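(* Let $\mathcal R$ be an ergodic p.m.p. equivalence relation on a standard probability space $(X,\mu)$, and let $\mathcal S\in\mathrm{Sub}(\mathcal R)$. The following are equivalent: (i) $\mathcal S$ is aperiodic and has everywhere infinite index in $\mathcal R$; (ii) $\mathcal S$ is aperiodic and the closure of the $[\mathcal R]$-orbit of $\mathcal S$ contains $\Delta_X$; (iii) $\mathcal S$ is aperiodic and the closure of the $\mathrm{Aut}(\mathcal R)$-orbit of $\mathcal S$ contains $\Delta_X$; (iv) the closure of the $[\mathcal R]$-orbit of $\mathcal S$ contains $\mathrm{Sub}_{\mathrm{hyp}}(\mathcal R)$; (v) the closure of the $\mathrm{Aut}(\mathcal R)$-orbit of $\mathcal S$ contains $\mathrm{Sub}_{\mathrm{hyp}}(\mathcal R)$.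
   Context: Standard probability spaces are atomless. A p.m.p. equivalence relation $\mathcal R$ on $(X,\mu)$ is the orbit equivalence relation of a measure-preserving Borel action of a countable group on $(X,\mu)$. It is ergodic if every $\mathcal R$-invariant Borel set is null or conull, aperiodic if almost all its classes are infinite, and hyperfinite if on a conull set it is an increasing union of Borel equivalence relations with finite classes. Everything is considered up to null sets. $\Delta_X=\{(x,x):x\in X\}$. Equip $\mathcal R$ with the measure $M(A)=\int_X|A_x|\,d\mu(x)$, where $A_x=\{y:(x,y)\in A\}$; $\mathrm{MAlg}(\mathcal R,M)$ is the space of Borel subsets of $\mathcal R$ modulo $M$-null sets with the topology of the metric $d_m(A,B)=m(A\triangle B)$, for $m$ any finite measure equivalent to $M$ (the topology does not depend on $m$). $\mathrm{Sub}(\mathcal R)\subseteq\mathrm{MAlg}(\mathcal R,M)$ is the subspace of (classes of) Borel equivalence relations on $X$ contained in $\mathcal R$, and $\mathrm{Sub}_{\mathrm{hyp}}(\mathcal R)$ is its subset of hyperfinite ones; closures are taken in $\mathrm{Sub}(\mathcal R)$. $\mathrm{Aut}(\mathcal R)$ is the group of all measure-preserving automorphisms $T$ of $(X,\mu)$ (mod null sets) such that $(T\times T)(\mathcal R)=\mathcal R$ up to null sets, and the full group $[\mathcal R]\leq\mathrm{Aut}(\mathcal R)$ consists of those $T$ with $(x,T(x))\in\mathcal R$ for almost every $x$. These act on $\mathrm{Sub}(\mathcal R)$ by $T\cdot\mathcal S=(T\times T)(\mathcal S)$. $\mathcal S$ has everywhere infinite index in $\mathcal R$ if for every Borel $A\subseteq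 X$ with $\mu(A)>0$, for almost every $x\in A$ the $\mathcal R_{\restriction A}$-class of $x$ contains infinitely many distinct $\mathcal S_{\restriction A}$-classes, where $\mathcal R_{\restriction A}=\mathcal R\cap(A\times A)$. *)

theory Defs
  imports "HOL-Analysis.Analysis" "HOL-Probability.Probability" "HOL-Algebra.Group_Action"
begin

section \<open>Standard probability spaces\<close>

definition standard_borel :: "'a measure \<Rightarrow> bool" where
  "standard_borel M \<longleftrightarrow>
     (\<exists>T. completely_metrizable_space T \<and> second_countable T \<and> topspace T = space M \<and>
          sets M = sigma_sets (space M) {U. openin T U})"

definition atomless :: "'a measure \<Rightarrow> bool" where
  "atomless M \<longleftrightarrow>
     (\<forall>A\<in>sets M. emeasure M A > 0 \<longrightarrow>
        (\<exists>B\<in>sets M. B \<subseteq> A \<and> 0 < emeasure M B \<and> emeasure M B < emeasure M A))"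

definition standard_prob_space :: "'a measure \<Rightarrow> bool" where
  "standard_prob_space M \<longleftrightarrow> prob_space M \<and> standard_borel M \<and> atomless M"

definition measure_pres :: "'a measure \<Rightarrow> ('a \<Rightarrow> 'a) \<Rightarrow> bool" where
  "measure_pres M T \<longleftrightarrow> T \<in> measurable M M \<and> distr M M T = M"


section \<open>P.m.p. equivalence relations\<close>

definition borel_equiv :: "'a measure \<Rightarrow> ('a \<times> 'a) set \<Rightarrow> bool" where
  "borel_equiv M S \<longleftrightarrow> equiv (space M) S \<and> S \<in> sets (M \<Otimes>\<^sub>M M)"

text \<open>Every countable group is isomorphic to one whose carrier is a set of natural numbers, so
  no generality is lost by letting the acting group live on the type \<open>nat\<close>.\<close>

definition pmp_equiv :: "'a measure \<Rightarrow> ('a \<times> 'a) set \<Rightarrow> bool" where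
  "pmp_equiv M R \<longleftrightarrow>
     (\<exists>(G :: nat monoid) \<phi>.
        group_action G (space M) \<phi> \<and> (\<forall>g\<in>carrier G. measure_pres M (\<phi> g)) \<and>
        R = {(x, y). x \<in> space M \<and> y \<in> orbit G \<phi> x})"

definition ergodic_rel :: "'a measure \<Rightarrow> ('a \<times> 'a) set \<Rightarrow> bool" where
  "ergodic_rel M R \<longleftrightarrow>
     (\<forall>A\<in>sets M. R `` A = A \<longrightarrow> emeasure M A = 0 \<or> emeasure M (space M - A) = 0)"

definition aperiodic_rel :: "'a measure \<Rightarrow> ('a \<times> 'a) set \<Rightarrow> bool" where
  "aperiodic_rel M S \<longleftrightarrow> (AE x in M. infinite (S `` {x}))"

definition hyperfinite_rel :: "'a measure \<Rightarrow> ('a \<times> 'a) set \<Rightarrow> bool" where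
  "hyperfinite_rel M S \<longleftrightarrow>
     (\<exists>X0\<in>sets M. emeasure M (space M - X0) = 0 \<and>
        (\<exists>F :: nat \<Rightarrow> ('a \<times> 'a) set.
           (\<forall>n. equiv X0 (F n) \<and> F n \<in> sets (M \<Otimes>\<^sub>M M) \<and> (\<forall>x\<in>X0. finite (F n `` {x})) \<and>
                F n \<subseteq> F (Suc n)) \<and>
           S \<inter> (X0 \<times> X0) = (\<Union>n. F n)))"

definition everywhere_infinite_index ::
    "'a measure \<Rightarrow> ('a \<times> 'a) set \<Rightarrow> ('a \<times> 'a) set \<Rightarrow> bool" where
  "everywhere_infinite_index M R S \<longleftrightarrow>
     (\<forall>A\<in>sets M. emeasure M A > 0 \<longrightarrow>
        (AE x in M. x \<in> A \<longrightarrow>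
           infinite (((R \<inter> (A \<times> A)) `` {x}) // (S \<inter> (A \<times> A)))))"


section \<open>The measure algebra and the space of subrelations\<close>

definition rel_measure :: "'a measure \<Rightarrow> ('a \<times> 'a) set \<Rightarrow> ('a \<times> 'a) measure" where
  "rel_measure M R =
     measure_of R {A \<in> sets (M \<Otimes>\<^sub>M M). A \<subseteq> R}
       (\<lambda>A. \<integral>\<^sup>+x. emeasure (count_space UNIV) (A `` {x}) \<partial>M)"

definition mclass :: "'b measure \<Rightarrow> 'b set \<Rightarrow> 'b set set" where
  "mclass N A = {B \<in> sets N. sym_diff A B \<in> null_sets N}"

definition MAlg :: "'b measure \<Rightarrow> 'b set set set" where
  "MAlg N = mclass N ` sets N"

text \<open>On classes modulo \<open>m\<close>-null sets the choice of representatives is irrelevant.\<close>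

definition malg_dist :: "'b measure \<Rightarrow> 'b set set \<Rightarrow> 'b set set \<Rightarrow> real" where
  "malg_dist m C D = measure m (sym_diff (SOME A. A \<in> C) (SOME B. B \<in> D))"

definition equivalent_finite_measure :: "'b measure \<Rightarrow> 'b measure \<Rightarrow> bool" where
  "equivalent_finite_measure N m \<longleftrightarrow>
     finite_measure m \<and> sets m = sets N \<and> null_sets m = null_sets N"

definition malg_topology :: "'b measure \<Rightarrow> 'b measure \<Rightarrow> 'b set set topology" where
  "malg_topology N m = Metric_space.mtopology (MAlg N) (malg_dist m)"

definition Sub :: "'a measure \<Rightarrow> ('a \<times> 'a) set \<Rightarrow> ('a \<times> 'a) set set set" where
  "Sub M R = {mclass (rel_measure M R) S | S. borel_equiv M S \<and> S \<subseteq> R}"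

definition Sub_hyp :: "'a measure \<Rightarrow> ('a \<times> 'a) set \<Rightarrow> ('a \<times> 'a) set set set" where
  "Sub_hyp M R =
     {mclass (rel_measure M R) S | S. borel_equiv M S \<and> S \<subseteq> R \<and> hyperfinite_rel M S}"

definition Sub_topology ::
    "'a measure \<Rightarrow> ('a \<times> 'a) set \<Rightarrow> ('a \<times> 'a) measure \<Rightarrow> ('a \<times> 'a) set set topology" where
  "Sub_topology M R m = subtopology (malg_topology (rel_measure M R) m) (Sub M R)"


section \<open>Automorphisms, full group and orbits\<close>

text \<open>A measure-preserving automorphism modulo null sets is represented by a Borel bijection of
  the whole space; its values outside \<open>space M\<close> play no role.\<close>

definition mp_automorphism :: "'a measure \<Rightarrow> ('a \<Rightarrow> 'a) \<Rightarrow> bool" where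
  "mp_automorphism M T \<longleftrightarrow>
     measure_pres M T \<and> bij_betw T (space M) (space M) \<and>
     the_inv_into (space M) T \<in> measurable M M"

text \<open>Equality up to null sets for subsets of \<open>X \<times> X\<close> not assumed to lie in \<open>R\<close>: almost every
  fibre of the symmetric difference is empty, that is,
  \<open>\<integral> |(A \<triangle> B)\<^sub>x| d\<mu>(x) = 0\<close>.\<close>

definition rel_eq_ae :: "'a measure \<Rightarrow> ('a \<times> 'a) set \<Rightarrow> ('a \<times> 'a) set \<Rightarrow> bool" where
  "rel_eq_ae M A B \<longleftrightarrow> (AE x in M. A `` {x} = B `` {x})"

definition Aut_rel :: "'a measure \<Rightarrow> ('a \<times> 'a) set \<Rightarrow> ('a \<Rightarrow> 'a) set" where
  "Aut_rel M R = {T. mp_automorphism M T \<and> rel_eq_ae M (map_prod T T ` R) R}"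

definition full_group :: "'a measure \<Rightarrow> ('a \<times> 'a) set \<Rightarrow> ('a \<Rightarrow> 'a) set" where
  "full_group M R = {T \<in> Aut_rel M R. AE x in M. (x, T x) \<in> R}"

text \<open>For \<open>T\<close> in \<open>Aut_rel M R\<close> the image \<open>(T \<times> T)(S)\<close> is contained in \<open>R\<close> only up to null sets;
  intersecting with \<open>R\<close> selects a representative contained in \<open>R\<close>.\<close>

definition sub_orbit ::
    "'a measure \<Rightarrow> ('a \<times> 'a) set \<Rightarrow> ('a \<Rightarrow> 'a) set \<Rightarrow> ('a \<times> 'a) set \<Rightarrow> ('a \<times> 'a) set set set" where
  "sub_orbit M R H S = {mclass (rel_measure M R) (map_prod T T ` S \<inter> R) | T. T \<in> H}"


section \<open>Well-definedness\<close>

text \<open>\<open>measure_of\<close> and \<open>Metric_space.mtopology\<close> are total and return junk when their side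
  conditions fail; the following facts show that the side conditions hold here.\<close>

lemma mclass_self: "A \<in> sets N \<Longrightarrow> A \<in> mclass N A"
  by (simp add: mclass_def)

lemma mclass_eq_iff:
  assumes A: "A \<in> sets N" and B: "B \<in> sets N"
  shows "mclass N A = mclass N B \<longleftrightarrow> sym_diff A B \<in> null_sets N"
proof
  assume "mclass N A = mclass N B"
  then have "B \<in> mclass N A" using mclass_self[OF B] by simp
  then show "sym_diff A B \<in> null_sets N" by (simp add: mclass_def)
next
  assume n: "sym_diff A B \<in> null_sets N"
  have *: "sym_diff U W \<in> null_sets N"
    if "sym_diff U V \<in> null_sets N" "sym_diff V W \<in> null_sets N" "U \<in> sets N" "W \<in> sets N"
    for U V W
  proof (rule null_sets_subset)
    show "sym_diff U V \<union> sym_diff V W \<in> null_sets N" by (rule null_sets.Un[OF that(1,2)])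
    show "sym_diff U W \<in> sets N" using that by auto
  qed auto
  have n': "sym_diff B A \<in> null_sets N" using n by (simp add: Un_commute)
  show "mclass N A = mclass N B"
    unfolding mclass_def using *[OF n _ A] *[OF n' _ B] by blast
qed

lemma malg_dist_eq:
  assumes m: "equivalent_finite_measure N m" and A: "A \<in> sets N" and B: "B \<in> sets N"
  shows "malg_dist m (mclass N A) (mclass N B) = measure m (sym_diff A B)"
proof -
  interpret finite_measure m using m by (simp add: equivalent_finite_measure_def)
  define A' where "A' = (SOME X. X \<in> mclass N A)"
  define B' where "B' = (SOME X. X \<in> mclass N B)"
  have "A' \<in> mclass N A" unfolding A'_def using mclass_self[OF A] by (rule someI)
  then have A': "A' \<in> sets m" "sym_diff A A' \<in> null_sets m"
    using m by (auto simp: mclass_def equivalent_finite_measure_def)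
  have "B' \<in> mclass N B" unfolding B'_def using mclass_self[OF B] by (rule someI)
  then have B': "B' \<in> sets m" "sym_diff B B' \<in> null_sets m"
    using m by (auto simp: mclass_def equivalent_finite_measure_def)
  have s: "A \<in> sets m" "B \<in> sets m" using A B m by (auto simp: equivalent_finite_measure_def)
  have "AE x in m. x \<in> sym_diff A' B' \<longleftrightarrow> x \<in> sym_diff A B"
    using AE_not_in[OF A'(2)] AE_not_in[OF B'(2)] by eventually_elim auto
  then have "measure m (sym_diff A' B') = measure m (sym_diff A B)"
    using A' B' s by (intro measure_eq_AE) auto
  then show ?thesis by (simp add: malg_dist_def A'_def B'_def)
qed

lemma Metric_space_MAlg:
  assumes m: "equivalent_finite_measure N m"
  shows "Metric_space (MAlg N) (malg_dist m)"
proof -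
  interpret finite_measure m using m by (simp add: equivalent_finite_measure_def)
  have s: "sets m = sets N" and n: "null_sets m = null_sets N"
    using m by (auto simp: equivalent_finite_measure_def)
  show ?thesis
  proof
    show "0 \<le> malg_dist m C D" for C D by (simp add: malg_dist_def)
    show "malg_dist m C D = malg_dist m D C" for C D
      unfolding malg_dist_def by (subst Un_commute) (rule refl)
  next
    fix C D assume "C \<in> MAlg N" "D \<in> MAlg N"
    then obtain A B where AB: "A \<in> sets N" "B \<in> sets N" "C = mclass N A" "D = mclass N B"
      by (auto simp: MAlg_def)
    have "sym_diff A B \<in> sets m" using AB s by auto
    then have "measure m (sym_diff A B) = 0 \<longleftrightarrow> sym_diff A B \<in> null_sets m"
      by (auto simp: null_sets_def emeasure_eq_measure)
    then show "malg_dist m C D = 0 \<longleftrightarrow> C = D"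
      using AB n by (simp add: malg_dist_eq[OF m] mclass_eq_iff)
  next
    fix C D E assume "C \<in> MAlg N" "D \<in> MAlg N" "E \<in> MAlg N"
    then obtain A B F where AB: "A \<in> sets N" "B \<in> sets N" "F \<in> sets N"
      "C = mclass N A" "D = mclass N B" "E = mclass N F"
      by (auto simp: MAlg_def)
    have "measure m (sym_diff A F) \<le> measure m (sym_diff A B \<union> sym_diff B F)"
      using AB s by (intro finite_measure_mono) auto
    also have "\<dots> \<le> measure m (sym_diff A B) + measure m (sym_diff B F)"
      using AB s by (intro measure_Un_le) auto
    finally show "malg_dist m C E \<le> malg_dist m C D + malg_dist m D E"
      using AB by (simp add: malg_dist_eq[OF m])
  qed
qed

lemma standard_borel_diagonal:
  assumes "standard_borel M"
  shows "Id_on (space M) \<in> sets (M \<Otimes>\<^sub>M M)"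
proof -
  from assms obtain T where T: "completely_metrizable_space T" "second_countable T"
      "topspace T = space M" "sets M = sigma_sets (space M) {U. openin T U}"
    unfolding standard_borel_def by blast
  from T(2) obtain B where B0: "countable B" "\<forall>V\<in>B. openin T V"
      "\<forall>U x. openin T U \<and> x \<in> U \<longrightarrow> (\<exists>V\<in>B. x \<in> V \<and> V \<subseteq> U)"
    unfolding second_countable_def by (elim exE conjE)
  have B: "countable B" "\<And>V. V \<in> B \<Longrightarrow> openin T V"
      "\<And>U x. openin T U \<Longrightarrow> x \<in> U \<Longrightarrow> \<exists>V\<in>B. x \<in> V \<and> V \<subseteq> U"
    using B0 by simp_all
  have H: "Hausdorff_space T"
    using T(1) completely_metrizable_imp_metrizable_space metrizable_imp_Hausdorff_space by blast
  have Bs: "V \<in> sets M" if "V \<in> B" for V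
    unfolding T(4) using B(2)[OF that] by (intro sigma_sets.Basic) simp
  have "Id_on (space M) = space M \<times> space M - (\<Union>V\<in>B. V \<times> (space M - V))"
  proof (intro Set.set_eqI iffI)
    fix z assume "z \<in> space M \<times> space M - (\<Union>V\<in>B. V \<times> (space M - V))"
    then obtain x y where xy: "z = (x, y)" "x \<in> space M" "y \<in> space M"
      and no: "\<And>V. V \<in> B \<Longrightarrow> x \<in> V \<Longrightarrow> y \<in> V" by (cases z) blast
    have "x = y"
    proof (rule ccontr)
      assume "x \<noteq> y"
      with H xy T(3) have "\<exists>U W. openin T U \<and> openin T W \<and> x \<in> U \<and> y \<in> W \<and> disjnt U W"
        unfolding Hausdorff_space_def by simp
      then obtain U W where "openin T U" "x \<in> U" "y \<in> W" "disjnt U W" by blast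
      then show False using B(3)[of U x] no unfolding disjnt_def by blast
    qed
    then show "z \<in> Id_on (space M)" using xy by auto
  qed auto
  moreover have "(\<Union>V\<in>B. V \<times> (space M - V)) \<in> sets (M \<Otimes>\<^sub>M M)"
    using Bs by (intro sets.countable_UN'' B(1) pair_measureI sets.compl_sets)
  ultimately show ?thesis by (simp add: pair_measureI sets.Diff)
qed

lemma orbit_relation_measure:
  assumes M: "standard_borel M"
    and C': "\<forall>n\<in>C. \<phi> n \<in> measurable M M"
    and R: "R = {(x, y). x \<in> space M \<and> (\<exists>n\<in>C. y = \<phi> n x)}"
  shows "\<And>A. A \<in> sets (M \<Otimes>\<^sub>M M) \<Longrightarrow> A \<subseteq> R \<Longrightarrow>
           (\<lambda>x. emeasure (count_space UNIV) (A `` {x})) \<in> borel_measurable M"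
    and "\<And>n :: nat. n \<in> C \<Longrightarrow> {(x, y). x \<in> space M \<and> y = \<phi> n x} \<in> sets (M \<Otimes>\<^sub>M M)"
proof -
  note diag = standard_borel_diagonal[OF M] and C = bspec[OF C']
  fix A assume A: "A \<in> sets (M \<Otimes>\<^sub>M M)" "A \<subseteq> R"
  define E where "E k n = {x \<in> space M. \<phi> k x = \<phi> n x}" for k n
  define D where "D n = (if n \<in> C then {x \<in> space M. (x, \<phi> n x) \<in> A} - (\<Union>k\<in>{k. k < n \<and> k \<in> C}. E k n)
    else {})" for n
  have E: "E k n \<in> sets M" if "k \<in> C" "n \<in> C" for k n
  proof -
    have "(\<lambda>x. (\<phi> k x, \<phi> n x)) -` Id_on (space M) \<inter> space M \<in> sets M"
      using C[OF that(1)] C[OF that(2)] diag by (intro measurable_sets) auto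
    also have "(\<lambda>x. (\<phi> k x, \<phi> n x)) -` Id_on (space M) \<inter> space M = E k n"
      using measurable_space[OF C[OF that(1)]] measurable_space[OF C[OF that(2)]]
      by (auto simp: E_def Id_on_def)
    finally show ?thesis .
  qed
  have D: "D n \<in> sets M" for n
  proof (cases "n \<in> C")
    case True
    have "(\<lambda>x. (x, \<phi> n x)) -` A \<inter> space M \<in> sets M"
      using C[OF True] A by (intro measurable_sets) auto
    moreover have "(\<lambda>x. (x, \<phi> n x)) -` A \<inter> space M = {x \<in> space M. (x, \<phi> n x) \<in> A}" by auto
    moreover have "(\<Union>k\<in>{k. k < n \<and> k \<in> C}. E k n) \<in> sets M"
      using E True by (intro sets.finite_UN) auto
    ultimately show ?thesis using True by (simp add: D_def)
  qed (simp add: D_def)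
  have count: "emeasure (count_space UNIV) (A `` {x}) = (\<Sum>n. indicator (D n) x)" if x: "x \<in> space M" for x
  proof -
    define F where "F n = (if x \<in> D n then {\<phi> n x} else {})" for n
    have disj: "disjoint_family F"
    proof (unfold disjoint_family_on_def, intro ballI impI)
      have *: "F k \<inter> F n = {}" if "k < n" for k n
        using that x by (auto simp: F_def D_def E_def split: if_splits)
      fix k n :: nat assume "k \<noteq> n"
      then show "F k \<inter> F n = {}" using *[of k n] *[of n k] by (cases "k < n") auto
    qed
    have "A `` {x} = (\<Union>n. F n)"
    proof (intro Set.set_eqI iffI)
      fix y assume "y \<in> A `` {x}"
      then have xy: "(x, y) \<in> A" by auto
      then have ex: "\<exists>n. n \<in> C \<and> y = \<phi> n x" using A(2) R by auto
      define n where "n = (LEAST n. n \<in> C \<and> y = \<phi> n x)"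
      have n: "n \<in> C" "y = \<phi> n x" using LeastI_ex[OF ex] by (auto simp: n_def)
      have nless: "\<not> (k \<in> C \<and> y = \<phi> k x)" if "k < n" for k
        using that not_less_Least by (auto simp: n_def)
      have less: "\<phi> k x \<noteq> \<phi> n x" if "k < n" "k \<in> C" for k
        using nless[OF that(1)] that(2) n(2) by metis
      have "x \<in> D n" using n x xy less by (auto simp: D_def E_def)
      then have "y \<in> F n" using n by (simp add: F_def)
      then show "y \<in> (\<Union>n. F n)" by blast
    qed (auto simp: F_def D_def split: if_splits)
    then have "emeasure (count_space UNIV) (A `` {x}) = emeasure (count_space UNIV) (\<Union>n. F n)"
      by simp
    also have "\<dots> = (\<Sum>n. emeasure (count_space UNIV) (F n))"
      by (rule suminf_emeasure[symmetric]) (use disj in auto)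
    also have "\<dots> = (\<Sum>n. indicator (D n) x)"
      by (intro suminf_cong) (auto simp: F_def indicator_def)
    finally show ?thesis .
  qed
  have "(\<lambda>x. \<Sum>n. indicator (D n) x :: ennreal) \<in> borel_measurable M"
    using D by measurable
  then show "(\<lambda>x. emeasure (count_space UNIV) (A `` {x})) \<in> borel_measurable M"
    using count by (subst measurable_cong) auto
next
  note C = bspec[OF C']
  fix n assume n: "n \<in> C"
  have "(\<lambda>z. (\<phi> n (fst z), snd z)) -` Id_on (space M) \<inter> space (M \<Otimes>\<^sub>M M) \<in> sets (M \<Otimes>\<^sub>M M)"
    using C[OF n] standard_borel_diagonal[OF M] by (intro measurable_sets) auto
  also have "(\<lambda>z. (\<phi> n (fst z), snd z)) -` Id_on (space M) \<inter> space (M \<Otimes>\<^sub>M M)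
      = {(x, y). x \<in> space M \<and> y = \<phi> n x}"
  proof (rule Set.set_eqI)
    fix z
    show "z \<in> (\<lambda>z. (\<phi> n (fst z), snd z)) -` Id_on (space M) \<inter> space (M \<Otimes>\<^sub>M M)
        \<longleftrightarrow> z \<in> {(x, y). x \<in> space M \<and> y = \<phi> n x}"
      using measurable_space[OF C[OF n], of "fst z"]
      by (cases z) (simp add: space_pair_measure Id_on_iff, metis)
  qed
  finally show "{(x, y). x \<in> space M \<and> y = \<phi> n x} \<in> sets (M \<Otimes>\<^sub>M M)" .
qed

lemma pmp_equivE:
  assumes "pmp_equiv M R"
  obtains C :: "nat set" and \<phi> where "\<forall>n\<in>C. \<phi> n \<in> measurable M M"
    "R = {(x, y). x \<in> space M \<and> (\<exists>n\<in>C. y = \<phi> n x)}"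
proof -
  from assms obtain G :: "nat monoid" and \<phi>
    where "\<forall>g\<in>carrier G. measure_pres M (\<phi> g)"
      and "R = {(x, y). x \<in> space M \<and> y \<in> orbit G \<phi> x}"
    unfolding pmp_equiv_def by blast
  then show ?thesis
    by (intro that[of "carrier G" \<phi>]) (auto simp: measure_pres_def orbit_def)
qed

lemma pmp_equiv_sets:
  assumes "standard_borel M" "pmp_equiv M R"
  shows "R \<in> sets (M \<Otimes>\<^sub>M M)"
proof -
  obtain C :: "nat set" and \<phi> where C: "\<forall>n\<in>C. \<phi> n \<in> measurable M M"
    and R: "R = {(x, y). x \<in> space M \<and> (\<exists>n\<in>C. y = \<phi> n x)}"
    using assms(2) by (rule pmp_equivE)
  have "(\<Union>n\<in>C. {(x, y). x \<in> space M \<and> y = \<phi> n x}) \<in> sets (M \<Otimes>\<^sub>M M)"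
    using orbit_relation_measure(2)[OF assms(1) C R] by (intro sets.countable_UN'') auto
  also have "(\<Union>n\<in>C. {(x, y). x \<in> space M \<and> y = \<phi> n x}) = R" using R by auto
  finally show ?thesis .
qed

lemma
  assumes M: "standard_borel M" and R: "pmp_equiv M R"
  shows space_rel_measure: "space (rel_measure M R) = R"
    and sets_rel_measure: "sets (rel_measure M R) = {A \<in> sets (M \<Otimes>\<^sub>M M). A \<subseteq> R}"
    and emeasure_rel_measure: "A \<in> sets (M \<Otimes>\<^sub>M M) \<Longrightarrow> A \<subseteq> R \<Longrightarrow>
      emeasure (rel_measure M R) A = (\<integral>\<^sup>+x. emeasure (count_space UNIV) (A `` {x}) \<partial>M)"
proof -
  let ?S = "{A \<in> sets (M \<Otimes>\<^sub>M M). A \<subseteq> R}"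
  let ?f = "\<lambda>A. \<integral>\<^sup>+x. emeasure (count_space UNIV) (A `` {x}) \<partial>M"
  note Rs = pmp_equiv_sets[OF M R]
  obtain C :: "nat set" and \<phi> where C: "\<forall>n\<in>C. \<phi> n \<in> measurable M M"
    and R': "R = {(x, y). x \<in> space M \<and> (\<exists>n\<in>C. y = \<phi> n x)}"
    using R by (rule pmp_equivE)
  note meas = orbit_relation_measure(1)[OF M C R']
  have "sets (restrict_space (M \<Otimes>\<^sub>M M) R) = ?S"
    using Rs by (subst sets_restrict_space_iff[symmetric] | auto simp: sets_restrict_space)+
  moreover have "space (restrict_space (M \<Otimes>\<^sub>M M) R) = R"
    using sets.sets_into_space[OF Rs] by (auto simp: space_restrict_space)
  ultimately have sa: "sigma_algebra R ?S"
    using sets.sigma_algebra_axioms[of "restrict_space (M \<Otimes>\<^sub>M M) R"] by simp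
  have P: "?S \<subseteq> Pow R" by auto
  show "space (rel_measure M R) = R"
    unfolding rel_measure_def using P by (rule space_measure_of)
  show s: "sets (rel_measure M R) = ?S"
    unfolding rel_measure_def using sigma_algebra.sets_measure_of_eq[OF sa] by simp
  have ca: "countably_additive (sets (rel_measure M R)) ?f"
    unfolding s
  proof (rule countably_additiveI)
    fix F :: "nat \<Rightarrow> _" assume F: "range F \<subseteq> ?S" "disjoint_family F"
    have "?f (\<Union>i. F i) = (\<integral>\<^sup>+x. (\<Sum>i. emeasure (count_space UNIV) (F i `` {x})) \<partial>M)"
    proof (intro nn_integral_cong)
      fix x
      have "disjoint_family (\<lambda>i. F i `` {x})" using F(2) by (fastforce simp: disjoint_family_on_def)
      then have "(\<Sum>i. emeasure (count_space UNIV) (F i `` {x}))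
          = emeasure (count_space UNIV) (\<Union>i. F i `` {x})"
        by (intro suminf_emeasure) auto
      moreover have "(\<Union>i. F i) `` {x} = (\<Union>i. F i `` {x})" by auto
      ultimately show "emeasure (count_space UNIV) ((\<Union>i. F i) `` {x})
          = (\<Sum>i. emeasure (count_space UNIV) (F i `` {x}))" by simp
    qed
    also have "\<dots> = (\<Sum>i. ?f (F i))"
      using F(1) by (intro nn_integral_suminf meas) auto
    finally show "(\<Sum>i. ?f (F i)) = ?f (\<Union>i. F i)" by simp
  qed
  show "emeasure (rel_measure M R) A = ?f A" if "A \<in> sets (M \<Otimes>\<^sub>M M)" "A \<subseteq> R"
    using that s ca P
    by (intro emeasure_measure_of[OF rel_measure_def]) (auto simp: positive_def)
qed

lemma equivalent_finite_measure_exists: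
  assumes M: "standard_prob_space M" and R: "pmp_equiv M R"
  shows "\<exists>m. equivalent_finite_measure (rel_measure M R) m"
proof -
  interpret prob_space M using M by (simp add: standard_prob_space_def)
  let ?N = "rel_measure M R"
  have sb: "standard_borel M" using M by (simp add: standard_prob_space_def)
  obtain C :: "nat set" and \<phi> where C: "\<forall>n\<in>C. \<phi> n \<in> measurable M M"
    and R': "R = {(x, y). x \<in> space M \<and> (\<exists>n\<in>C. y = \<phi> n x)}"
    using R by (rule pmp_equivE)
  define \<Gamma> where "\<Gamma> n = {(x, y). x \<in> space M \<and> y = \<phi> n x}" for n
  have \<Gamma>: "\<Gamma> n \<in> sets (M \<Otimes>\<^sub>M M)" "\<Gamma> n \<subseteq> R" if "n \<in> C" for n
    using orbit_relation_measure(2)[OF sb C R' that] R' that by (auto simp: \<Gamma>_def)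
  have fin: "emeasure ?N (\<Gamma> n) \<noteq> \<infinity>" if "n \<in> C" for n
  proof -
    have "emeasure ?N (\<Gamma> n) = (\<integral>\<^sup>+x. emeasure (count_space UNIV) (\<Gamma> n `` {x}) \<partial>M)"
      using emeasure_rel_measure[OF sb R \<Gamma>[OF that]] .
    also have "\<dots> = (\<integral>\<^sup>+x. 1 \<partial>M)"
    proof (intro nn_integral_cong)
      fix x assume "x \<in> space M"
      then have "\<Gamma> n `` {x} = {\<phi> n x}" by (auto simp: \<Gamma>_def)
      then show "emeasure (count_space UNIV) (\<Gamma> n `` {x}) = 1" by simp
    qed
    finally show ?thesis by (simp add: emeasure_space_1)
  qed
  have "sigma_finite_measure ?N"
  proof (rule sigma_finite_measure.intro, intro exI conjI)
    show "countable (\<Gamma> ` C)" by auto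
    show "\<Gamma> ` C \<subseteq> sets ?N" using \<Gamma> by (auto simp: sets_rel_measure[OF sb R])
    show "\<Union> (\<Gamma> ` C) = space ?N" unfolding space_rel_measure[OF sb R] by (subst R') (auto simp: \<Gamma>_def)
    show "\<forall>a\<in>\<Gamma> ` C. emeasure ?N a \<noteq> \<infinity>" using fin by auto
  qed
  then obtain h where h: "h \<in> borel_measurable ?N" "integral\<^sup>N ?N h \<noteq> \<infinity>"
      "\<forall>x\<in>space ?N. 0 < h x \<and> h x < \<infinity>"
    using sigma_finite_measure.Ex_finite_integrable_function by blast
  have "finite_measure (density ?N h)"
    using h by (intro finite_measureI) (simp add: emeasure_density cong: nn_integral_cong)
  moreover have "null_sets (density ?N h) = null_sets ?N"
  proof (rule Set.set_eqI)
    fix A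
    have "A \<in> null_sets (density ?N h) \<longleftrightarrow> A \<in> sets ?N \<and> (AE x in ?N. x \<in> A \<longrightarrow> h x = 0)"
      using null_sets_density_iff[OF h(1)] .
    also have "\<dots> \<longleftrightarrow> A \<in> sets ?N \<and> (AE x in ?N. x \<notin> A)"
      using h(3) by (intro conj_cong refl AE_cong) auto
    also have "\<dots> \<longleftrightarrow> A \<in> null_sets ?N"
      using AE_iff_null_sets by blast
    finally show "A \<in> null_sets (density ?N h) \<longleftrightarrow> A \<in> null_sets ?N" .
  qed
  ultimately show ?thesis unfolding equivalent_finite_measure_def by auto
qed

end

theory Submission
  imports Defs
begin

text \<open>Let \<open>F \<subseteq> R\<close> be a relation with finite classes and let \<open>L\<close> be finite. If \<open>S\<close> is aperiodic and has
  everywhere infinite index, a greedy choice assigns to the classes of \<open>F\<close> disjoint tuples of points,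
  each inside a single \<open>S\<close>-class, such that classes joined by one of the first \<open>L\<close> generators of \<open>R\<close>
  receive \<open>S\<close>-inequivalent tuples. A class without a tuple would, together with an uncovered set \<open>B\<close> of
  positive measure, contradict maximality: in \<open>B\<close> it sees infinitely many \<open>S\<close>-classes, all infinite,
  and only finitely many are forbidden. The assignment is an element of the full group carrying \<open>F\<close> to
  \<open>S\<close> along these generators, so \<open>F\<close>, and hence every hyperfinite relation, is in the closure of the
  orbit of \<open>S\<close>.

  Conversely, \<open>R\<close> contains a relation \<open>E\<close> almost all of whose classes have exactly \<open>N\<close> elements. If \<open>S\<close>
  has finite index on a set of positive measure then, for large \<open>N\<close>, every image of \<open>S\<close> meets \<open>E\<close> off the
  diagonal in a set whose measure is bounded below; and if many \<open>S\<close>-classes are small, every image of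
  \<open>S\<close> misses a part of \<open>E\<close> whose measure is bounded below.\<close>

text \<open>Two difficulties shape the proof. The metric of \<open>m\<close> is not invariant under
  the group: \<open>m\<close> is only equivalent to the measure of R, which is infinite because
  almost every class is. Up to a small error \<open>m\<close> sees only the pairs joined by finitely
  many generators, so agreement along \<open>L\<close> of them is enough; and since \<open>F\<close>
  has finite classes, only finitely many S-classes are then forbidden at each choice. Lower bounds
  are proved on a relation \<open>E\<close> of finite measure and transferred to \<open>m\<close> by
  absolute continuity. They are uniform because the set where S behaves badly keeps its measure
  under every automorphism. Secondly, a maximal assignment may exhaust the targets instead of
  serving every class. Mass transport reduces one outcome to the other: sources and targets of an
  injective assignment inside the classes of R have the same measure, and the space has measure
  1.\<close>

section \<open>Mass transport and partial bijections\<close>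

text \<open>Quantifiers over a class of R become countable quantifiers over the generators
  \<open>g n\<close>, which keeps the sets below Borel; \<open>gi n\<close> recovers a source from a
  target. The injection \<open>c\<close> serves as a linear order for choosing points and, through
  rational intervals, for separating finitely many points.\<close>

locale pmp_rel = prob_space M for M :: "'a measure" +
  fixes R :: "('a \<times> 'a) set" and g gi :: "nat \<Rightarrow> 'a \<Rightarrow> 'a" and c :: "'a \<Rightarrow> real"
  assumes sb: "standard_borel M" and pe: "pmp_equiv M R"
    and c_meas [measurable]: "c \<in> borel_measurable M" and c_inj: "inj_on c (space M)"
    and R_eq: "R = {(x, y). x \<in> space M \<and> (\<exists>n. y = g n x)}"
    and R_equiv: "equiv (space M) R"
    and g_meas [measurable]: "\<And>n. g n \<in> measurable M M" "\<And>n. gi n \<in> measurable M M"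
    and g_gi: "\<And>n x. x \<in> space M \<Longrightarrow> g n (gi n x) = x" "\<And>n x. x \<in> space M \<Longrightarrow> gi n (g n x) = x"
    and g_pres: "\<And>n. distr M M (g n) = M" "\<And>n. distr M M (gi n) = M"
begin

section \<open>Measurability and null sets along the generators\<close>

lemma g_space [simp]: "x \<in> space M \<Longrightarrow> g n x \<in> space M" "x \<in> space M \<Longrightarrow> gi n x \<in> space M"
  using measurable_space[OF g_meas(1)] measurable_space[OF g_meas(2)] by auto

lemma g_R [simp]: "x \<in> space M \<Longrightarrow> (x, g n x) \<in> R"
  by (auto simp: R_eq)

lemma R_space: "(x, y) \<in> R \<Longrightarrow> x \<in> space M" "(x, y) \<in> R \<Longrightarrow> y \<in> space M"
  by (auto simp: R_eq)

lemma R_ex: "(x, y) \<in> R \<Longrightarrow> \<exists>n. y = g n x"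
  by (auto simp: R_eq)

lemma R_refl: "x \<in> space M \<Longrightarrow> (x, x) \<in> R"
  using R_equiv by (auto simp: equiv_def refl_on_def)

lemma R_sym: "(x, y) \<in> R \<Longrightarrow> (y, x) \<in> R"
  using R_equiv by (auto simp: equiv_def sym_def)

lemma R_trans: "(x, y) \<in> R \<Longrightarrow> (y, z) \<in> R \<Longrightarrow> (x, z) \<in> R"
  using R_equiv by (meson equiv_def transD)

lemma R_meas [measurable]: "R \<in> sets (M \<Otimes>\<^sub>M M)"
  using pmp_equiv_sets[OF sb pe] .

lemma Id_meas [measurable]: "Id_on (space M) \<in> sets (M \<Otimes>\<^sub>M M)"
  using standard_borel_diagonal[OF sb] .

lemma eq_meas [measurable]:
  assumes [measurable]: "f \<in> measurable N M" "h \<in> measurable N M"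
  shows "Measurable.pred N (\<lambda>x. f x = h x)"
proof -
  have "Measurable.pred N (\<lambda>x. (f x, h x) \<in> Id_on (space M))" by measurable
  moreover have "(f x, h x) \<in> Id_on (space M) \<longleftrightarrow> f x = h x" if "x \<in> space N" for x
    using measurable_space[OF assms(1) that] by (auto simp: Id_on_iff)
  ultimately show ?thesis
    using measurable_cong[of N "\<lambda>x. (f x, h x) \<in> Id_on (space M)" "\<lambda>x. f x = h x" "count_space UNIV"]
    by simp
qed

lemma rel_setI:
  assumes "Measurable.pred (M \<Otimes>\<^sub>M M) (\<lambda>z. P (fst z) (snd z))"
    and "\<And>x y. P x y \<Longrightarrow> x \<in> space M" "\<And>x y. P x y \<Longrightarrow> y \<in> space M"
  shows "{(x, y). P x y} \<in> sets (M \<Otimes>\<^sub>M M)"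
proof -
  have "{(x, y). P x y} = {z \<in> space (M \<Otimes>\<^sub>M M). P (fst z) (snd z)}"
    using assms(2,3) by (auto simp: space_pair_measure)
  then show ?thesis using assms(1) by simp
qed

lemma rel_setI':
  assumes "Measurable.pred (M \<Otimes>\<^sub>M M) (\<lambda>z. z \<in> R \<and> P (fst z) (snd z))"
  shows "{(x, y). (x, y) \<in> R \<and> P x y} \<in> sets (M \<Otimes>\<^sub>M M)"
  using assms by (intro rel_setI) (auto simp: R_space)

lemma pred_rel [measurable (raw)]:
  assumes A: "A \<in> sets (M \<Otimes>\<^sub>M M)" and [measurable]: "f \<in> measurable N M" "h \<in> measurable N M"
  shows "Measurable.pred N (\<lambda>x. (f x, h x) \<in> A)"
  using A by measurable

text \<open>Projections of Borel sets need not be Borel in general; here the sections lie in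
  countable classes, so a witness can be sought among the points \<open>g n x\<close>.\<close>

lemma Domain_meas:
  assumes A [measurable]: "A \<in> sets (M \<Otimes>\<^sub>M M)" and AR: "A \<subseteq> R"
  shows "Domain A \<in> sets M"
proof -
  have "Domain A = {x \<in> space M. \<exists>n. (x, g n x) \<in> A}"
  proof (intro Set.set_eqI iffI)
    fix x assume "x \<in> Domain A"
    then obtain y where "(x, y) \<in> A" by blast
    then show "x \<in> {x \<in> space M. \<exists>n. (x, g n x) \<in> A}"
      using AR R_ex[of x y] R_space[of x y] by auto
  qed auto
  then show ?thesis by simp
qed

lemma converse_meas:
  assumes A [measurable]: "A \<in> sets (M \<Otimes>\<^sub>M M)"
  shows "A\<inverse> \<in> sets (M \<Otimes>\<^sub>M M)"
proof -
  have "A\<inverse> = {(x, y). (y, x) \<in> A}" by auto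
  also have "\<dots> \<in> sets (M \<Otimes>\<^sub>M M)"
    using sets.sets_into_space[OF A] by (intro rel_setI) (auto simp: space_pair_measure)
  finally show ?thesis .
qed

lemma converse_R: "A \<subseteq> R \<Longrightarrow> A\<inverse> \<subseteq> R"
  using R_sym by auto

lemma Range_meas: "A \<in> sets (M \<Otimes>\<^sub>M M) \<Longrightarrow> A \<subseteq> R \<Longrightarrow> Range A \<in> sets M"
  using Domain_meas[of "A\<inverse>"] converse_meas converse_R by simp

lemma AE_g: "AE x in M. P x \<Longrightarrow> AE x in M. P (g n x)"
proof -
  assume "AE x in M. P x"
  then obtain N where N: "{x \<in> space M. \<not> P x} \<subseteq> N" "emeasure M N = 0" "N \<in> sets M" by (rule AE_E)
  have "emeasure M (g n -` N \<inter> space M) = emeasure (distr M M (g n)) N"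
    using N by (subst emeasure_distr) auto
  then have "g n -` N \<inter> space M \<in> null_sets M" using N g_pres by (auto simp: null_sets_def)
  moreover have "{x \<in> space M. \<not> P (g n x)} \<subseteq> g n -` N \<inter> space M"
    using N(1) g_space(1)[of _ n] by blast
  ultimately show ?thesis by (rule AE_I')
qed

text \<open>Each of the countably many generators preserves null sets, so the R-saturation of a null
  set is null.\<close>

lemma AE_rel: "AE x in M. P x \<Longrightarrow> AE x in M. \<forall>y. (x, y) \<in> R \<longrightarrow> P y"
proof -
  assume "AE x in M. P x"
  then have "AE x in M. \<forall>n. P (g n x)" using AE_g by (simp add: AE_all_countable)
  then show ?thesis by eventually_elim (auto simp: R_eq)
qed

section \<open>The measure on R and mass transport\<close>

abbreviation RM :: "('a \<times> 'a) measure" where "RM \<equiv> rel_measure M R"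

lemma sets_RM: "A \<in> sets RM \<longleftrightarrow> A \<in> sets (M \<Otimes>\<^sub>M M) \<and> A \<subseteq> R"
  using sets_rel_measure[OF sb pe] by simp

lemma fibre_meas:
  assumes "A \<in> sets (M \<Otimes>\<^sub>M M)" "A \<subseteq> R"
  shows "(\<lambda>x. emeasure (count_space UNIV) (A `` {x})) \<in> borel_measurable M"
proof (rule orbit_relation_measure(1)[OF sb _ _ assms])
  show "\<forall>n\<in>UNIV. g n \<in> measurable M M" by simp
  show "R = {(x, y). x \<in> space M \<and> (\<exists>n\<in>UNIV. y = g n x)}" using R_eq by simp
qed

lemmas emeasure_RM = emeasure_rel_measure[OF sb pe]

lemma emeasure_RM_single_valued:
  assumes "A \<in> sets (M \<Otimes>\<^sub>M M)" "A \<subseteq> R" "single_valued A"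
  shows "emeasure RM A = emeasure M (Domain A)"
proof -
  have "emeasure (count_space UNIV) (A `` {x}) = indicator (Domain A) x" for x
  proof (cases "x \<in> Domain A")
    case True
    then obtain y where "(x, y) \<in> A" by blast
    then have "A `` {x} = {y}" using assms(3) by (auto simp: single_valued_def)
    then show ?thesis using True by simp
  next
    case False
    then have "A `` {x} = {}" by auto
    then show ?thesis using False by simp
  qed
  then show ?thesis using Domain_meas[OF assms(1,2)] emeasure_RM[OF assms(1,2)] by simp
qed

text \<open>Splitting \<open>A\<close> according to the first generator that carries
  \<open>x\<close> to \<open>y\<close> leaves pieces of graphs of the injective maps
  \<open>g n\<close>; such a piece and its converse have equal measure because \<open>gi n\<close>
  preserves \<open>M\<close>.\<close>

theorem mass_transport:
  assumes A [measurable]: "A \<in> sets (M \<Otimes>\<^sub>M M)" and AR: "A \<subseteq> R"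
  shows "emeasure RM (A\<inverse>) = emeasure RM A"
proof -
  define An where "An n = {(x, y). (x, y) \<in> A \<and> y = g n x \<and> (\<forall>m<n. y \<noteq> g m x)}" for n
  have sp: "(x, y) \<in> A \<Longrightarrow> x \<in> space M \<and> y \<in> space M" for x y using AR R_space[of x y] by auto
  have Am [measurable]: "An n \<in> sets (M \<Otimes>\<^sub>M M)" for n
    unfolding An_def using sp by (intro rel_setI) auto
  have AnR: "An n \<subseteq> R" for n using AR by (auto simp: An_def)
  have disj: "disjoint_family An"
  proof (unfold disjoint_family_on_def, intro ballI impI)
    fix i j :: nat assume "i \<noteq> j"
    then consider "i < j" | "j < i" by linarith
    then show "An i \<inter> An j = {}" by cases (auto simp: An_def)
  qed
  have un: "A = (\<Union>n. An n)"
  proof (intro subset_antisym subrelI)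
    fix x y assume xy: "(x, y) \<in> A"
    then have "\<exists>n. y = g n x" using AR R_ex[of x y] by auto
    then have "(x, y) \<in> An (LEAST n. y = g n x)"
      using xy not_less_Least unfolding An_def by (auto intro: LeastI)
    then show "(x, y) \<in> (\<Union>n. An n)" by blast
  qed (auto simp: An_def)
  have eqn: "emeasure RM ((An n)\<inverse>) = emeasure RM (An n)" for n
  proof -
    have "single_valued (An n)" by (simp add: single_valued_def An_def)
    moreover have "single_valued ((An n)\<inverse>)"
    proof (rule single_valuedI)
      fix y x x' assume "(y, x) \<in> (An n)\<inverse>" "(y, x') \<in> (An n)\<inverse>"
      then have "x \<in> space M" "x' \<in> space M" "g n x = g n x'" using sp by (auto simp: An_def)
      then show "x = x'" using g_gi(2) by metis
    qed
    ultimately have sv: "single_valued (An n)" "single_valued ((An n)\<inverse>)" by auto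
    have "Domain ((An n)\<inverse>) = {y \<in> space M. gi n y \<in> Domain (An n)}"
    proof (intro Set.set_eqI iffI)
      fix y assume "y \<in> Domain ((An n)\<inverse>)"
      then obtain x where xy: "(x, y) \<in> An n" by auto
      then have "x \<in> space M" "y \<in> space M" "y = g n x" using sp by (auto simp: An_def)
      then show "y \<in> {y \<in> space M. gi n y \<in> Domain (An n)}" using xy g_gi by auto
    next
      fix y assume "y \<in> {y \<in> space M. gi n y \<in> Domain (An n)}"
      then obtain z where z: "y \<in> space M" "(gi n y, z) \<in> An n" by auto
      then have "z = y" using g_gi by (auto simp: An_def)
      then show "y \<in> Domain ((An n)\<inverse>)" using z by auto
    qed
    also have "\<dots> = gi n -` Domain (An n) \<inter> space M" by auto
    also have "emeasure M \<dots> = emeasure (distr M M (gi n)) (Domain (An n))"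
      using Domain_meas[OF Am AnR] by (subst emeasure_distr) auto
    finally have "emeasure M (Domain ((An n)\<inverse>)) = emeasure M (Domain (An n))" using g_pres by simp
    then show ?thesis
      using emeasure_RM_single_valued[OF converse_meas[OF Am] converse_R[OF AnR] sv(2)]
        emeasure_RM_single_valued[OF Am AnR sv(1)] by simp
  qed
  have "emeasure RM (A\<inverse>) = emeasure RM (\<Union>n. (An n)\<inverse>)" using un by (simp add: converse_UNION)
  also have "\<dots> = (\<Sum>n. emeasure RM ((An n)\<inverse>))"
  proof (rule suminf_emeasure[symmetric])
    show "range (\<lambda>n. (An n)\<inverse>) \<subseteq> sets RM"
      using converse_meas[OF Am] converse_R[OF AnR] by (auto simp: sets_RM)
    show "disjoint_family (\<lambda>n. (An n)\<inverse>)"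
      using disj unfolding disjoint_family_on_def by blast
  qed
  also have "\<dots> = (\<Sum>n. emeasure RM (An n))" using eqn by simp
  also have "\<dots> = emeasure RM A"
    by (subst un, rule suminf_emeasure) (use disj AnR in \<open>auto simp: sets_RM\<close>)
  finally show ?thesis .
qed

lemma partial_bijection_measure:
  assumes "A \<in> sets (M \<Otimes>\<^sub>M M)" "A \<subseteq> R" "single_valued A" "single_valued (A\<inverse>)"
  shows "emeasure M (Range A) = emeasure M (Domain A)"
  using mass_transport[OF assms(1,2)] emeasure_RM_single_valued[OF assms(1-3)]
    emeasure_RM_single_valued[OF converse_meas[OF assms(1)] converse_R[OF assms(2)] assms(4)] by simp


section \<open>Elements of the full group from partial bijections\<close>

lemma full_groupI:
  assumes T: "T \<in> measurable M M" "T' \<in> measurable M M"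
    and inv: "\<And>x. x \<in> space M \<Longrightarrow> T' (T x) = x" "\<And>x. x \<in> space M \<Longrightarrow> T (T' x) = x"
    and TR: "\<And>x. x \<in> space M \<Longrightarrow> (x, T x) \<in> R"
  shows "T \<in> full_group M R" "\<And>x. x \<in> space M \<Longrightarrow> the_inv_into (space M) T x = T' x"
proof -
  note [measurable] = T
  have sp: "T x \<in> space M" "T' x \<in> space M" if "x \<in> space M" for x
    using that measurable_space[OF T(1)] measurable_space[OF T(2)] by auto
  have inj: "inj_on T (space M)" using inv(1) by (metis inj_onI)
  have bij: "bij_betw T (space M) (space M)"
    by (rule bij_betw_byWitness[where f' = T']) (use inv sp in auto)
  show tinv: "the_inv_into (space M) T x = T' x" if "x \<in> space M" for x
    using inj inv(2)[OF that] sp(2)[OF that] by (intro the_inv_into_f_eq) auto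
  \<comment> \<open>Preservation of the measure is automatic: the graph of \<open>T\<close> over
    \<open>E\<close> is a partial bijection inside R from the preimage of \<open>E\<close> onto
    \<open>E\<close>.\<close>
  have pres: "distr M M T = M"
  proof (rule measure_eqI)
    fix E assume "E \<in> sets (distr M M T)"
    then have E [measurable]: "E \<in> sets M" by simp
    define G where "G = {(x, y). (x, y) \<in> R \<and> y = T x \<and> y \<in> E}"
    have Gs: "G \<in> sets (M \<Otimes>\<^sub>M M)" unfolding G_def by (intro rel_setI') measurable
    have GR: "G \<subseteq> R" by (auto simp: G_def)
    have sv: "single_valued G" by (auto simp: G_def single_valued_def)
    have sv': "single_valued (G\<inverse>)"
    proof (rule single_valuedI)
      fix y x x' assume "(y, x) \<in> G\<inverse>" "(y, x') \<in> G\<inverse>"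
      then have "x \<in> space M" "x' \<in> space M" "T x = T x'" using R_space by (auto simp: G_def)
      then show "x = x'" using inv(1) by metis
    qed
    have d: "Domain G = T -` E \<inter> space M" using TR R_space by (auto simp: G_def)
    have r: "Range G = E"
    proof (intro Set.set_eqI iffI)
      fix y assume y: "y \<in> E"
      then have ys: "y \<in> space M" using sets.sets_into_space[OF E] by auto
      have "(T' y, y) \<in> G" using TR[OF sp(2)[OF ys]] inv(2)[OF ys] y by (simp add: G_def)
      then show "y \<in> Range G" by auto
    qed (auto simp: G_def)
    show "emeasure (distr M M T) E = emeasure M E"
      using partial_bijection_measure[OF Gs GR sv sv'] by (simp add: emeasure_distr d r)
  qed simp
  have "the_inv_into (space M) T \<in> measurable M M"
    using T(2) tinv by (simp cong: measurable_cong)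
  then have aut: "mp_automorphism M T"
    using T pres bij by (simp add: mp_automorphism_def measure_pres_def)
  have "map_prod T T ` R = R"
  proof (intro subset_antisym subrelI)
    fix x y assume "(x, y) \<in> map_prod T T ` R"
    then obtain a b where ab: "(a, b) \<in> R" "x = T a" "y = T b" by auto
    then show "(x, y) \<in> R" using TR R_space R_sym R_trans by metis
  next
    fix x y assume xy: "(x, y) \<in> R"
    then have s: "x \<in> space M" "y \<in> space M" using R_space by auto
    have "(T' x, x) \<in> R" "(T' y, y) \<in> R" using TR[OF sp(2)[OF s(1)]] TR[OF sp(2)[OF s(2)]] inv(2) s by auto
    then have "(T' x, T' y) \<in> R" using xy R_sym R_trans by metis
    moreover have "(x, y) = map_prod T T (T' x, T' y)" using inv(2) s by simp
    ultimately show "(x, y) \<in> map_prod T T ` R" by (rule rev_image_eqI)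
  qed
  then show "T \<in> full_group M R"
    using aut TR by (auto simp: full_group_def Aut_rel_def rel_eq_ae_def)
qed

text \<open>The conclusion speaks of the inverse of \<open>T\<close> because membership in the image
  of S under \<open>T\<close> is tested by pulling pairs back along this inverse.\<close>

lemma extend_partial_bijection:
  assumes A [measurable]: "A \<in> sets (M \<Otimes>\<^sub>M M)" and AR: "A \<subseteq> R"
    and sv: "single_valued A" "single_valued (A\<inverse>)"
    and dom: "AE x in M. x \<in> Domain A"
  obtains T where "T \<in> full_group M R" "AE x in M. (the_inv_into (space M) T x, x) \<in> A"
proof -
  have [measurable]: "Domain A \<in> sets M" "Range A \<in> sets M" using Domain_meas Range_meas A AR by auto
  have "prob (Range A) = 1"
    using partial_bijection_measure[OF A AR sv] dom prob_eq_1[of "Domain A"]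
    by (simp add: emeasure_eq_measure)
  then have ran: "AE x in M. x \<in> Range A" using prob_eq_1[of "Range A"] by simp
  \<comment> \<open>The points whose whole R-class lies in both the domain and the range. This set
    is conull and R-invariant, so \<open>A\<close> restricts to a bijection of it, and the identity
    fills the null rest.\<close>
  define X1 where "X1 = {x \<in> space M. \<forall>n. g n x \<in> Domain A \<and> g n x \<in> Range A}"
  have X1 [measurable]: "X1 \<in> sets M" unfolding X1_def by measurable
  have X1': "x \<in> X1 \<longleftrightarrow> x \<in> space M \<and> (\<forall>y. (x, y) \<in> R \<longrightarrow> y \<in> Domain A \<and> y \<in> Range A)" for x
    unfolding X1_def R_eq by auto
  have X1_inv: "y \<in> X1" if "x \<in> X1" "(x, y) \<in> R" for x y
    using that R_space R_trans unfolding X1' by blast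
  have X1_AE: "AE x in M. x \<in> X1"
    using AE_rel[OF dom] AE_rel[OF ran] AE_space by eventually_elim (auto simp: X1')
  define T where "T x = (if x \<in> X1 then THE y. (x, y) \<in> A else x)" for x
  define T' where "T' x = (if x \<in> X1 then THE y. (y, x) \<in> A else x)" for x
  have TA: "(x, T x) \<in> A" if x: "x \<in> X1" for x
  proof -
    obtain y where y: "(x, y) \<in> A" using x R_refl by (auto simp: X1')
    then have "(THE y. (x, y) \<in> A) = y" using sv(1) by (auto simp: single_valued_def)
    then show ?thesis using y x by (simp add: T_def)
  qed
  have TA': "(T' x, x) \<in> A" if x: "x \<in> X1" for x
  proof -
    obtain y where y: "(y, x) \<in> A" using x R_refl by (auto simp: X1')
    then have "(THE y. (y, x) \<in> A) = y" using sv(2) by (auto simp: single_valued_def)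
    then show ?thesis using y x by (simp add: T'_def)
  qed
  have TX: "T x \<in> X1" "T' x \<in> X1" if "x \<in> X1" for x
    using X1_inv[OF that] TA[OF that] TA'[OF that] AR R_sym by auto
  have eq: "y = T x" if "(x, y) \<in> A" "x \<in> X1" for x y
    using that TA sv(1) by (auto simp: single_valued_def)
  have eq': "x = T' y" if "(x, y) \<in> A" "y \<in> X1" for x y
    using that TA' sv(2) by (auto simp: single_valued_def)
  have 1: "T' (T x) = x" if "x \<in> space M" for x
  proof (cases "x \<in> X1")
    case True
    then show ?thesis using eq'[OF TA TX(1)] by simp
  qed (simp add: T_def T'_def)
  have 2: "T (T' x) = x" if "x \<in> space M" for x
  proof (cases "x \<in> X1")
    case True
    then show ?thesis using eq[OF TA' TX(2)] by simp
  qed (simp add: T_def T'_def)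
  have TR: "(x, T x) \<in> R" if "x \<in> space M" for x
    using that TA[of x] AR R_refl by (cases "x \<in> X1") (auto simp: T_def)
  have TR': "(x, T' x) \<in> R" if "x \<in> space M" for x
    using that TA'[of x] AR R_refl R_sym by (cases "x \<in> X1") (auto simp: T'_def)
  have Tm: "T \<in> measurable M M"
  proof (rule measurableI)
    fix E assume E [measurable]: "E \<in> sets M"
    have "T -` E \<inter> space M = {x \<in> space M. (x \<in> X1 \<and> (\<exists>n. (x, g n x) \<in> A \<and> g n x \<in> E)) \<or> (x \<notin> X1 \<and> x \<in> E)}"
    proof (intro Set.set_eqI)
      fix x show "x \<in> T -` E \<inter> space M \<longleftrightarrow> x \<in> {x \<in> space M. (x \<in> X1 \<and> (\<exists>n. (x, g n x) \<in> A \<and> g n x \<in> E)) \<or> (x \<notin> X1 \<and> x \<in> E)}"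
      proof (cases "x \<in> X1")
        case True
        obtain m where m: "T x = g m x" using TR[of x] R_ex[of x "T x"] True by (auto simp: X1')
        have "(\<exists>n. (x, g n x) \<in> A \<and> g n x \<in> E) \<longleftrightarrow> T x \<in> E"
          using TA[OF True] m eq[OF _ True] by metis
        then show ?thesis using True by (simp add: X1_def)
      qed (auto simp: T_def)
    qed
    then show "T -` E \<inter> space M \<in> sets M" by simp
  qed (use TR R_space in blast)
  have Tm': "T' \<in> measurable M M"
  proof (rule measurableI)
    fix E assume E [measurable]: "E \<in> sets M"
    have "T' -` E \<inter> space M = {x \<in> space M. (x \<in> X1 \<and> (\<exists>n. (g n x, x) \<in> A \<and> g n x \<in> E)) \<or> (x \<notin> X1 \<and> x \<in> E)}"
    proof (intro Set.set_eqI)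
      fix x show "x \<in> T' -` E \<inter> space M \<longleftrightarrow> x \<in> {x \<in> space M. (x \<in> X1 \<and> (\<exists>n. (g n x, x) \<in> A \<and> g n x \<in> E)) \<or> (x \<notin> X1 \<and> x \<in> E)}"
      proof (cases "x \<in> X1")
        case True
        obtain m where m: "T' x = g m x" using TR'[of x] R_ex[of x "T' x"] True by (auto simp: X1')
        have "(\<exists>n. (g n x, x) \<in> A \<and> g n x \<in> E) \<longleftrightarrow> T' x \<in> E"
          using TA'[OF True] m eq'[OF _ True] by metis
        then show ?thesis using True by (simp add: X1_def)
      qed (auto simp: T'_def)
    qed
    then show "T' -` E \<inter> space M \<in> sets M" by simp
  qed (use TR' R_space in blast)
  have "AE x in M. (the_inv_into (space M) T x, x) \<in> A"
    using X1_AE AE_space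
    by eventually_elim (simp add: full_groupI(2)[OF Tm Tm' 1 2 TR] TA')
  with full_groupI(1)[OF Tm Tm' 1 2 TR] show ?thesis by (rule that)
qed

end

section \<open>Greedy packings of tuples\<close>

text \<open>Step \<open>i\<close> looks only at conflicts with earlier steps; conflicts inside a
  step have to be excluded by the choice of \<open>W\<close>.\<close>

fun greedy :: "(nat \<Rightarrow> 'a set) \<Rightarrow> (nat \<Rightarrow> nat \<Rightarrow> ('a \<times> 'a) set) \<Rightarrow> nat \<Rightarrow> 'a set" where
  "greedy W cf i = {x \<in> W i. \<forall>j\<in>{..<i}. \<forall>y\<in>greedy W cf j. (x, y) \<notin> cf i j}"

declare greedy.simps [simp del]

context pmp_rel begin

lemma greedy_meas:
  assumes W [measurable]: "\<And>i. W i \<in> sets M"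
    and cf [measurable]: "\<And>i j. cf i j \<in> sets (M \<Otimes>\<^sub>M M)" and cfR: "\<And>i j. cf i j \<subseteq> R"
  shows "greedy W cf i \<in> sets M"
proof (induction i rule: less_induct)
  case (less i)
  \<comment> \<open>Truncating at \<open>i\<close> turns the induction hypothesis for
    \<open>j < i\<close> into a measurability rule without side condition.\<close>
  define D where "D j = (if j < i then greedy W cf j else {})" for j
  have D [measurable]: "D j \<in> sets M" for j using less by (simp add: D_def)
  have "greedy W cf i = {x \<in> space M. x \<in> W i \<and> (\<forall>j\<in>{..<i}. \<forall>n. g n x \<in> D j \<longrightarrow> (x, g n x) \<notin> cf i j)}"
  proof (intro Set.set_eqI)
    fix x
    have "(\<forall>y\<in>greedy W cf j. (x, y) \<notin> cf i j) \<longleftrightarrow> (\<forall>n. g n x \<in> greedy W cf j \<longrightarrow> (x, g n x) \<notin> cf i j)" for j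
      using R_ex[OF subsetD[OF cfR]] by metis
    then show "x \<in> greedy W cf i \<longleftrightarrow> x \<in> {x \<in> space M. x \<in> W i \<and> (\<forall>j\<in>{..<i}. \<forall>n. g n x \<in> D j \<longrightarrow> (x, g n x) \<notin> cf i j)}"
      using sets.sets_into_space[OF W[of i]] by (auto simp: greedy.simps[of W cf i] D_def)
  qed
  then show ?case by simp
qed

text \<open>Each index \<open>i\<close> is split into countably many indices \<open>(i, p, q)\<close> with \<open>p, q\<close> rational, which admit
  only points \<open>x\<close> with \<open>p < c x < q\<close> none of whose finitely many conflicts of type \<open>(i, i)\<close> has this
  property; then no conflicts remain inside one step of the greedy choice.\<close>

lemma maximal_independent:
  fixes W :: "'i::countable \<Rightarrow> 'a set" and cf :: "'i \<Rightarrow> 'i \<Rightarrow> ('a \<times> 'a) set"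
  assumes W [measurable]: "\<And>i. W i \<in> sets M"
    and cf [measurable]: "\<And>i j. cf i j \<in> sets (M \<Otimes>\<^sub>M M)" and cfR: "\<And>i j. cf i j \<subseteq> R"
    and sym: "\<And>i j x y. (x, y) \<in> cf i j \<Longrightarrow> (y, x) \<in> cf j i"
    and fin: "\<And>i x. x \<in> W i \<Longrightarrow> finite (cf i i `` {x} \<inter> W i)"
  obtains D where "\<And>i. D i \<in> sets M" "\<And>i. D i \<subseteq> W i"
    "\<And>i j x y. x \<in> D i \<Longrightarrow> y \<in> D j \<Longrightarrow> (x, y) \<in> cf i j \<Longrightarrow> i = j \<and> x = y"
    "\<And>i x. x \<in> W i \<Longrightarrow> x \<in> D i \<or> (\<exists>j y. y \<in> D j \<and> (x, y) \<in> cf i j)"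
proof -
  define dec :: "nat \<Rightarrow> 'i \<times> rat \<times> rat" where "dec = from_nat"
  define ix where "ix k = fst (dec k)" for k
  define cell where "cell k x \<longleftrightarrow> of_rat (fst (snd (dec k))) < c x \<and> c x < of_rat (snd (snd (dec k)))" for k x
  have [measurable]: "Measurable.pred M (cell k)" for k unfolding cell_def by measurable
  define W' where "W' k = {x \<in> W (ix k). cell k x \<and>
    (\<forall>y\<in>W (ix k). (x, y) \<in> cf (ix k) (ix k) \<longrightarrow> y \<noteq> x \<longrightarrow> \<not> cell k y)}" for k
  define cf' where "cf' k l = cf (ix k) (ix l)" for k l
  have W'_eq: "W' k = {x \<in> space M. x \<in> W (ix k) \<and> cell k x \<and>
    (\<forall>n. g n x \<in> W (ix k) \<longrightarrow> (x, g n x) \<in> cf (ix k) (ix k) \<longrightarrow> g n x \<noteq> x \<longrightarrow> \<not> cell k (g n x))}" for k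
  proof (intro Set.set_eqI)
    fix x
    have "(\<forall>y\<in>W (ix k). (x, y) \<in> cf (ix k) (ix k) \<longrightarrow> y \<noteq> x \<longrightarrow> \<not> cell k y) \<longleftrightarrow>
      (\<forall>n. g n x \<in> W (ix k) \<longrightarrow> (x, g n x) \<in> cf (ix k) (ix k) \<longrightarrow> g n x \<noteq> x \<longrightarrow> \<not> cell k (g n x))"
      using R_ex[OF subsetD[OF cfR]] by metis
    then show "x \<in> W' k \<longleftrightarrow> x \<in> {x \<in> space M. x \<in> W (ix k) \<and> cell k x \<and>
      (\<forall>n. g n x \<in> W (ix k) \<longrightarrow> (x, g n x) \<in> cf (ix k) (ix k) \<longrightarrow> g n x \<noteq> x \<longrightarrow> \<not> cell k (g n x))}"
      using sets.sets_into_space[OF W[of "ix k"]] by (auto simp: W'_def)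
  qed
  have W'm: "W' k \<in> sets M" for k unfolding W'_eq by measurable
  have cf'm: "cf' k l \<in> sets (M \<Otimes>\<^sub>M M)" "cf' k l \<subseteq> R" for k l using cfR by (auto simp: cf'_def)
  define D where "D i = (\<Union>k\<in>{k. ix k = i}. greedy W' cf' k)" for i
  have gW: "greedy W' cf' k \<subseteq> W' k" for k by (auto simp: greedy.simps[of W' cf' k])
  have gg: False if "x \<in> greedy W' cf' k" "y \<in> greedy W' cf' l" "(x, y) \<in> cf' k l" "l < k" for x y k l
    using that by (auto simp: greedy.simps[of W' cf' k])
  show ?thesis
  proof (rule that[of D])
    show "D i \<in> sets M" for i
      unfolding D_def using greedy_meas[OF W'm cf'm] by (intro sets.countable_UN'') auto
    show "D i \<subseteq> W i" for i unfolding D_def using gW by (fastforce simp: W'_def)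
  next
    fix i j x y assume xy: "x \<in> D i" "y \<in> D j" "(x, y) \<in> cf i j"
    obtain k where k: "ix k = i" "x \<in> greedy W' cf' k" using xy(1) by (auto simp: D_def)
    obtain l where l: "ix l = j" "y \<in> greedy W' cf' l" using xy(2) by (auto simp: D_def)
    have cf1: "(x, y) \<in> cf' k l" "(y, x) \<in> cf' l k" using xy(3) sym k l by (auto simp: cf'_def)
    \<comment> \<open>Conflicts are symmetric, so if the steps differed, the point of the later one
      would have been rejected.\<close>
    have kl: "k = l" using gg[OF k(2) l(2) cf1(1)] gg[OF l(2) k(2) cf1(2)] by (meson linorder_neqE_nat)
    have "x \<in> W' k" "y \<in> W' k" using k l kl gW by auto
    then have "x = y" using cf1(1) kl by (auto simp: W'_def cf'_def)
    then show "i = j \<and> x = y" using k l kl by auto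
  next
    fix i x assume x: "x \<in> W i"
    define Z where "Z = cf i i `` {x} \<inter> W i - {x}"
    have "finite (c ` Z)" using fin[OF x] by (simp add: Z_def)
    moreover have "c x \<notin> c ` Z"
    proof
      assume "c x \<in> c ` Z"
      then obtain y where y: "y \<in> Z" "c x = c y" by blast
      then have "x \<in> space M" "y \<in> space M" using R_space[OF subsetD[OF cfR]] by (auto simp: Z_def)
      then have "x = y" using c_inj y by (auto dest: inj_onD)
      then show False using y by (simp add: Z_def)
    qed
    \<comment> \<open>The finitely many other conflicts of \<open>x\<close> have
      \<open>c\<close>-values different from \<open>c x\<close>, so an interval around
      \<open>c x\<close> with rational ends avoids them; it selects the step \<open>k\<close> at
      which \<open>x\<close> is admissible.\<close>
    ultimately have "open (- (c ` Z))" "c x \<in> - (c ` Z)" by (auto intro: finite_imp_closed)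
    then obtain e where e: "e > 0" "\<And>t. \<bar>t - c x\<bar> < e \<Longrightarrow> t \<notin> c ` Z"
      by (metis ComplD dist_real_def open_dist)
    obtain p where p: "c x - e < of_rat p" "of_rat p < c x" using of_rat_dense[of "c x - e" "c x"] e by auto
    obtain q where q: "of_rat q < c x + e" "c x < of_rat q" using of_rat_dense[of "c x" "c x + e"] e by auto
    define k where "k = to_nat (i, p, q)"
    have ixk: "ix k = i" by (simp add: ix_def dec_def k_def)
    have "\<not> cell k y" if "y \<in> Z" for y
    proof
      assume "cell k y"
      then have "\<bar>c y - c x\<bar> < e" using p q by (auto simp: cell_def dec_def k_def)
      then show False using e that by blast
    qed
    then have xW: "x \<in> W' k" using x p q ixk by (auto simp: W'_def cell_def dec_def k_def Z_def)
    show "x \<in> D i \<or> (\<exists>j y. y \<in> D j \<and> (x, y) \<in> cf i j)"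
    proof (cases "x \<in> greedy W' cf' k")
      case True
      then show ?thesis using ixk by (auto simp: D_def)
    next
      case False
      then obtain l y where "l < k" "y \<in> greedy W' cf' l" "(x, y) \<in> cf' k l"
        using xW by (auto simp: greedy.simps[of W' cf' k])
      then have "y \<in> D (ix l)" "(x, y) \<in> cf i (ix l)" using ixk by (auto simp: D_def cf'_def)
      then show ?thesis by blast
    qed
  qed
qed


section \<open>Least points of finite classes\<close>

lemma finite_fibre_meas:
  assumes "A \<in> sets (M \<Otimes>\<^sub>M M)" "A \<subseteq> R"
  shows "{x \<in> space M. finite (A `` {x})} \<in> sets M"
proof -
  note [measurable] = fibre_meas[OF assms]
  have "{x \<in> space M. finite (A `` {x})} = {x \<in> space M. emeasure (count_space UNIV) (A `` {x}) < \<infinity>}"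
    by (auto simp: emeasure_count_space of_nat_less_top)
  then show ?thesis by simp
qed

text \<open>A Borel transversal of the finite classes. The condition \<open>(x, x) \<in> Q\<close>
  matters because \<open>Q\<close> may be an equivalence relation on a part of the space only, such
  as a restriction to a set.\<close>

definition min_points :: "('a \<times> 'a) set \<Rightarrow> 'a set" where
  "min_points Q = {x \<in> space M. (x, x) \<in> Q \<and> finite (Q `` {x}) \<and> (\<forall>y. (x, y) \<in> Q \<longrightarrow> c x \<le> c y)}"

lemma min_points_meas:
  assumes Q [measurable]: "Q \<in> sets (M \<Otimes>\<^sub>M M)" and QR: "Q \<subseteq> R"
  shows "min_points Q \<in> sets M"
proof -
  note [measurable] = finite_fibre_meas[OF Q QR]
  have "min_points Q = {x \<in> space M. (x, x) \<in> Q \<and> x \<in> {x \<in> space M. finite (Q `` {x})} \<and>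
      (\<forall>n. (x, g n x) \<in> Q \<longrightarrow> c x \<le> c (g n x))}"
    unfolding min_points_def using R_ex[OF subsetD[OF QR]] by (auto; metis)
  then show ?thesis by simp
qed

lemma min_points_unique:
  assumes "sym Q" "x \<in> min_points Q" "y \<in> min_points Q" "(x, y) \<in> Q"
  shows "x = y"
  using assms c_inj unfolding min_points_def
  by (metis (mono_tags, lifting) antisym inj_onD mem_Collect_eq symD)

lemma min_points_exist:
  assumes QR: "Q \<subseteq> R" and Q: "sym Q" "trans Q" and x: "(x, x) \<in> Q" "finite (Q `` {x})"
  shows "\<exists>y\<in>min_points Q. (x, y) \<in> Q"
proof -
  obtain y where y: "y \<in> Q `` {x}" "\<And>z. z \<in> Q `` {x} \<Longrightarrow> c y \<le> c z"
    using arg_min_if_finite(1)[OF x(2), of c] arg_min_least[OF x(2), of _ c] x(1) by blast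
  have "Q `` {y} \<subseteq> Q `` {x}" using y(1) Q(2) by (auto dest: transD)
  moreover have "y \<in> space M" "(y, y) \<in> Q"
    using y(1) QR R_space Q by (auto dest: transD symD)
  ultimately have "y \<in> min_points Q"
    using y(2) finite_subset[OF _ x(2)] unfolding min_points_def by blast
  then show ?thesis using y(1) by auto
qed

text \<open>Every finite class contains a least point, so the points with finite classes lie in the
  saturation of a null set.\<close>

lemma AE_infinite_if_min_points_null:
  assumes QR: "Q \<subseteq> R" and Q: "sym Q" "trans Q" and null: "emeasure M (min_points Q) = 0"
    and Qm: "Q \<in> sets (M \<Otimes>\<^sub>M M)"
  shows "AE x in M. (x, x) \<in> Q \<longrightarrow> infinite (Q `` {x})"
proof -
  have "AE x in M. x \<notin> min_points Q"
    using null min_points_meas[OF Qm QR] by (intro AE_not_in) (auto simp: null_sets_def)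
  from AE_rel[OF this] show ?thesis
    by eventually_elim (use min_points_exist[OF QR Q] QR in blast)
qed

text \<open>The least points of the finite classes of the restriction lie in pairwise distinct infinite
  \<open>S\<close>-classes. A set of positive measure of them would send an infinite mass to a set of measure at
  most 1.\<close>

lemma infinite_restrict:
  assumes S [measurable]: "S \<in> sets (M \<Otimes>\<^sub>M M)" and SR: "S \<subseteq> R" and eq: "equiv (space M) S"
    and inf: "AE x in M. infinite (S `` {x})" and B [measurable]: "B \<in> sets M"
  shows "AE x in M. x \<in> B \<longrightarrow> infinite (S `` {x} \<inter> B)"
proof -
  define Q where "Q = {(x, y). (x, y) \<in> S \<and> x \<in> B \<and> y \<in> B}"
  have SS: "(x, y) \<in> S \<Longrightarrow> x \<in> space M \<and> y \<in> space M" for x y using SR R_space by blast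
  have Q: "Q \<in> sets (M \<Otimes>\<^sub>M M)" unfolding Q_def using SS by (intro rel_setI) auto
  have QR: "Q \<subseteq> R" using SR by (auto simp: Q_def)
  have Sst: "sym S" "trans S" using eq by (auto simp: equiv_def)
  then have Qst: "sym Q" "trans Q" unfolding Q_def sym_def trans_def by blast+
  define Y where "Y = min_points Q"
  have Y [measurable]: "Y \<in> sets M" unfolding Y_def by (rule min_points_meas[OF Q QR])
  have YB: "Y \<subseteq> B" by (auto simp: Y_def min_points_def Q_def)
  define A where "A = {(x, y). (x, y) \<in> S \<and> x \<in> Y}"
  have A: "A \<in> sets (M \<Otimes>\<^sub>M M)" unfolding A_def using SS by (intro rel_setI) auto
  have AR: "A \<subseteq> R" using SR by (auto simp: A_def)
  have sv: "single_valued (A\<inverse>)"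
  proof (rule single_valuedI)
    fix y x x' assume "(y, x) \<in> A\<inverse>" "(y, x') \<in> A\<inverse>"
    then have "(x, y) \<in> S" "(x', y) \<in> S" and Yx: "x \<in> Y" "x' \<in> Y" by (auto simp: A_def)
    then have "(x, x') \<in> S" using Sst by (meson symD transD)
    then have "(x, x') \<in> Q" using Yx YB by (auto simp: Q_def)
    then show "x = x'" using min_points_unique[OF Qst(1)] Yx by (simp add: Y_def)
  qed
  have "\<infinity> * emeasure M Y = (\<integral>\<^sup>+x. \<infinity> * indicator Y x \<partial>M)"
    by (subst nn_integral_cmult_indicator) auto
  also have "\<dots> = (\<integral>\<^sup>+x. emeasure (count_space UNIV) (A `` {x}) \<partial>M)"
  proof (rule nn_integral_cong_AE)
    show "AE x in M. \<infinity> * indicator Y x = emeasure (count_space UNIV) (A `` {x})"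
      using inf
    proof eventually_elim
      case (elim x)
      have "A `` {x} = (if x \<in> Y then S `` {x} else {})" by (auto simp: A_def)
      then show ?case using elim by (simp add: emeasure_count_space)
    qed
  qed
  also have "\<dots> = emeasure M (Domain (A\<inverse>))"
    using mass_transport[OF A AR] emeasure_RM[OF A AR]
      emeasure_RM_single_valued[OF converse_meas[OF A] converse_R[OF AR] sv] by simp
  also have "\<dots> \<le> 1" by (rule emeasure_le_1)
  finally have "emeasure M Y = 0" by (auto simp: ennreal_mult_eq_top_iff top_unique ennreal_top_mult split: if_splits)
  then have "AE x in M. (x, x) \<in> Q \<longrightarrow> infinite (Q `` {x})"
    using AE_infinite_if_min_points_null[OF QR Qst _ Q] by (simp add: Y_def)
  with AE_space show ?thesis
  proof eventually_elim
    case (elim x)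
    have "(x, x) \<in> S" using eq elim by (auto simp: equiv_def refl_on_def)
    moreover have "Q `` {x} = S `` {x} \<inter> B" if "x \<in> B" using that by (auto simp: Q_def)
    ultimately show ?case using elim by (auto simp: Q_def)
  qed
qed

text \<open>If the set of least points were not null, atomlessness would split it into two parts of
  positive measure. A class contains at most one least point, so the saturation of one part misses
  the other, against ergodicity.\<close>

lemma R_aperiodic:
  assumes erg: "ergodic_rel M R" and al: "atomless M"
  shows "AE x in M. infinite (R `` {x})"
proof -
  have st: "sym R" "trans R" using R_equiv by (auto simp: equiv_def)
  define Y where "Y = min_points R"
  have Y [measurable]: "Y \<in> sets M" unfolding Y_def by (rule min_points_meas) auto
  have "emeasure M Y = 0"
  proof (rule ccontr)
    assume "emeasure M Y \<noteq> 0"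
    then obtain B where B [measurable]: "B \<in> sets M" and BY: "B \<subseteq> Y" "0 < emeasure M B" "emeasure M B < emeasure M Y"
      using al Y unfolding atomless_def by (meson zero_less_iff_neq_zero)
    define Z where "Z = {x \<in> space M. \<exists>n. g n x \<in> B}"
    have Z [measurable]: "Z \<in> sets M" unfolding Z_def by measurable
    have Z': "x \<in> Z \<longleftrightarrow> (\<exists>y\<in>B. (x, y) \<in> R)" for x unfolding Z_def by (auto simp: R_eq)
    have "R `` Z = Z"
    proof (intro Set.set_eqI iffI)
      fix y assume "y \<in> R `` Z"
      then obtain x b where "(x, y) \<in> R" "(x, b) \<in> R" "b \<in> B" by (auto simp: Z')
      then show "y \<in> Z" using R_sym[of x y] R_trans[of y x b] by (auto simp: Z')
    next
      fix y assume "y \<in> Z"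
      then show "y \<in> R `` Z" using R_refl[of y] by (auto simp: Z_def)
    qed
    then have "emeasure M Z = 0 \<or> emeasure M (space M - Z) = 0" using erg Z by (auto simp: ergodic_rel_def)
    moreover have "B \<subseteq> Z" using R_refl sets.sets_into_space[OF B] unfolding Z' subset_iff by blast
    then have "emeasure M B \<le> emeasure M Z" by (intro emeasure_mono) auto
    ultimately have "emeasure M (space M - Z) = 0" using BY by auto
    moreover have "Y - B \<subseteq> space M - Z"
    proof
      fix x assume x: "x \<in> Y - B"
      have "x \<notin> Z"
      proof
        assume "x \<in> Z"
        then obtain y where y: "y \<in> B" "(x, y) \<in> R" by (auto simp: Z')
        have "x = y" by (rule min_points_unique[OF st(1)]) (use x y BY(1) in \<open>auto simp: Y_def\<close>)
        then show False using x y by simp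
      qed
      then show "x \<in> space M - Z" using x sets.sets_into_space[OF Y] by auto
    qed
    then have "emeasure M (Y - B) \<le> emeasure M (space M - Z)" by (intro emeasure_mono) auto
    ultimately have "emeasure M (Y - B) = 0" by simp
    then have "emeasure M (B \<union> (Y - B)) = emeasure M B"
      by (intro emeasure_Un_null_set) (auto simp: null_sets_def)
    then have "emeasure M Y = emeasure M B" using BY(1) by (simp add: Un_absorb1)
    then show False using BY by simp
  qed
  from AE_infinite_if_min_points_null[OF subset_refl st this[unfolded Y_def] R_meas] AE_space
  show ?thesis by eventually_elim (auto simp: R_refl)
qed

section \<open>Packings by tuples of targets\<close>

definition tuple_in :: "('a \<times> 'a) set \<Rightarrow> nat list \<Rightarrow> 'a \<Rightarrow> bool" where
  "tuple_in S ns x \<longleftrightarrow> distinct (map (\<lambda>n. g n x) ns) \<and> (\<forall>n\<in>set ns. \<forall>n'\<in>set ns. (g n x, g n' x) \<in> S)"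

lemma distinct_map_meas [measurable]: "Measurable.pred M (\<lambda>x. distinct (map (\<lambda>n. g n x) ns))"
proof -
  have "(\<lambda>x. distinct (map (\<lambda>n. g n x) ns)) =
    (\<lambda>x. \<forall>i\<in>{..<length ns}. \<forall>j\<in>{..<length ns}. i \<noteq> j \<longrightarrow> g (ns ! i) x \<noteq> g (ns ! j) x)"
    by (auto simp: distinct_conv_nth fun_eq_iff)
  then show ?thesis by simp
qed

lemma tuple_in_meas [measurable]:
  assumes [measurable]: "S \<in> sets (M \<Otimes>\<^sub>M M)"
  shows "Measurable.pred M (tuple_in S ns)"
  unfolding tuple_in_def by measurable

text \<open>A point \<open>x\<close> of \<open>D is ns\<close> is assigned the tuple of targets \<open>g n x\<close> for \<open>n\<close> in \<open>ns\<close>; the list \<open>is\<close>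
  is only a label that prescribes the length of the tuple. Targets of different points are
  distinct, and even \<open>S\<close>-inequivalent if the points are adjacent.\<close>

lemma tuple_packing:
  fixes E :: "nat list \<Rightarrow> 'a set"
  assumes S [measurable]: "S \<in> sets (M \<Otimes>\<^sub>M M)" and SR: "S \<subseteq> R" and Sst: "sym S"
    and adj [measurable]: "adj \<in> sets (M \<Otimes>\<^sub>M M)" and adjR: "adj \<subseteq> R" and adjs: "sym adj"
    and E [measurable]: "\<And>is. E is \<in> sets M"
    and fin: "\<And>x. x \<in> space M \<Longrightarrow> finite (adj `` {x} \<inter> (\<Union>is. E is))"
  obtains D where "\<And>is ns. D is ns \<in> sets M"
    "\<And>is ns x. x \<in> D is ns \<Longrightarrow> x \<in> E is \<and> length ns = length is \<and> tuple_in S ns x"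
    "\<And>is ns is' ns' x. x \<in> D is ns \<Longrightarrow> x \<in> D is' ns' \<Longrightarrow> is = is' \<and> ns = ns'"
    "\<And>is ns is' ns' x y n n'. x \<in> D is ns \<Longrightarrow> y \<in> D is' ns' \<Longrightarrow> n \<in> set ns \<Longrightarrow> n' \<in> set ns' \<Longrightarrow>
       g n x = g n' y \<or> ((x, y) \<in> adj \<and> (g n x, g n' y) \<in> S) \<Longrightarrow> x = y"
    "\<And>is ns x. x \<in> E is \<Longrightarrow> length ns = length is \<Longrightarrow> tuple_in S ns x \<Longrightarrow>
       x \<in> D is ns \<or> x \<in> (\<Union>is' ns'. D is' ns') \<or> (\<exists>is' ns' y n n'. y \<in> D is' ns' \<and> n \<in> set ns \<and> n' \<in> set ns' \<and>
       (g n x = g n' y \<or> ((x, y) \<in> adj \<and> (g n x, g n' y) \<in> S)))"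
proof -
  \<comment> \<open>Tuples are encoded by lists of generator indices, so their types form a
    countable set over which the greedy choice can run.\<close>
  define W where "W p = {x \<in> space M. x \<in> E (fst p) \<and> length (snd p) = length (fst p) \<and> tuple_in S (snd p) x}"
    for p :: "nat list \<times> nat list"
  \<comment> \<open>Counting \<open>x = y\<close> as a conflict gives every point at most one label
    and one tuple.\<close>
  define cf where "cf p q = {(x, y). (x, y) \<in> R \<and> (x = y \<or> (\<exists>n\<in>set (snd p). \<exists>n'\<in>set (snd q).
      g n x = g n' y \<or> ((x, y) \<in> adj \<and> (g n x, g n' y) \<in> S)))}" for p q :: "nat list \<times> nat list"
  have W: "W p \<in> sets M" for p unfolding W_def by measurable
  have cf: "cf p q \<in> sets (M \<Otimes>\<^sub>M M)" for p q unfolding cf_def by (intro rel_setI') measurable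
  have cfR: "cf p q \<subseteq> R" for p q by (auto simp: cf_def)
  have sym: "(y, x) \<in> cf q p" if "(x, y) \<in> cf p q" for x y p q
  proof -
    have "(y, x) \<in> R" using that R_sym by (auto simp: cf_def)
    then show ?thesis using that adjs Sst unfolding cf_def by (auto dest: symD) (metis symD)+
  qed
  have fin': "finite (cf p p `` {x} \<inter> W p)" if "x \<in> W p" for p x
  proof (rule finite_subset)
    \<comment> \<open>Equal targets determine \<open>y\<close> through \<open>gi n'\<close>, and
      adjacency leaves finitely many \<open>y\<close> by \<open>fin\<close>.\<close>
    show "cf p p `` {x} \<inter> W p \<subseteq> insert x ((\<Union>n\<in>set (snd p). \<Union>n'\<in>set (snd p). {gi n' (g n x)}) \<union>
        (adj `` {x} \<inter> (\<Union>is. E is)))"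
    proof
      fix y assume y: "y \<in> cf p p `` {x} \<inter> W p"
      have "y \<in> {gi n' (g n x)}" if "g n x = g n' y" for n n'
        using that y g_gi(2)[of y n'] by (auto simp: W_def)
      with y show "y \<in> insert x ((\<Union>n\<in>set (snd p). \<Union>n'\<in>set (snd p). {gi n' (g n x)}) \<union>
        (adj `` {x} \<inter> (\<Union>is. E is)))" unfolding cf_def W_def by blast
    qed
    show "finite (insert x ((\<Union>n\<in>set (snd p). \<Union>n'\<in>set (snd p). {gi n' (g n x)}) \<union>
        (adj `` {x} \<inter> (\<Union>is. E is))))"
      using fin that by (auto simp: W_def)
  qed
  obtain D where D: "\<And>p. D p \<in> sets M" "\<And>p. D p \<subseteq> W p"
    "\<And>p q x y. x \<in> D p \<Longrightarrow> y \<in> D q \<Longrightarrow> (x, y) \<in> cf p q \<Longrightarrow> p = q \<and> x = y"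
    "\<And>p x. x \<in> W p \<Longrightarrow> x \<in> D p \<or> (\<exists>q y. y \<in> D q \<and> (x, y) \<in> cf p q)"
    using maximal_independent[of W cf, OF W cf cfR sym fin'] by metis
  have sp: "x \<in> D p \<Longrightarrow> x \<in> space M" for x p using D(1) sets.sets_into_space by blast
  show ?thesis
  proof (rule that[of "\<lambda>is ns. D (is, ns)"])
    show "D (is, ns) \<in> sets M" for "is" ns by (rule D(1))
    show "x \<in> E is \<and> length ns = length is \<and> tuple_in S ns x" if "x \<in> D (is, ns)" for "is" ns x
      using subsetD[OF D(2) that] by (simp add: W_def)
    show "is = is' \<and> ns = ns'" if "x \<in> D (is, ns)" "x \<in> D (is', ns')" for "is" ns is' ns' x
      using D(3)[OF that] R_refl[OF sp[OF that(1)]] by (auto simp: cf_def)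
  next
    fix "is" ns is' ns' x y n n'
    assume xy: "x \<in> D (is, ns)" "y \<in> D (is', ns')" "n \<in> set ns" "n' \<in> set ns'"
      "g n x = g n' y \<or> ((x, y) \<in> adj \<and> (g n x, g n' y) \<in> S)"
    have "(x, y) \<in> R" using xy(5)
    proof
      assume e: "g n x = g n' y"
      show ?thesis using g_R[OF sp[OF xy(1)], of n] g_R[OF sp[OF xy(2)], of n'] R_sym R_trans unfolding e by blast
    qed (use adjR in auto)
    then have "(x, y) \<in> cf (is, ns) (is', ns')" using xy(3-5) by (auto simp: cf_def)
    then show "x = y" using D(3)[OF xy(1,2)] by auto
  next
    fix "is" ns x assume x: "x \<in> E is" "length ns = length is" "tuple_in S ns x"
    then have "x \<in> W (is, ns)" using sets.sets_into_space[OF E] by (auto simp: W_def)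
    from D(4)[OF this]
    show "x \<in> D (is, ns) \<or> x \<in> (\<Union>is' ns'. D (is', ns')) \<or> (\<exists>is' ns' y n n'. y \<in> D (is', ns') \<and> n \<in> set ns \<and> n' \<in> set ns' \<and>
       (g n x = g n' y \<or> ((x, y) \<in> adj \<and> (g n x, g n' y) \<in> S)))"
      unfolding cf_def by (auto; blast)
  qed
qed


text \<open>If the set \<open>B\<close> of points that are not targets has positive measure,
  \<open>room\<close> places inside \<open>B\<close> a tuple for almost every \<open>x\<close> that
  avoids the S-classes of all targets of neighbours of \<open>x\<close>; by maximality a point to be
  served already has a tuple. The clause on empty adjacency lets the lemma apply to S = R with no
  adjacent points, where no class could be avoided.\<close>

lemma tuple_packing_complete:
  fixes E :: "nat list \<Rightarrow> 'a set"
  assumes S [measurable]: "S \<in> sets (M \<Otimes>\<^sub>M M)" and SR: "S \<subseteq> R" and Sst: "sym S"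
    and adj [measurable]: "adj \<in> sets (M \<Otimes>\<^sub>M M)" and adjR: "adj \<subseteq> R" and adjs: "sym adj"
    and E [measurable]: "\<And>is. E is \<in> sets M"
    and fin: "\<And>x. x \<in> space M \<Longrightarrow> finite (adj `` {x} \<inter> (\<Union>is. E is))"
    and room: "\<And>B. B \<in> sets M \<Longrightarrow> emeasure M B > 0 \<Longrightarrow> AE x in M. \<forall>Fin k. finite Fin \<longrightarrow>
        (adj `` {x} = {} \<longrightarrow> Fin = {}) \<longrightarrow>
        (\<exists>ys. length ys = k \<and> distinct ys \<and> set ys \<subseteq> B \<and>
          (\<forall>y\<in>set ys. (x, y) \<in> R \<and> (\<forall>y'\<in>set ys. (y, y') \<in> S) \<and> (\<forall>f\<in>Fin. (y, f) \<notin> S)))"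
  obtains D where "\<And>is ns. D is ns \<in> sets M"
    "\<And>is ns x. x \<in> D is ns \<Longrightarrow> x \<in> E is \<and> length ns = length is \<and> tuple_in S ns x"
    "\<And>is ns is' ns' x. x \<in> D is ns \<Longrightarrow> x \<in> D is' ns' \<Longrightarrow> is = is' \<and> ns = ns'"
    "\<And>is ns is' ns' x y n n'. x \<in> D is ns \<Longrightarrow> y \<in> D is' ns' \<Longrightarrow> n \<in> set ns \<Longrightarrow> n' \<in> set ns' \<Longrightarrow>
       g n x = g n' y \<or> ((x, y) \<in> adj \<and> (g n x, g n' y) \<in> S) \<Longrightarrow> x = y"
    "(AE x in M. x \<in> (\<Union>is. E is) \<longrightarrow> x \<in> (\<Union>is ns. D is ns)) \<or>
     (AE x in M. \<exists>is ns y. \<exists>n\<in>set ns. y \<in> D is ns \<and> x = g n y)"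
proof -
  obtain D where Dm [measurable]: "\<And>is ns. D is ns \<in> sets M"
    and D: "\<And>is ns x. x \<in> D is ns \<Longrightarrow> x \<in> E is \<and> length ns = length is \<and> tuple_in S ns x"
    and Du: "\<And>is ns is' ns' x. x \<in> D is ns \<Longrightarrow> x \<in> D is' ns' \<Longrightarrow> is = is' \<and> ns = ns'"
    and Dd: "\<And>is ns is' ns' x y n n'. x \<in> D is ns \<Longrightarrow> y \<in> D is' ns' \<Longrightarrow> n \<in> set ns \<Longrightarrow> n' \<in> set ns' \<Longrightarrow>
       g n x = g n' y \<or> ((x, y) \<in> adj \<and> (g n x, g n' y) \<in> S) \<Longrightarrow> x = y"
    and Dmax: "\<And>is ns x. x \<in> E is \<Longrightarrow> length ns = length is \<Longrightarrow> tuple_in S ns x \<Longrightarrow>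
       x \<in> D is ns \<or> x \<in> (\<Union>is' ns'. D is' ns') \<or> (\<exists>is' ns' y n n'. y \<in> D is' ns' \<and> n \<in> set ns \<and> n' \<in> set ns' \<and>
       (g n x = g n' y \<or> ((x, y) \<in> adj \<and> (g n x, g n' y) \<in> S)))"
    by (rule tuple_packing[of S adj E, OF S SR Sst adj adjR adjs E fin]) (assumption | rule that)+
  have sp: "x \<in> D is ns \<Longrightarrow> x \<in> space M" for x "is" ns using Dm sets.sets_into_space by blast
  define P where "P = {x \<in> space M. \<exists>is ns. \<exists>n\<in>set ns. gi n x \<in> D is ns}"
  have P [measurable]: "P \<in> sets M" unfolding P_def by measurable
  have P': "x \<in> P \<longleftrightarrow> (\<exists>is ns y. \<exists>n\<in>set ns. y \<in> D is ns \<and> x = g n y)" for x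
  proof
    assume "x \<in> P"
    then obtain "is" ns n where "x \<in> space M" "n \<in> set ns" "gi n x \<in> D is ns" by (auto simp: P_def)
    then show "\<exists>is ns y. \<exists>n\<in>set ns. y \<in> D is ns \<and> x = g n y" using g_gi(1)[of x n] by metis
  next
    assume "\<exists>is ns y. \<exists>n\<in>set ns. y \<in> D is ns \<and> x = g n y"
    then obtain "is" ns y n where "n \<in> set ns" "y \<in> D is ns" "x = g n y" by blast
    moreover from this have "gi n x \<in> D is ns" "x \<in> space M" using g_gi(2)[OF sp] sp by auto
    ultimately show "x \<in> P" unfolding P_def by blast
  qed
  have "(AE x in M. x \<in> (\<Union>is. E is) \<longrightarrow> x \<in> (\<Union>is ns. D is ns)) \<or> (AE x in M. x \<in> P)"
  proof (cases "emeasure M (space M - P) = 0")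
    case True
    then have "AE x in M. x \<notin> space M - P" by (intro AE_not_in) (auto simp: null_sets_def)
    with AE_space have "AE x in M. x \<in> P" by eventually_elim auto
    then show ?thesis ..
  next
    case False
    then have "emeasure M (space M - P) > 0" by (simp add: zero_less_iff_neq_zero)
    from room[OF _ this] have rm: "AE x in M. \<forall>Fin k. finite Fin \<longrightarrow>
        (adj `` {x} = {} \<longrightarrow> Fin = {}) \<longrightarrow>
        (\<exists>ys. length ys = k \<and> distinct ys \<and> set ys \<subseteq> space M - P \<and>
          (\<forall>y\<in>set ys. (x, y) \<in> R \<and> (\<forall>y'\<in>set ys. (y, y') \<in> S) \<and> (\<forall>f\<in>Fin. (y, f) \<notin> S)))" by simp
    have "AE x in M. x \<in> (\<Union>is. E is) \<longrightarrow> x \<in> (\<Union>is ns. D is ns)"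
      using rm AE_space
    proof eventually_elim
      case (elim x)
      show ?case
      proof (intro impI, rule ccontr)
        assume xE: "x \<in> (\<Union>is. E is)" and xD: "x \<notin> (\<Union>is ns. D is ns)"
        obtain "is" where xis: "x \<in> E is" using xE by blast
        \<comment> \<open>The targets already given to neighbours of \<open>x\<close>. There are
          finitely many, since by \<open>Du\<close> each neighbour has at most one tuple.\<close>
        define Fin where "Fin = (\<Union>y\<in>adj `` {x} \<inter> (\<Union>is. E is). \<Union>p\<in>{p. y \<in> D (fst p) (snd p)}. (\<lambda>n. g n y) ` set (snd p))"
        have "finite {p. y \<in> D (fst p) (snd p)}" for y
        proof (cases "\<exists>p. y \<in> D (fst p) (snd p)")
          case True
          then obtain p where p: "y \<in> D (fst p) (snd p)" by blast
          have "{p. y \<in> D (fst p) (snd p)} \<subseteq> {p}"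
            using Du[OF _ p] by (auto simp: prod_eq_iff)
          then show ?thesis by (rule finite_subset) simp
        qed simp
        then have "finite Fin" unfolding Fin_def using fin[OF elim(2)] by auto
        moreover have "adj `` {x} = {} \<longrightarrow> Fin = {}" by (auto simp: Fin_def)
        ultimately obtain ys where ys: "length ys = length is" "distinct ys" "set ys \<subseteq> space M - P"
          "\<And>y. y \<in> set ys \<Longrightarrow> (x, y) \<in> R" "\<And>y y'. y \<in> set ys \<Longrightarrow> y' \<in> set ys \<Longrightarrow> (y, y') \<in> S"
          "\<And>y f. y \<in> set ys \<Longrightarrow> f \<in> Fin \<Longrightarrow> (y, f) \<notin> S"
          using elim(1)[rule_format, of Fin "length is"] by blast
        define ns where "ns = map (\<lambda>y. SOME n. y = g n x) ys"
        have gs: "g (SOME n. y = g n x) x = y" if "y \<in> set ys" for y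
          using someI_ex[OF R_ex[OF ys(4)[OF that]]] by simp
        have mns: "map (\<lambda>n. g n x) ns = ys" unfolding ns_def by (simp add: map_idI gs)
        have gin: "g n x \<in> set ys" if "n \<in> set ns" for n
          using that unfolding mns[symmetric] by simp
        have "tuple_in S ns x" unfolding tuple_in_def mns using ys(2,5) gin by simp
        moreover have "length ns = length is" using ys(1) by (simp add: ns_def)
        ultimately have "\<exists>is' ns' y n n'. y \<in> D is' ns' \<and> n \<in> set ns \<and> n' \<in> set ns' \<and>
            (g n x = g n' y \<or> ((x, y) \<in> adj \<and> (g n x, g n' y) \<in> S))"
          using Dmax[OF xis, of ns] xD by blast
        then obtain is' ns' y n n' where y: "y \<in> D is' ns'" "n \<in> set ns" "n' \<in> set ns'"
            "g n x = g n' y \<or> ((x, y) \<in> adj \<and> (g n x, g n' y) \<in> S)" by blast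
        from y(4) show False
        proof
          assume "g n x = g n' y"
          then have "g n x \<in> P" using y unfolding P' by blast
          then show False using gin[OF y(2)] ys(3) by auto
        next
          assume a: "(x, y) \<in> adj \<and> (g n x, g n' y) \<in> S"
          have "g n' y \<in> Fin"
            unfolding Fin_def using a y D[OF y(1)] by (intro UN_I[of y] UN_I[of "(is', ns')"]) auto
          then show False using ys(6)[OF gin[OF y(2)]] a by blast
        qed
      qed
    qed
    then show ?thesis ..
  qed
  note alt = this[unfolded P']
  show ?thesis by (rule that[of D]) (fact Dm D Du Dd alt)+
qed

section \<open>Tuples inside a set of positive measure\<close>

lemma ergodic_hit:
  assumes erg: "ergodic_rel M R" and B [measurable]: "B \<in> sets M" and pos: "emeasure M B > 0"
  shows "AE x in M. \<exists>y\<in>B. (x, y) \<in> R"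
proof -
  define Z where "Z = {x \<in> space M. \<exists>n. g n x \<in> B}"
  have Z [measurable]: "Z \<in> sets M" unfolding Z_def by measurable
  have Z': "x \<in> Z \<longleftrightarrow> (\<exists>y\<in>B. (x, y) \<in> R)" for x unfolding Z_def by (auto simp: R_eq)
  have "R `` Z = Z"
  proof (intro Set.set_eqI iffI)
    fix y assume "y \<in> R `` Z"
    then obtain x b where "(x, y) \<in> R" "(x, b) \<in> R" "b \<in> B" by (auto simp: Z')
    then show "y \<in> Z" using R_sym[of x y] R_trans[of y x b] by (auto simp: Z')
  next
    fix y assume "y \<in> Z"
    then show "y \<in> R `` Z" using R_refl[of y] by (auto simp: Z_def)
  qed
  then have "emeasure M Z = 0 \<or> emeasure M (space M - Z) = 0" using erg Z by (auto simp: ergodic_rel_def)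
  moreover have "B \<subseteq> Z" using R_refl sets.sets_into_space[OF B] unfolding Z' subset_iff by blast
  then have "emeasure M B \<le> emeasure M Z" by (intro emeasure_mono) auto
  ultimately have "emeasure M (space M - Z) = 0" using pos by auto
  then have "AE x in M. x \<notin> space M - Z" by (intro AE_not_in) (auto simp: null_sets_def)
  with AE_space show ?thesis by eventually_elim (auto simp: Z')
qed

lemma infinite_distinct_list:
  assumes "infinite A"
  shows "\<exists>ys. length ys = k \<and> distinct ys \<and> set ys \<subseteq> A"
proof -
  obtain T where "finite T" "card T = k" "T \<subseteq> A" using infinite_arbitrarily_large[OF assms] by blast
  moreover then obtain ys where "set ys = T" "distinct ys" using finite_distinct_list by blast
  ultimately show ?thesis using distinct_card by metis
qed

lemma AE_related_tuple:
  assumes erg: "ergodic_rel M R" and inf: "AE x in M. infinite (R `` {x})"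
    and B: "B \<in> sets M" "emeasure M B > 0"
  shows "AE x in M. \<exists>ys. length ys = k \<and> distinct ys \<and> set ys \<subseteq> B \<and> (\<forall>y\<in>set ys. (x, y) \<in> R)"
  using ergodic_hit[OF erg B] AE_rel[OF infinite_restrict[OF R_meas subset_refl R_equiv inf B(1)]]
proof eventually_elim
  case (elim x)
  then obtain y where y: "y \<in> B" "(x, y) \<in> R" "infinite (R `` {y} \<inter> B)" by blast
  obtain ys where "length ys = k" "distinct ys" "set ys \<subseteq> R `` {y} \<inter> B"
    using infinite_distinct_list[OF y(3)] by blast
  then show ?case using y(2) R_trans by blast
qed

text \<open>The point \<open>x\<close> need not lie in \<open>B\<close>: ergodicity provides a
  related point of \<open>B\<close>, where infinite index of the restriction to \<open>B\<close>
  yields a class that misses \<open>Fin\<close>. Aperiodicity alone would not make its trace on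
  \<open>B\<close> infinite; this is \<open>infinite_restrict\<close>.\<close>

lemma AE_avoiding_tuple:
  assumes erg: "ergodic_rel M R"
    and S: "S \<in> sets (M \<Otimes>\<^sub>M M)" "S \<subseteq> R" "equiv (space M) S"
    and inf: "AE x in M. infinite (S `` {x})" and eii: "everywhere_infinite_index M R S"
    and B: "B \<in> sets M" "emeasure M B > 0"
  shows "AE x in M. \<forall>Fin k. finite Fin \<longrightarrow> (\<exists>ys. length ys = k \<and> distinct ys \<and> set ys \<subseteq> B \<and>
          (\<forall>y\<in>set ys. (x, y) \<in> R \<and> (\<forall>y'\<in>set ys. (y, y') \<in> S) \<and> (\<forall>f\<in>Fin. (y, f) \<notin> S)))"
proof -
  have Sst: "sym S" "trans S" using S(3) by (auto simp: equiv_def)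
  have i: "AE x in M. x \<in> B \<longrightarrow> infinite (((R \<inter> (B \<times> B)) `` {x}) // (S \<inter> (B \<times> B)))"
    using eii B by (auto simp: everywhere_infinite_index_def)
  show ?thesis
    using ergodic_hit[OF erg B] AE_rel[OF infinite_restrict[OF S inf B(1)]] AE_rel[OF i]
  proof (eventually_elim, intro allI impI)
    fix x :: 'a and Fin :: "'a set" and k :: nat assume h: "\<exists>y\<in>B. (x, y) \<in> R"
      "\<forall>y. (x, y) \<in> R \<longrightarrow> y \<in> B \<longrightarrow> infinite (S `` {y} \<inter> B)"
      "\<forall>y. (x, y) \<in> R \<longrightarrow> y \<in> B \<longrightarrow> infinite (((R \<inter> (B \<times> B)) `` {y}) // (S \<inter> (B \<times> B)))"
      and Fin: "finite Fin"
    obtain y where y: "y \<in> B" "(x, y) \<in> R" using h(1) by blast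
    have "\<exists>z\<in>B. (x, z) \<in> R \<and> (\<forall>f\<in>Fin. (z, f) \<notin> S)"
    proof (rule ccontr)
      assume n: "\<not> (\<exists>z\<in>B. (x, z) \<in> R \<and> (\<forall>f\<in>Fin. (z, f) \<notin> S))"
      have "((R \<inter> (B \<times> B)) `` {y}) // (S \<inter> (B \<times> B)) \<subseteq> (\<lambda>f. S `` {f} \<inter> B) ` Fin"
      proof
        fix C assume "C \<in> ((R \<inter> (B \<times> B)) `` {y}) // (S \<inter> (B \<times> B))"
        then obtain z where z: "z \<in> B" "(y, z) \<in> R" "C = (S \<inter> (B \<times> B)) `` {z}" by (auto simp: quotient_def)
        then obtain f where f: "f \<in> Fin" "(z, f) \<in> S" using n R_trans[OF y(2) z(2)] by blast
        have "C = S `` {f} \<inter> B" using z f Sst by (auto dest: symD transD)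
        then show "C \<in> (\<lambda>f. S `` {f} \<inter> B) ` Fin" using f(1) by blast
      qed
      then have "finite (((R \<inter> (B \<times> B)) `` {y}) // (S \<inter> (B \<times> B)))"
        using Fin finite_subset by blast
      then show False using h(3) y by blast
    qed
    then obtain z where z: "z \<in> B" "(x, z) \<in> R" "\<And>f. f \<in> Fin \<Longrightarrow> (z, f) \<notin> S" by blast
    obtain ys where ys: "length ys = k" "distinct ys" "set ys \<subseteq> S `` {z} \<inter> B"
      using infinite_distinct_list h(2) z by blast
    have zy: "(z, u) \<in> S" if "u \<in> set ys" for u using that ys(3) by auto
    have "(x, u) \<in> R" "(u, u') \<in> S" "\<forall>f\<in>Fin. (u, f) \<notin> S" if "u \<in> set ys" "u' \<in> set ys" for u u'
      using zy[OF that(1)] zy[OF that(2)] S(2) R_trans[OF z(2)] z(3) Sst by (auto dest: symD transD)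
    then show "\<exists>ys. length ys = k \<and> distinct ys \<and> set ys \<subseteq> B \<and>
          (\<forall>y\<in>set ys. (x, y) \<in> R \<and> (\<forall>y'\<in>set ys. (y, y') \<in> S) \<and> (\<forall>f\<in>Fin. (y, f) \<notin> S))"
      using ys by (intro exI[of _ ys]) auto
  qed
qed


text \<open>The packing of disjoint \<open>N\<close>-tuples is complete although its domain is the whole space, because
  \<open>N\<close> disjoint copies of a conull set do not fit into a probability space.\<close>

lemma block_relation:
  assumes erg: "ergodic_rel M R" and inf: "AE x in M. infinite (R `` {x})" and N: "N \<ge> 2"
  obtains E where "E \<in> sets (M \<Otimes>\<^sub>M M)" "E \<subseteq> R" "equiv (space M) E"
    "\<And>x. x \<in> space M \<Longrightarrow> finite (E `` {x})" "AE x in M. card (E `` {x}) = N"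
proof -
  \<comment> \<open>Only the length of this label matters; its entries are arbitrary.\<close>
  define is0 :: "nat list" where "is0 = replicate N 0"
  define E0 where "E0 is = (if is = is0 then space M else {})" for "is"
  have E0: "E0 is \<in> sets M" for "is" by (simp add: E0_def)
  have Rsym: "sym R" using R_equiv by (simp add: equiv_def)
  have room: "AE x in M. \<forall>Fin k. finite Fin \<longrightarrow> (({} :: ('a \<times> 'a) set) `` {x} = {} \<longrightarrow> Fin = {}) \<longrightarrow>
        (\<exists>ys. length ys = k \<and> distinct ys \<and> set ys \<subseteq> B \<and>
          (\<forall>y\<in>set ys. (x, y) \<in> R \<and> (\<forall>y'\<in>set ys. (y, y') \<in> R) \<and> (\<forall>f\<in>Fin. (y, f) \<notin> R)))"
    if B: "B \<in> sets M" "emeasure M B > 0" for B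
  proof -
    have "AE x in M. \<forall>k. \<exists>ys. length ys = k \<and> distinct ys \<and> set ys \<subseteq> B \<and> (\<forall>y\<in>set ys. (x, y) \<in> R)"
      using AE_related_tuple[OF erg inf B] by (simp add: AE_all_countable)
    then show ?thesis
    proof (eventually_elim, intro allI impI)
      fix x :: 'a and Fin :: "'a set" and k :: nat
      assume h: "\<forall>k. \<exists>ys. length ys = k \<and> distinct ys \<and> set ys \<subseteq> B \<and> (\<forall>y\<in>set ys. (x, y) \<in> R)"
        and F: "({} :: ('a \<times> 'a) set) `` {x} = {} \<longrightarrow> Fin = {}"
      obtain ys where ys: "length ys = k" "distinct ys" "set ys \<subseteq> B" "\<forall>y\<in>set ys. (x, y) \<in> R" using h by blast
      have "(y, y') \<in> R" if "y \<in> set ys" "y' \<in> set ys" for y y'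
        using that ys(4) R_sym R_trans by blast
      then show "\<exists>ys. length ys = k \<and> distinct ys \<and> set ys \<subseteq> B \<and>
          (\<forall>y\<in>set ys. (x, y) \<in> R \<and> (\<forall>y'\<in>set ys. (y, y') \<in> R) \<and> (\<forall>f\<in>Fin. (y, f) \<notin> R))"
        using ys F by (intro exI[of _ ys]) auto
    qed
  qed
  \<comment> \<open>With empty adjacency the packing only has to keep the tuples disjoint.\<close>
  have empt: "{} \<in> sets (M \<Otimes>\<^sub>M M)" "{} \<subseteq> R" "sym ({} :: ('a \<times> 'a) set)" by (auto simp: sym_def)
  have efin: "finite (({} :: ('a \<times> 'a) set) `` {x} \<inter> (\<Union>is. E0 is))" for x by simp
  obtain D where Dm [measurable]: "\<And>is ns. D is ns \<in> sets M"
    and D: "\<And>is ns x. x \<in> D is ns \<Longrightarrow> x \<in> E0 is \<and> length ns = length is \<and> tuple_in R ns x"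
    and Du: "\<And>is ns is' ns' x. x \<in> D is ns \<Longrightarrow> x \<in> D is' ns' \<Longrightarrow> is = is' \<and> ns = ns'"
    and Dd: "\<And>is ns is' ns' x y n n'. x \<in> D is ns \<Longrightarrow> y \<in> D is' ns' \<Longrightarrow> n \<in> set ns \<Longrightarrow> n' \<in> set ns' \<Longrightarrow>
       g n x = g n' y \<or> ((x, y) \<in> {} \<and> (g n x, g n' y) \<in> R) \<Longrightarrow> x = y"
    and alt: "(AE x in M. x \<in> (\<Union>is. E0 is) \<longrightarrow> x \<in> (\<Union>is ns. D is ns)) \<or>
     (AE x in M. \<exists>is ns y. \<exists>n\<in>set ns. y \<in> D is ns \<and> x = g n y)"
    by (rule tuple_packing_complete[of R "{}" E0, OF R_meas subset_refl Rsym empt E0 efin room]) (assumption | rule that)+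
  have sp: "x \<in> D is ns \<Longrightarrow> x \<in> space M" for x "is" ns using Dm sets.sets_into_space by blast
  have Dis: "is = is0" "length ns = N" if "x \<in> D is ns" for x "is" ns
    using D[OF that] by (auto simp: E0_def is0_def split: if_splits)
  have cover: "AE x in M. \<exists>is ns y. \<exists>n\<in>set ns. y \<in> D is ns \<and> x = g n y"
    using alt
  proof
    assume a: "AE x in M. x \<in> (\<Union>is. E0 is) \<longrightarrow> x \<in> (\<Union>is ns. D is ns)"
    have a: "AE x in M. x \<in> (\<Union>ns. D is0 ns)"
      using a AE_space by eventually_elim (use Dis in \<open>auto simp: E0_def\<close>)
    \<comment> \<open>\<open>G j\<close> sends a point to the entry \<open>j\<close> of its tuple.
      The entries 0 and 1 suffice for the contradiction: both ranges would have measure 1, yet they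
      are disjoint.\<close>
    define G where "G j = {(x, y). (x, y) \<in> R \<and> (\<exists>ns. x \<in> D is0 ns \<and> y = g (ns ! j) x)}" for j
    have G: "G j \<in> sets (M \<Otimes>\<^sub>M M)" "G j \<subseteq> R" for j
      unfolding G_def by (intro rel_setI', measurable) auto
    have sv: "single_valued (G j)" for j
      using Du by (auto simp: G_def single_valued_def) blast
    have nth: "ns ! j \<in> set ns" if "x \<in> D is ns" "j < 2" for x "is" ns j
      using Dis[OF that(1)] that(2) N by simp
    have sv': "single_valued ((G j)\<inverse>)" if "j < 2" for j
      using Dd nth that unfolding G_def single_valued_def by auto blast
    have dom: "Domain (G j) = (\<Union>ns. D is0 ns)" for j
      using sp by (fastforce simp: G_def)
    have r1: "prob (Range (G j)) = 1" if "j < 2" for j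
    proof -
      have "prob (Domain (G j)) = 1" unfolding dom using a by (subst prob_eq_1) auto
      then show ?thesis
        using partial_bijection_measure[OF G sv sv'[OF that]] by (simp add: emeasure_eq_measure)
    qed
    have "Range (G 0) \<inter> Range (G 1) = {}"
    proof (rule ccontr)
      assume "Range (G 0) \<inter> Range (G 1) \<noteq> {}"
      then obtain x y ns ns' where xy: "x \<in> D is0 ns" "y \<in> D is0 ns'" "g (ns ! 0) x = g (ns' ! 1) y"
        by (auto simp: G_def)
      then have "x = y" using Dd[OF xy(1,2) nth[OF xy(1), of 0] nth[OF xy(2), of 1]] by auto
      then have "ns = ns'" using Du xy by blast
      have "distinct (map (\<lambda>n. g n x) ns)" using D[OF xy(1)] by (simp add: tuple_in_def)
      from nth_eq_iff_index_eq[OF this, of 0 1] show False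
        using xy(3) N Dis(2)[OF xy(1)] unfolding \<open>ns = ns'\<close> \<open>x = y\<close> by simp
    qed
    then have "prob (Range (G 0) \<union> Range (G 1)) = 2"
      using Range_meas[OF G] r1 by (subst finite_measure_Union) auto
    then show ?thesis using prob_le_1[of "Range (G 0) \<union> Range (G 1)"] by simp
  qed
  \<comment> \<open>The pairs \<open>u = v\<close> make \<open>E\<close> reflexive also on the null
    set that the tuples miss.\<close>
  define E where "E = {(u, v). (u, v) \<in> R \<and> (u = v \<or> (\<exists>is ns. \<exists>n\<in>set ns. \<exists>n'\<in>set ns. gi n u \<in> D is ns \<and> v = g n' (gi n u)))}"
  have Em: "E \<in> sets (M \<Otimes>\<^sub>M M)" unfolding E_def by (intro rel_setI') measurable
  have ER: "E \<subseteq> R" by (auto simp: E_def)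
  have Echar: "(u, v) \<in> E \<longleftrightarrow> (u, v) \<in> R \<and> (u = v \<or> (\<exists>is ns x. \<exists>n\<in>set ns. \<exists>n'\<in>set ns. x \<in> D is ns \<and> u = g n x \<and> v = g n' x))"
    for u v
  proof
    assume "(u, v) \<in> E"
    then show "(u, v) \<in> R \<and> (u = v \<or> (\<exists>is ns x. \<exists>n\<in>set ns. \<exists>n'\<in>set ns. x \<in> D is ns \<and> u = g n x \<and> v = g n' x))"
      using g_gi(1) R_space(1)[of u v] unfolding E_def mem_Collect_eq case_prod_conv by metis
  next
    assume h: "(u, v) \<in> R \<and> (u = v \<or> (\<exists>is ns x. \<exists>n\<in>set ns. \<exists>n'\<in>set ns. x \<in> D is ns \<and> u = g n x \<and> v = g n' x))"
    then show "(u, v) \<in> E"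
      using g_gi(2)[OF sp] unfolding E_def mem_Collect_eq case_prod_conv by metis
  qed
  have cls: "E `` {g n x} = (\<lambda>n. g n x) ` set ns" if x: "x \<in> D is ns" "n \<in> set ns" for "is" ns n x
  proof (intro subset_antisym subsetI)
    fix v assume "v \<in> E `` {g n x}"
    then have "(g n x, v) \<in> E" by simp
    then consider "g n x = v" | is' ns' y m n' where "y \<in> D is' ns'" "m \<in> set ns'" "n' \<in> set ns'" "g n x = g m y" "v = g n' y"
      unfolding Echar by blast
    then show "v \<in> (\<lambda>n. g n x) ` set ns"
    proof cases
      case 2
      then have "x = y" using Dd x by blast
      then have "ns = ns'" using Du x 2 by blast
      then show ?thesis using 2 \<open>x = y\<close> by blast
    qed (use x in auto)
  next
    fix v assume "v \<in> (\<lambda>n. g n x) ` set ns"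
    then obtain n' where n': "n' \<in> set ns" "v = g n' x" by blast
    have "(g n x, v) \<in> R" using R_sym[OF g_R[OF sp[OF x(1)], of n]] R_trans g_R[OF sp[OF x(1)], of n'] n' by blast
    then show "v \<in> E `` {g n x}" using x n' unfolding Image_singleton_iff Echar by blast
  qed
  have clsu: "E `` {u} = {u}" if "u \<in> space M" "\<not> (\<exists>is ns y. \<exists>n\<in>set ns. y \<in> D is ns \<and> u = g n y)" for u
    using that R_refl[of u] by (auto simp: Echar) blast
  have "equiv (space M) E"
  proof (rule equivI)
    show "E \<subseteq> space M \<times> space M" using R_space by (auto simp: E_def)
    show "refl_on (space M) E" using R_refl by (auto simp: refl_on_def E_def)
    show "sym E"
    proof (rule symI)
      fix u v assume "(u, v) \<in> E"
      then show "(v, u) \<in> E" using R_sym unfolding Echar by metis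
    qed
    show "trans E"
    proof (rule transI)
      fix u v w assume uv: "(u, v) \<in> E" and vw: "(v, w) \<in> E"
      show "(u, w) \<in> E"
      proof (cases "u = v")
        case False
        then obtain "is" ns x n n' where x: "n \<in> set ns" "n' \<in> set ns" "x \<in> D is ns" "u = g n x" "v = g n' x"
          using uv unfolding Echar by blast
        have "w \<in> E `` {u}" using vw cls[OF x(3,1)] cls[OF x(3,2)] x by auto
        then show ?thesis by simp
      qed (use vw in simp)
    qed
  qed
  moreover have "finite (E `` {u})" if "u \<in> space M" for u
  proof (cases "\<exists>is ns y. \<exists>n\<in>set ns. y \<in> D is ns \<and> u = g n y")
    case True
    then obtain "is" ns y n where y: "n \<in> set ns" "y \<in> D is ns" "u = g n y" by blast
    then show ?thesis using cls[OF y(2,1)] by simp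
  qed (use clsu that in simp)
  moreover have "AE u in M. card (E `` {u}) = N"
    using cover
  proof eventually_elim
    case (elim u)
    then obtain "is" ns y n where y: "n \<in> set ns" "y \<in> D is ns" "u = g n y" by blast
    have "card ((\<lambda>n. g n y) ` set ns) = length (map (\<lambda>n. g n y) ns)"
      using D[OF y(2)] distinct_card[of "map (\<lambda>n. g n y) ns"] by (simp add: tuple_in_def)
    then show ?case using cls[OF y(2,1)] Dis[OF y(2)] y(3) by simp
  qed
  ultimately show ?thesis using that Em ER by blast
qed

text \<open>A transversal \<open>Y\<close> of \<open>F\<close> is packed by tuples in \<open>S\<close>-classes, one target for each point of the
  \<open>F\<close>-class; two \<open>F\<close>-classes are adjacent if some \<open>g i\<close> with \<open>i \<le> L\<close> joins them.\<close>

lemma conjugate_to_finite: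
  assumes erg: "ergodic_rel M R"
    and S [measurable]: "S \<in> sets (M \<Otimes>\<^sub>M M)" and SR: "S \<subseteq> R" and Seq: "equiv (space M) S"
    and inf: "AE x in M. infinite (S `` {x})" and eii: "everywhere_infinite_index M R S"
    and F [measurable]: "F \<in> sets (M \<Otimes>\<^sub>M M)" and FR: "F \<subseteq> R" and Feq: "equiv (space M) F"
    and Ffin: "\<And>x. x \<in> space M \<Longrightarrow> finite (F `` {x})"
  obtains T where "T \<in> full_group M R"
    "AE x in M. \<forall>i\<le>L. (x, g i x) \<in> F \<longleftrightarrow> (the_inv_into (space M) T x, the_inv_into (space M) T (g i x)) \<in> S"
proof -
  have Fst: "sym F" "trans F" using Feq by (auto simp: equiv_def)
  have Sst: "sym S" "trans S" using Seq by (auto simp: equiv_def)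
  have Frefl: "(x, x) \<in> F" if "x \<in> space M" for x using Feq that by (auto simp: equiv_def refl_on_def)
  have Fsp: "x \<in> space M" "y \<in> space M" if "(x, y) \<in> F" for x y using that FR R_space by auto
  define Y where "Y = min_points F"
  have Y [measurable]: "Y \<in> sets M" unfolding Y_def by (rule min_points_meas[OF F FR])
  have Yu: "x = y" if "x \<in> Y" "y \<in> Y" "(x, y) \<in> F" for x y
    using min_points_unique[OF Fst(1)] that by (simp add: Y_def)
  have Yex: "\<exists>y\<in>Y. (x, y) \<in> F" if "x \<in> space M" for x
    using min_points_exist[OF FR Fst Frefl[OF that] Ffin[OF that]] by (simp add: Y_def)
  \<comment> \<open>The list \<open>is\<close> reaches every point of the F-class of
    \<open>x\<close> exactly once. Several lists may do so; the packing selects at most one for each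
    \<open>x\<close>.\<close>
  define E where "E is = {x \<in> space M. x \<in> Y \<and> distinct (map (\<lambda>n. g n x) is) \<and> (\<forall>i\<in>set is. (x, g i x) \<in> F) \<and>
      (\<forall>n. (x, g n x) \<in> F \<longrightarrow> (\<exists>i\<in>set is. g n x = g i x))}" for "is"
  have E: "E is \<in> sets M" for "is" unfolding E_def by measurable
  have EY: "E is \<subseteq> Y" for "is" by (auto simp: E_def)
  have Ecls: "F `` {x} = (\<lambda>n. g n x) ` set is" if "x \<in> E is" for x "is"
    using that R_ex[OF subsetD[OF FR]] by (auto simp: E_def) (metis imageI)
  have Eex: "\<exists>is. x \<in> E is" if x: "x \<in> Y" for x
  proof -
    have xs: "x \<in> space M" using x sets.sets_into_space[OF Y] by auto
    obtain us where us: "set us = F `` {x}" "distinct us" using finite_distinct_list[OF Ffin[OF xs]] by blast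
    define "is" where "is = map (\<lambda>y. SOME n. y = g n x) us"
    have gs: "g (SOME n. y = g n x) x = y" if "y \<in> set us" for y
      using someI_ex[OF R_ex[of x y]] that us FR by auto
    have m: "map (\<lambda>n. g n x) is = us" unfolding is_def by (simp add: map_idI gs)
    have im: "(\<lambda>n. g n x) ` set is = F `` {x}" using arg_cong[OF m, of set] us by simp
    have "x \<in> E is" unfolding E_def mem_Collect_eq m
    proof (intro conjI ballI allI impI)
      show "(x, g i x) \<in> F" if "i \<in> set is" for i using im that by blast
      show "\<exists>i\<in>set is. g n x = g i x" if "(x, g n x) \<in> F" for n using im that by blast
    qed (use xs x us in auto)
    then show ?thesis ..
  qed
  define adj where "adj = {(x, y). (x, y) \<in> R \<and> (\<exists>i\<in>{..L}. \<exists>a b. (x, g a x) \<in> F \<and> (y, g b y) \<in> F \<and>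
      (g i (g a x) = g b y \<or> g a x = g i (g b y)))}"
  have adjm: "adj \<in> sets (M \<Otimes>\<^sub>M M)" unfolding adj_def by (intro rel_setI') measurable
  have adjR: "adj \<subseteq> R" by (auto simp: adj_def)
  have adjs: "sym adj"
  proof (rule symI)
    fix x y assume "(x, y) \<in> adj"
    then show "(y, x) \<in> adj" using R_sym unfolding adj_def mem_Collect_eq case_prod_conv by metis
  qed
  have adjfin: "finite (adj `` {x})" if xs: "x \<in> space M" for x
  proof (rule finite_subset)
    show "adj `` {x} \<subseteq> (\<Union>u\<in>F `` {x}. \<Union>i\<in>{..L}. F `` {g i u} \<union> F `` {gi i u})"
    proof
      fix y assume "y \<in> adj `` {x}"
      then obtain i a b where h: "i \<le> L" "(x, g a x) \<in> F" "(y, g b y) \<in> F" "(x, y) \<in> R"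
        "g i (g a x) = g b y \<or> g a x = g i (g b y)" by (auto simp: adj_def)
      have "gi i (g a x) = g b y" if "g a x = g i (g b y)" using that g_gi(2) R_space(2)[OF h(4)] by simp
      then have "g b y = g i (g a x) \<or> g b y = gi i (g a x)" using h(5) by auto
      moreover have "y \<in> F `` {g b y}" using h(3) Fst(1) by (auto dest: symD)
      ultimately have "y \<in> F `` {g i (g a x)} \<union> F `` {gi i (g a x)}" by auto
      then show "y \<in> (\<Union>u\<in>F `` {x}. \<Union>i\<in>{..L}. F `` {g i u} \<union> F `` {gi i u})"
        using h(1,2) by blast
    qed
    show "finite (\<Union>u\<in>F `` {x}. \<Union>i\<in>{..L}. F `` {g i u} \<union> F `` {gi i u})"
      using Ffin xs Fsp by (intro finite_UN_I finite_UnI) auto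
  qed
  have room: "AE x in M. \<forall>Fin k. finite Fin \<longrightarrow> (adj `` {x} = {} \<longrightarrow> Fin = {}) \<longrightarrow>
        (\<exists>ys. length ys = k \<and> distinct ys \<and> set ys \<subseteq> B \<and>
          (\<forall>y\<in>set ys. (x, y) \<in> R \<and> (\<forall>y'\<in>set ys. (y, y') \<in> S) \<and> (\<forall>f\<in>Fin. (y, f) \<notin> S)))"
    if B: "B \<in> sets M" "emeasure M B > 0" for B
    using AE_avoiding_tuple[OF erg S SR Seq inf eii B] by eventually_elim simp
  have fin: "finite (adj `` {x} \<inter> (\<Union>is. E is))" if "x \<in> space M" for x
    using adjfin[OF that] by simp
  obtain D where Dm [measurable]: "\<And>is ns. D is ns \<in> sets M"
    and D: "\<And>is ns x. x \<in> D is ns \<Longrightarrow> x \<in> E is \<and> length ns = length is \<and> tuple_in S ns x"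
    and Du: "\<And>is ns is' ns' x. x \<in> D is ns \<Longrightarrow> x \<in> D is' ns' \<Longrightarrow> is = is' \<and> ns = ns'"
    and Dd: "\<And>is ns is' ns' x y n n'. x \<in> D is ns \<Longrightarrow> y \<in> D is' ns' \<Longrightarrow> n \<in> set ns \<Longrightarrow> n' \<in> set ns' \<Longrightarrow>
       g n x = g n' y \<or> ((x, y) \<in> adj \<and> (g n x, g n' y) \<in> S) \<Longrightarrow> x = y"
    and alt: "(AE x in M. x \<in> (\<Union>is. E is) \<longrightarrow> x \<in> (\<Union>is ns. D is ns)) \<or>
     (AE x in M. \<exists>is ns y. \<exists>n\<in>set ns. y \<in> D is ns \<and> x = g n y)"
    by (rule tuple_packing_complete[of S adj E, OF S SR Sst(1) adjm adjR adjs E fin room]) (assumption | rule that)+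
  have sp: "x \<in> D is ns \<Longrightarrow> x \<in> space M" for x "is" ns using Dm sets.sets_into_space by blast
  \<comment> \<open>\<open>V\<close> matches the entry \<open>j\<close> of the list of an F-class
    with the entry \<open>j\<close> of the tuple given to its least point.\<close>
  define V where "V = {(u, v). (u, v) \<in> R \<and> (\<exists>is ns. \<exists>j\<in>{..<length ns}. gi (is ! j) u \<in> D is ns \<and> v = g (ns ! j) (gi (is ! j) u))}"
  have Vm: "V \<in> sets (M \<Otimes>\<^sub>M M)" unfolding V_def by (intro rel_setI') measurable
  have VR: "V \<subseteq> R" by (auto simp: V_def)
  have Vchar: "(u, v) \<in> V \<longleftrightarrow> (\<exists>is ns j x. x \<in> D is ns \<and> j < length ns \<and> u = g (is ! j) x \<and> v = g (ns ! j) x)" for u v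
  proof
    assume "(u, v) \<in> V"
    then obtain "is" ns j where h: "j < length ns" "(u, v) \<in> R" "gi (is ! j) u \<in> D is ns" "v = g (ns ! j) (gi (is ! j) u)"
      by (auto simp: V_def)
    moreover have "u = g (is ! j) (gi (is ! j) u)" using g_gi(1)[OF R_space(1)[OF h(2)]] by simp
    ultimately show "\<exists>is ns j x. x \<in> D is ns \<and> j < length ns \<and> u = g (is ! j) x \<and> v = g (ns ! j) x" by blast
  next
    assume "\<exists>is ns j x. x \<in> D is ns \<and> j < length ns \<and> u = g (is ! j) x \<and> v = g (ns ! j) x"
    then obtain "is" ns j x where h: "x \<in> D is ns" "j < length ns" "u = g (is ! j) x" "v = g (ns ! j) x" by blast
    have "(u, v) \<in> R" using h R_sym[OF g_R[OF sp[OF h(1)], of "is ! j"]] R_trans g_R[OF sp[OF h(1)], of "ns ! j"] by blast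
    then show "(u, v) \<in> V" using h g_gi(2)[OF sp[OF h(1)]] unfolding V_def mem_Collect_eq case_prod_conv lessThan_iff Bex_def
      by metis
  qed
  have src: "x = y \<and> j = k" if "x \<in> D is ns" "y \<in> D is' ns'" "j < length ns" "k < length ns'" "g (is ! j) x = g (is' ! k) y"
    for x y "is" ns is' ns' j k
  proof -
    have l: "length ns = length is" "length ns' = length is'" and xy: "x \<in> E is" "y \<in> E is'" using D that by blast+
    have "(x, g (is ! j) x) \<in> F" "(y, g (is' ! k) y) \<in> F"
      using xy nth_mem[of j "is"] nth_mem[of k is'] that(3,4) l by (auto simp: E_def)
    then have "(x, y) \<in> F" using that(5) Fst by (metis symD transD)
    then have xy': "x = y" using Yu EY xy by blast
    then have "is' = is" using Du that by blast
    then show ?thesis using xy' xy(1) that l unfolding E_def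
      using nth_eq_iff_index_eq[of "map (\<lambda>n. g n x) is" j k] by auto
  qed
  have sv: "single_valued V"
  proof (rule single_valuedI)
    fix u v w assume "(u, v) \<in> V" "(u, w) \<in> V"
    then show "v = w" unfolding Vchar using src Du by metis
  qed
  have tgt: "x = y \<and> j = k" if "x \<in> D is ns" "y \<in> D is' ns'" "j < length ns" "k < length ns'" "g (ns ! j) x = g (ns' ! k) y"
    for x y "is" ns is' ns' j k
  proof -
    have xy: "x = y" using Dd[OF that(1,2)] that by (metis nth_mem)
    then have "ns' = ns" using Du that by blast
    then show ?thesis using xy that D[OF that(1)] unfolding tuple_in_def
      using nth_eq_iff_index_eq[of "map (\<lambda>n. g n x) ns" j k] by auto
  qed
  have sv': "single_valued (V\<inverse>)"
  proof (rule single_valuedI)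
    fix u v w assume "(u, v) \<in> V\<inverse>" "(u, w) \<in> V\<inverse>"
    then show "v = w" unfolding converse_iff Vchar using tgt Du by metis
  qed
  have RV: "u \<in> Range V" if "\<exists>is ns y. \<exists>n\<in>set ns. y \<in> D is ns \<and> u = g n y" for u
    using that unfolding Range_iff Vchar by (metis in_set_conv_nth)
  \<comment> \<open>Immediate if the targets cover the space. If instead all least points are
    served, the domain of \<open>V\<close> is conull, and its range has the same measure.\<close>
  have "AE u in M. u \<in> Range V"
    using alt
  proof
    assume a: "AE x in M. x \<in> (\<Union>is. E is) \<longrightarrow> x \<in> (\<Union>is ns. D is ns)"
    have "AE u in M. u \<in> Domain V"
      using AE_rel[OF a] AE_space
    proof eventually_elim
      case (elim u)
      obtain y where y: "y \<in> Y" "(u, y) \<in> F" using Yex[OF elim(2)] by blast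
      then obtain "is" ns where D': "y \<in> D is ns" using elim(1) FR Eex[OF y(1)] by blast
      have "u \<in> (\<lambda>n. g n y) ` set is" using y(2) Fst(1) Ecls[of y "is"] D[OF D'] by (auto dest: symD)
      then obtain j where "j < length is" "u = g (is ! j) y" by (auto simp: in_set_conv_nth)
      then have "(u, g (ns ! j) y) \<in> V" unfolding Vchar using D' D[OF D'] by metis
      then show ?case by blast
    qed
    then have "prob (Domain V) = 1" using Domain_meas[OF Vm VR] by (simp add: prob_eq_1)
    then have "prob (Range V) = 1"
      using partial_bijection_measure[OF Vm VR sv sv'] by (simp add: emeasure_eq_measure)
    then show ?thesis using Range_meas[OF Vm VR] by (simp add: prob_eq_1)
  qed (use RV in \<open>auto elim: eventually_mono\<close>)
  then have dom: "AE u in M. u \<in> Domain (V\<inverse>)" by simp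
  \<comment> \<open>Extending the converse of \<open>V\<close> makes the inverse of \<open>T\<close>
    agree with \<open>V\<close> almost everywhere, so that this inverse carries an F-class to its
    tuple.\<close>
  obtain T where T: "T \<in> full_group M R" "AE x in M. (the_inv_into (space M) T x, x) \<in> V\<inverse>"
    using extend_partial_bijection[OF converse_meas[OF Vm] converse_R[OF VR] sv' _ dom] sv by auto
  define T' where "T' = the_inv_into (space M) T"
  have T': "AE x in M. (x, T' x) \<in> V" using T(2) by (simp add: T'_def)
  have "AE x in M. \<forall>i\<le>L. (x, g i x) \<in> F \<longleftrightarrow> (T' x, T' (g i x)) \<in> S"
    using AE_rel[OF T'] AE_space
  proof (eventually_elim, intro allI impI)
    fix u i assume h: "\<forall>y. (u, y) \<in> R \<longrightarrow> (y, T' y) \<in> V" and us: "u \<in> space M" and i: "i \<le> L"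
    have 1: "(u, T' u) \<in> V" and 2: "(g i u, T' (g i u)) \<in> V" using h us R_refl by auto
    obtain "is" ns j x where x: "x \<in> D is ns" "j < length ns" "u = g (is ! j) x" "T' u = g (ns ! j) x"
      using 1 unfolding Vchar by blast
    obtain is' ns' k y where y: "y \<in> D is' ns'" "k < length ns'" "g i u = g (is' ! k) y" "T' (g i u) = g (ns' ! k) y"
      using 2 unfolding Vchar by blast
    have l: "length ns = length is" "length ns' = length is'" and xy: "x \<in> E is" "y \<in> E is'" using D x y by blast+
    have xF: "(x, g (is ! j) x) \<in> F" "(y, g (is' ! k) y) \<in> F"
      using xy nth_mem[of j "is"] nth_mem[of k is'] x(2) y(2) l by (auto simp: E_def)
    have mem: "ns ! j \<in> set ns" "ns' ! k \<in> set ns'" using x y by auto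
    \<comment> \<open>Points of one F-class go to one tuple, which lies in a single S-class.
      Otherwise \<open>g i\<close> joins two F-classes, their least points are adjacent, and the
      targets are S-inequivalent.\<close>
    show "(u, g i u) \<in> F \<longleftrightarrow> (T' u, T' (g i u)) \<in> S"
    proof (cases "x = y")
      case True
      then have "is' = is" "ns' = ns" using Du x y by blast+
      then have "(T' u, T' (g i u)) \<in> S" using D[OF x(1)] x y mem True by (auto simp: tuple_in_def)
      moreover have "(u, g i u) \<in> F" using xF True x(3) y(3) Fst by (metis symD transD)
      ultimately show ?thesis by simp
    next
      case False
      have "(u, g i u) \<notin> F"
      proof
        assume "(u, g i u) \<in> F"
        then have "(x, y) \<in> F" using xF x(3) y(3) Fst by (metis symD transD)
        then show False using False Yu EY xy by blast
      qed
      moreover have "(x, y) \<in> R"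
      proof -
        have "(x, u) \<in> R" "(y, g i u) \<in> R" using xF FR x(3) y(3) by auto
        then show ?thesis using R_trans R_sym g_R[OF us, of i] by blast
      qed
      then have "(x, y) \<in> adj"
        unfolding adj_def using xF i x(3) y(3) by auto
      then have "(T' u, T' (g i u)) \<notin> S" using Dd[OF x(1) y(1) mem] x(4) y(4) False by auto
      ultimately show ?thesis by simp
    qed
  qed
  then show ?thesis using that[OF T(1)] by (simp add: T'_def)
qed

end

section \<open>Closures of orbits\<close>

text \<open>Sets of \<open>N\<close>-measure below powers of 1/2 have an \<open>N\<close>-null limit
  superior by Borel-Cantelli. If their \<open>L\<close>-measures were all at least \<open>e\<close>,
  so would be that of the limit superior, by continuity from above.\<close>

lemma absolutely_continuous_epsilon_delta:
  assumes fm: "finite_measure N" and fn: "finite_measure L" and s: "sets L = sets N"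
    and ac: "null_sets N \<subseteq> null_sets L" and e: "e > 0"
  shows "\<exists>d>0. \<forall>A\<in>sets N. measure N A < d \<longrightarrow> measure L A < e"
proof (rule ccontr)
  interpret N: finite_measure N by (rule fm)
  interpret L: finite_measure L by (rule fn)
  assume "\<not> ?thesis"
  then have "\<exists>A\<in>sets N. measure N A < (1/2)^n \<and> e \<le> measure L A" for n
    by (metis linorder_not_less zero_less_power half_gt_zero_iff zero_less_one)
  then obtain A where A: "\<And>n. A n \<in> sets N" "\<And>n. measure N (A n) < (1/2)^n" "\<And>n. e \<le> measure L (A n)"
    by metis
  have "summable (\<lambda>n. measure N (A n))"
    by (rule summable_comparison_test'[of "\<lambda>n. (1/2)^n" 0]) (auto intro: less_imp_le A(2))
  then have null: "limsup A \<in> null_sets N"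
    using A(1) by (intro borel_cantelli_limsup1) (auto simp: N.emeasure_eq_measure)
  define B where "B k = (\<Union>n\<in>{k..}. A n)" for k
  have Bm: "range B \<subseteq> sets L" using A(1) s by (auto simp: B_def)
  have dB: "decseq B" unfolding decseq_def B_def by (intro allI impI UN_mono) auto
  have "(\<lambda>k. measure L (B k)) \<longlonglongrightarrow> measure L (\<Inter>k. B k)"
    by (rule L.finite_Lim_measure_decseq[OF Bm dB])
  moreover have "e \<le> measure L (B k)" for k
  proof -
    have "measure L (A k) \<le> measure L (B k)"
      using Bm by (intro L.finite_measure_mono) (auto simp: B_def)
    then show ?thesis using A(3)[of k] by simp
  qed
  ultimately have "e \<le> measure L (\<Inter>k. B k)" by (intro LIMSEQ_le_const) auto
  moreover have "(\<Inter>k. B k) = limsup A" by (simp add: limsup_INF_SUP B_def)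
  then have "measure L (\<Inter>k. B k) = 0" using null ac by (auto intro: measure_eq_0_null_sets)
  ultimately show False using e by simp
qed

context pmp_rel begin

section \<open>Images under automorphisms and approximation of hyperfinite relations\<close>

lemma null_RM:
  assumes "A \<in> sets (M \<Otimes>\<^sub>M M)" "A \<subseteq> R" "AE x in M. A `` {x} = {}"
  shows "A \<in> null_sets RM"
proof -
  have "emeasure RM A = (\<integral>\<^sup>+x. emeasure (count_space UNIV) (A `` {x}) \<partial>M)"
    by (rule emeasure_RM[OF assms(1,2)])
  also have "\<dots> = (\<integral>\<^sup>+x. 0 \<partial>M)"
    by (rule nn_integral_cong_AE) (use assms(3) in eventually_elim, simp)
  finally show ?thesis using assms(1,2) by (auto simp: null_sets_def sets_RM)
qed

text \<open>This turns the image into a preimage under the inverse of \<open>T\<close>, which is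
  Borel whenever S is.\<close>

lemma automorphism_image:
  assumes T: "mp_automorphism M T" and SR: "S \<subseteq> R"
  shows "map_prod T T ` S \<inter> R =
    {(x, y). (x, y) \<in> R \<and> (the_inv_into (space M) T x, the_inv_into (space M) T y) \<in> S}"
proof -
  have bij: "bij_betw T (space M) (space M)" using T by (simp add: mp_automorphism_def)
  have i: "the_inv_into (space M) T (T x) = x" if "x \<in> space M" for x
    using bij that by (auto simp: bij_betw_def the_inv_into_f_f)
  have j: "T (the_inv_into (space M) T x) = x" if "x \<in> space M" for x
    using bij that by (auto simp: bij_betw_def f_the_inv_into_f)
  show ?thesis
  proof (intro subset_antisym subrelI)
    fix x y assume xy: "(x, y) \<in> map_prod T T ` S \<inter> R"
    then obtain a b where ab: "(a, b) \<in> S" "x = T a" "y = T b" by auto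
    then have "a \<in> space M" "b \<in> space M" using SR R_space[of a b] by auto
    moreover have "(x, y) \<in> R" using xy by simp
    ultimately show "(x, y) \<in> {(x, y). (x, y) \<in> R \<and> (the_inv_into (space M) T x, the_inv_into (space M) T y) \<in> S}"
      using i ab(1) unfolding ab(2,3) by simp
  next
    fix x y assume "(x, y) \<in> {(x, y). (x, y) \<in> R \<and> (the_inv_into (space M) T x, the_inv_into (space M) T y) \<in> S}"
    then have xy: "(x, y) \<in> R" "(the_inv_into (space M) T x, the_inv_into (space M) T y) \<in> S" by auto
    then have "(x, y) = map_prod T T (the_inv_into (space M) T x, the_inv_into (space M) T y)"
      using j R_space[of x y] by simp
    then show "(x, y) \<in> map_prod T T ` S \<inter> R" using xy by blast
  qed
qed

lemma borel_equiv_image: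
  assumes T: "mp_automorphism M T" and S: "borel_equiv M S" "S \<subseteq> R"
  shows "borel_equiv M (map_prod T T ` S \<inter> R)"
proof -
  define T' where "T' = the_inv_into (space M) T"
  have [measurable]: "T' \<in> measurable M M" "S \<in> sets (M \<Otimes>\<^sub>M M)"
    using T S by (auto simp: mp_automorphism_def borel_equiv_def T'_def)
  have T's: "T' x \<in> space M" if "x \<in> space M" for x
    using that measurable_space[of T' M M] by simp
  have Srefl: "(x, x) \<in> S" if "x \<in> space M" for x
    using S that by (auto simp: borel_equiv_def equiv_def refl_on_def)
  have eq: "map_prod T T ` S \<inter> R = {(x, y). (x, y) \<in> R \<and> (T' x, T' y) \<in> S}"
    unfolding T'_def by (rule automorphism_image[OF T S(2)])
  have "{(x, y). (x, y) \<in> R \<and> (T' x, T' y) \<in> S} \<in> sets (M \<Otimes>\<^sub>M M)"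
    by (intro rel_setI') measurable
  moreover have "equiv (space M) {(x, y). (x, y) \<in> R \<and> (T' x, T' y) \<in> S}"
  proof (rule equivI)
    show "refl_on (space M) {(x, y). (x, y) \<in> R \<and> (T' x, T' y) \<in> S}"
      using R_refl Srefl T's by (auto simp: refl_on_def)
    have S': "sym S" "trans S" using S by (auto simp: borel_equiv_def equiv_def)
    show "sym {(x, y). (x, y) \<in> R \<and> (T' x, T' y) \<in> S}"
      by (rule symI) (use S'(1) R_sym in \<open>auto dest: symD\<close>)
    show "trans {(x, y). (x, y) \<in> R \<and> (T' x, T' y) \<in> S}"
      by (rule transI) (use R_trans transD[OF S'(2)] in \<open>simp, metis\<close>)
  qed (use R_space in auto)
  ultimately show ?thesis by (simp add: eq borel_equiv_def)
qed

text \<open>The orbit lies in \<open>Sub M R\<close>, so passing to the subspace changes nothing,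
  and distances can be computed on representatives.\<close>

lemma closure_orbit_iff:
  assumes m: "equivalent_finite_measure RM m" and S: "borel_equiv M S" "S \<subseteq> R"
    and H: "borel_equiv M H" "H \<subseteq> R" and G: "G \<subseteq> Aut_rel M R"
  shows "mclass RM H \<in> Sub_topology M R m closure_of sub_orbit M R G S \<longleftrightarrow>
    (\<forall>e>0. \<exists>T\<in>G. measure m (sym_diff H (map_prod T T ` S \<inter> R)) < e)"
proof -
  interpret MS: Metric_space "MAlg RM" "malg_dist m" by (rule Metric_space_MAlg[OF m])
  have im: "borel_equiv M (map_prod T T ` S \<inter> R)" "map_prod T T ` S \<inter> R \<in> sets RM" if "T \<in> G" for T
    using borel_equiv_image[OF _ S, of T] that G by (auto simp: Aut_rel_def sets_RM borel_equiv_def)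
  have so: "sub_orbit M R G S = (\<lambda>T. mclass RM (map_prod T T ` S \<inter> R)) ` G"
    by (auto simp: sub_orbit_def)
  have sub: "sub_orbit M R G S \<subseteq> Sub M R"
    unfolding sub_orbit_def Sub_def using im by blast
  have Hs: "H \<in> sets RM" using H by (simp add: sets_RM borel_equiv_def)
  have HM: "mclass RM H \<in> MAlg RM" using Hs by (simp add: MAlg_def)
  have "mclass RM H \<in> Sub M R" using H by (auto simp: Sub_def)
  moreover have "sub_orbit M R G S \<subseteq> MAlg RM" using im(2) by (auto simp: sub_orbit_def MAlg_def)
  ultimately have "mclass RM H \<in> Sub_topology M R m closure_of sub_orbit M R G S \<longleftrightarrow>
    (\<forall>e>0. \<exists>C\<in>sub_orbit M R G S. malg_dist m (mclass RM H) C < e)"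
    using HM sub unfolding Sub_topology_def malg_topology_def closure_of_subtopology MS.metric_closure_of
    by (auto simp: Int_absorb1) (meson subsetD)+
  also have "\<dots> \<longleftrightarrow> (\<forall>e>0. \<exists>T\<in>G. malg_dist m (mclass RM H) (mclass RM (map_prod T T ` S \<inter> R)) < e)"
    unfolding so by simp
  also have "\<dots> \<longleftrightarrow> (\<forall>e>0. \<exists>T\<in>G. measure m (sym_diff H (map_prod T T ` S \<inter> R)) < e)"
    using im(2) malg_dist_eq[OF m Hs] by simp
  finally show ?thesis .
qed

text \<open>The error has three parts: \<open>H\<close> minus a finite stage \<open>F' n\<close>,
  the pairs in \<open>Q l\<close> that none of the first generators joins, and the rest, which is
  null for the \<open>T\<close> supplied by \<open>conjugate_to_finite\<close>.\<close>

lemma hyperfinite_in_closure: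
  assumes erg: "ergodic_rel M R" and m: "equivalent_finite_measure RM m"
    and S: "borel_equiv M S" "S \<subseteq> R"
    and inf: "aperiodic_rel M S" and eii: "everywhere_infinite_index M R S"
    and H: "borel_equiv M H" "H \<subseteq> R" "hyperfinite_rel M H" and e: "e > 0"
  shows "\<exists>T\<in>full_group M R. measure m (sym_diff H (map_prod T T ` S \<inter> R)) < e"
proof -
  interpret m: finite_measure m using m by (simp add: equivalent_finite_measure_def)
  have ms: "sets m = sets RM" and mn: "null_sets m = null_sets RM"
    using m by (auto simp: equivalent_finite_measure_def)
  have Sm [measurable]: "S \<in> sets (M \<Otimes>\<^sub>M M)" and Seq: "equiv (space M) S" using S by (auto simp: borel_equiv_def)
  have Hm [measurable]: "H \<in> sets (M \<Otimes>\<^sub>M M)" and Heq: "equiv (space M) H" using H by (auto simp: borel_equiv_def)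
  have Hrefl: "(x, x) \<in> H" if "x \<in> space M" for x using Heq that by (auto simp: equiv_def refl_on_def)
  obtain X0 F where X0 [measurable]: "X0 \<in> sets M" and X0n: "emeasure M (space M - X0) = 0"
    and F: "\<And>n. equiv X0 (F n)" "\<And>n. F n \<in> sets (M \<Otimes>\<^sub>M M)" "\<And>n x. x \<in> X0 \<Longrightarrow> finite (F n `` {x})"
      "\<And>n. F n \<subseteq> F (Suc n)" and FH: "H \<inter> (X0 \<times> X0) = (\<Union>n. F n)"
    using H(3) unfolding hyperfinite_rel_def by blast
  \<comment> \<open>The stages \<open>F n\<close> live on \<open>X0\<close>; the diagonal extends
    them to equivalence relations on the whole space.\<close>
  define F' where "F' n = F n \<union> Id_on (space M)" for n
  have X0s: "X0 \<subseteq> space M" using sets.sets_into_space[OF X0] .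
  have FX0: "F n \<subseteq> X0 \<times> X0" for n using F(1)[of n] by (auto simp: equiv_def)
  have F'm [measurable]: "F' n \<in> sets (M \<Otimes>\<^sub>M M)" for n unfolding F'_def using F(2) by simp
  have F'H: "F' n \<subseteq> H" for n using FH Hrefl by (auto simp: F'_def)
  have F'eq: "equiv (space M) (F' n)" for n
  proof (rule equivI)
    have st: "sym (F n)" "trans (F n)" using F(1)[of n] by (auto simp: equiv_def)
    show "sym (F' n)" by (rule symI) (use st(1) in \<open>auto simp: F'_def dest: symD\<close>)
    show "trans (F' n)" by (rule transI) (use transD[OF st(2)] in \<open>auto simp: F'_def Id_on_iff\<close>)
  qed (use FX0[of n] X0s in \<open>auto simp: F'_def refl_on_def\<close>)
  have F'fin: "finite (F' n `` {x})" if "x \<in> space M" for n x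
  proof (cases "x \<in> X0")
    case True
    have "F' n `` {x} \<subseteq> insert x (F n `` {x})" by (auto simp: F'_def)
    then show ?thesis using F(3)[OF True] by (meson finite_insert finite_subset)
  next
    case False
    then have "F' n `` {x} \<subseteq> {x}" using FX0[of n] by (auto simp: F'_def)
    then show ?thesis by (meson finite.intros finite_subset)
  qed
  have Fmono: "F i \<subseteq> F j" if "i \<le> j" for i j using that F(4) by (rule lift_Suc_mono_le[rotated])
  have "(\<lambda>n. measure m (H - F' n)) \<longlonglongrightarrow> measure m (\<Inter>n. H - F' n)"
  proof (rule m.finite_Lim_measure_decseq)
    show "range (\<lambda>n. H - F' n) \<subseteq> sets m" using H by (auto simp: ms sets_RM)
    show "decseq (\<lambda>n. H - F' n)" using Fmono by (fastforce simp: decseq_def F'_def)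
  qed
  moreover have "measure m (\<Inter>n. H - F' n) = 0"
  proof -
    have "(\<Inter>n. H - F' n) \<in> null_sets RM"
    proof (rule null_RM)
      have "AE x in M. x \<notin> space M - X0" using X0n by (intro AE_not_in) (auto simp: null_sets_def)
      from AE_rel[OF this] AE_space show "AE x in M. (\<Inter>n. H - F' n) `` {x} = {}"
      proof eventually_elim
        case (elim x)
        have "(x, y) \<in> (\<Union>n. F n)" if "(x, y) \<in> H" for y
        proof -
          have "(x, y) \<in> R" "(x, x) \<in> R" using that H R_refl elim by auto
          then have "x \<in> X0" "y \<in> X0" using elim R_space by blast+
          then show ?thesis using that FH by blast
        qed
        then show ?case by (auto simp: F'_def)
      qed
    qed (use H in auto)
    then show ?thesis by (intro measure_eq_0_null_sets) (simp add: mn)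
  qed
  ultimately have "\<forall>\<^sub>F n in sequentially. measure m (H - F' n) < e / 2"
    using e by (intro order_tendstoD) auto
  then obtain n where n: "measure m (H - F' n) < e / 2" by (meson eventually_sequentially order_refl)
  \<comment> \<open>Every pair of R is joined by some generator, so these sets decrease to the empty
    set.\<close>
  define Q where "Q l = {(x, y). (x, y) \<in> R \<and> (\<forall>i\<in>{..l}. y \<noteq> g i x)}" for l
  have Qm: "Q l \<in> sets (M \<Otimes>\<^sub>M M)" for l unfolding Q_def by (intro rel_setI') measurable
  have "(\<lambda>l. measure m (Q l)) \<longlonglongrightarrow> measure m (\<Inter>l. Q l)"
  proof (rule m.finite_Lim_measure_decseq)
    show "range Q \<subseteq> sets m" using Qm by (auto simp: ms sets_RM Q_def)
    show "decseq Q" by (auto simp: decseq_def Q_def)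
  qed
  moreover have "(\<Inter>l. Q l) = {}"
  proof (rule equals0I)
    fix z assume z: "z \<in> (\<Inter>l. Q l)"
    obtain x y where xy: "z = (x, y)" by (cases z)
    then have "(x, y) \<in> R" using z by (auto simp: Q_def)
    then obtain i where i: "y = g i x" using R_ex by blast
    have "(x, y) \<in> Q i" using z xy by blast
    then show False using i by (auto simp: Q_def)
  qed
  ultimately have "\<forall>\<^sub>F l in sequentially. measure m (Q l) < e / 2"
    using e by (intro order_tendstoD) auto
  then obtain l where l: "measure m (Q l) < e / 2" by (meson eventually_sequentially order_refl)
  have F'R: "F' n \<subseteq> R" using F'H H by blast
  obtain T where T: "T \<in> full_group M R" and TF:
    "AE x in M. \<forall>i\<le>l. (x, g i x) \<in> F' n \<longleftrightarrow> (the_inv_into (space M) T x, the_inv_into (space M) T (g i x)) \<in> S"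
    by (rule conjugate_to_finite[OF erg Sm S(2) Seq inf[unfolded aperiodic_rel_def] eii F'm F'R F'eq F'fin, of l])
      (assumption | rule that)+
  have Ta: "mp_automorphism M T" using T by (simp add: full_group_def Aut_rel_def)
  define S' where "S' = map_prod T T ` S \<inter> R"
  have S'm [measurable]: "S' \<in> sets (M \<Otimes>\<^sub>M M)" and S'R: "S' \<subseteq> R"
    using borel_equiv_image[OF Ta S] by (auto simp: S'_def borel_equiv_def)
  have "sym_diff (F' n) S' - Q l \<in> null_sets RM"
  proof (rule null_RM)
    show "AE x in M. (sym_diff (F' n) S' - Q l) `` {x} = {}"
      using TF
    proof eventually_elim
      case (elim x)
      have False if y: "(x, y) \<in> sym_diff (F' n) S' - Q l" for y
      proof -
        have xy: "(x, y) \<in> R" using y F'R S'R by auto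
        then obtain i where i: "i \<le> l" "y = g i x" using y by (auto simp: Q_def)
        then show False using elim y xy unfolding S'_def automorphism_image[OF Ta S(2)] by auto
      qed
      then show ?case by auto
    qed
  qed (use F'R S'R Qm in auto)
  then have z: "measure m (sym_diff (F' n) S' - Q l) = 0" by (intro measure_eq_0_null_sets) (simp add: mn)
  have "measure m (sym_diff H S') \<le> measure m ((H - F' n) \<union> ((sym_diff (F' n) S' - Q l) \<union> Q l))"
    using H F'R S'R F'H[of n] Qm by (intro m.finite_measure_mono) (auto simp: ms sets_RM Q_def)
  also have "\<dots> \<le> measure m (H - F' n) + measure m ((sym_diff (F' n) S' - Q l) \<union> Q l)"
    using H F'R S'R Qm by (intro measure_Un_le) (auto simp: ms sets_RM Q_def)
  also have "\<dots> \<le> measure m (H - F' n) + (measure m (sym_diff (F' n) S' - Q l) + measure m (Q l))"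
    using H F'R S'R Qm by (intro add_left_mono measure_Un_le) (auto simp: ms sets_RM Q_def)
  also have "\<dots> < e" using n l z by simp
  finally show ?thesis using T by (auto simp: S'_def)
qed


section \<open>Lower bounds on the distance to an orbit\<close>

lemma Domain_le_RM:
  assumes A: "A \<in> sets (M \<Otimes>\<^sub>M M)" and AR: "A \<subseteq> R"
  shows "emeasure M (Domain A) \<le> emeasure RM A"
proof -
  have "emeasure M (Domain A) = (\<integral>\<^sup>+x. indicator (Domain A) x \<partial>M)"
    using Domain_meas[OF A AR] by simp
  also have "\<dots> \<le> (\<integral>\<^sup>+x. emeasure (count_space UNIV) (A `` {x}) \<partial>M)"
  proof (rule nn_integral_mono)
    fix x
    show "indicator (Domain A) x \<le> emeasure (count_space UNIV) (A `` {x})"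
    proof (cases "x \<in> Domain A")
      case True
      then obtain y where "(x, y) \<in> A" by blast
      then have "emeasure (count_space UNIV) {y} \<le> emeasure (count_space UNIV) (A `` {x})"
        by (intro emeasure_mono) auto
      then show ?thesis using True by simp
    qed simp
  qed
  finally show ?thesis using emeasure_RM[OF A AR] by simp
qed

text \<open>Smallness in \<open>m\<close> does not by itself bound \<open>RM\<close>, which can be
  an infinite measure. The restriction of \<open>RM\<close> to \<open>E\<close> is finite and
  absolutely continuous with respect to \<open>m\<close>, so the epsilon-delta criterion applies to
  it.\<close>

lemma block_continuity:
  assumes m: "equivalent_finite_measure RM m" and E: "E \<in> sets (M \<Otimes>\<^sub>M M)" "E \<subseteq> R"
    and fin: "emeasure RM E < \<infinity>" and e: "e > 0"
  shows "\<exists>d>0. \<forall>A\<in>sets RM. measure m A < d \<longrightarrow> emeasure RM (A \<inter> E) < ennreal e"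
proof -
  define L where "L = density RM (indicator E)"
  have Es: "E \<in> sets RM" using E by (simp add: sets_RM)
  have L: "emeasure L A = emeasure RM (A \<inter> E)" if "A \<in> sets RM" for A
    unfolding L_def using that Es by (simp add: emeasure_density nn_integral_indicator' Int_commute flip: indicator_inter_arith)
  have "space RM \<in> sets RM" by simp
  then have "emeasure L (space L) \<le> emeasure RM E"
    using L Es by (auto simp: L_def intro!: emeasure_mono)
  then have fL: "finite_measure L" using fin by (intro finite_measureI) auto
  have "null_sets m \<subseteq> null_sets L"
  proof
    fix A assume "A \<in> null_sets m"
    then have A: "A \<in> null_sets RM" using m by (simp add: equivalent_finite_measure_def)
    then have "A \<inter> E \<in> null_sets RM" using Es by (rule null_set_Int2)
    then show "A \<in> null_sets L" using A L[of A] by (auto simp: null_sets_def L_def)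
  qed
  then obtain d where d: "d > 0" "\<forall>A\<in>sets m. measure m A < d \<longrightarrow> measure L A < e"
    using absolutely_continuous_epsilon_delta[OF _ fL _ _ e, of m] m
    by (auto simp: equivalent_finite_measure_def L_def)
  interpret L: finite_measure L by (rule fL)
  show ?thesis
  proof (intro exI[of _ d] conjI ballI impI)
    fix A assume A: "A \<in> sets RM" "measure m A < d"
    then have "measure L A < e" using d m by (auto simp: equivalent_finite_measure_def)
    then show "emeasure RM (A \<inter> E) < ennreal e"
      using L[OF A(1)] e by (simp add: L.emeasure_eq_measure ennreal_less_iff flip: L[OF A(1)])
  qed (use d in auto)
qed

lemma measure_preserving_preimage:
  assumes T: "mp_automorphism M T" and B: "B \<in> sets M"
  shows "{x \<in> space M. the_inv_into (space M) T x \<in> B} \<in> sets M"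
    "emeasure M {x \<in> space M. the_inv_into (space M) T x \<in> B} = emeasure M B"
proof -
  define T' where "T' = the_inv_into (space M) T"
  have [measurable]: "T \<in> measurable M M" "T' \<in> measurable M M" and p: "distr M M T = M"
    and bij: "bij_betw T (space M) (space M)"
    using T by (auto simp: mp_automorphism_def measure_pres_def T'_def)
  note [measurable] = B
  have C: "{x \<in> space M. T' x \<in> B} \<in> sets M" by measurable
  then show "{x \<in> space M. the_inv_into (space M) T x \<in> B} \<in> sets M" by (simp add: T'_def)
  have "T' (T x) = x" "T x \<in> space M" if "x \<in> space M" for x
    using bij that by (auto simp: bij_betw_def the_inv_into_f_f T'_def)
  then have "T -` {x \<in> space M. T' x \<in> B} \<inter> space M = B"
    using sets.sets_into_space[OF B] by auto
  then have "emeasure M B = emeasure (distr M M T) {x \<in> space M. T' x \<in> B}"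
    using C by (subst emeasure_distr) auto
  then show "emeasure M {x \<in> space M. the_inv_into (space M) T x \<in> B} = emeasure M B"
    using p by (simp add: T'_def)
qed

lemma inv_inj:
  assumes "mp_automorphism M T"
  shows "inj_on (the_inv_into (space M) T) (space M)" "x \<in> space M \<Longrightarrow> the_inv_into (space M) T x \<in> space M"
  using assms bij_betw_the_inv_into[of T "space M" "space M"]
  by (auto simp: mp_automorphism_def bij_betw_def)

text \<open>Failure of infinite index is pointwise; countable additivity makes one bound
  \<open>k\<close> uniform on a set of positive measure. The set \<open>Ak k\<close> consists of the
  points of \<open>A\<close> whose R-class contains no \<open>k + 1\<close> pairwise S-inequivalent
  points of \<open>A\<close>.\<close>

lemma finite_index_witness:
  assumes S [measurable]: "S \<in> sets (M \<Otimes>\<^sub>M M)" and Seq: "equiv (space M) S"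
    and n: "\<not> everywhere_infinite_index M R S"
  obtains B k where "B \<in> sets M" "emeasure M B > 0"
    "\<And>Z. finite Z \<Longrightarrow> Z \<subseteq> B \<Longrightarrow> Z \<times> Z \<subseteq> R \<Longrightarrow> card Z > k \<Longrightarrow> \<exists>y\<in>Z. \<exists>z\<in>Z. y \<noteq> z \<and> (y, z) \<in> S"
proof -
  obtain A where A [measurable]: "A \<in> sets M" "emeasure M A > 0"
    and nA: "\<not> (AE x in M. x \<in> A \<longrightarrow> infinite (((R \<inter> (A \<times> A)) `` {x}) // (S \<inter> (A \<times> A))))"
    using n unfolding everywhere_infinite_index_def by blast
  define Ak where "Ak k = {x \<in> space M. x \<in> A \<and> (\<forall>ns. length ns = Suc k \<longrightarrow> (\<forall>n\<in>set ns. g n x \<in> A) \<longrightarrow>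
    (\<exists>i\<in>{..<Suc k}. \<exists>j\<in>{..<Suc k}. i \<noteq> j \<and> (g (ns ! i) x, g (ns ! j) x) \<in> S))}" for k
  have Ak [measurable]: "Ak k \<in> sets M" for k unfolding Ak_def by measurable
  have "\<exists>k. emeasure M (Ak k) > 0"
  proof (rule ccontr)
    assume "\<not> ?thesis"
    then have "AE x in M. x \<notin> Ak k" for k by (intro AE_not_in) (auto simp: null_sets_def)
    then have "AE x in M. \<forall>k. x \<notin> Ak k" by (simp add: AE_all_countable)
    with AE_space have "AE x in M. x \<in> A \<longrightarrow> infinite (((R \<inter> (A \<times> A)) `` {x}) // (S \<inter> (A \<times> A)))"
    proof (eventually_elim, intro impI notI)
      fix x assume x: "x \<in> space M" "\<forall>k. x \<notin> Ak k" "x \<in> A"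
        and fq: "finite (((R \<inter> (A \<times> A)) `` {x}) // (S \<inter> (A \<times> A)))" (is "finite ?Q")
      define k where "k = card ?Q"
      obtain ns where ns: "length ns = Suc k" "\<And>n. n \<in> set ns \<Longrightarrow> g n x \<in> A"
        "\<And>i j. i < Suc k \<Longrightarrow> j < Suc k \<Longrightarrow> i \<noteq> j \<Longrightarrow> (g (ns ! i) x, g (ns ! j) x) \<notin> S"
        using x unfolding Ak_def by blast
      define f where "f i = (S \<inter> (A \<times> A)) `` {g (ns ! i) x}" for i
      have mem: "g (ns ! i) x \<in> A" if "i < Suc k" for i using ns(1,2) that by auto
      have "f ` {..<Suc k} \<subseteq> ?Q"
        unfolding f_def using mem x by (auto intro!: quotientI)
      moreover have "inj_on f {..<Suc k}"
      proof (rule inj_onI, rule ccontr)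
        fix i j assume ij: "i \<in> {..<Suc k}" "j \<in> {..<Suc k}" "f i = f j" "i \<noteq> j"
        have "g (ns ! j) x \<in> f j" using mem ij Seq x(1) by (auto simp: f_def equiv_def refl_on_def)
        then have "(g (ns ! i) x, g (ns ! j) x) \<in> S" unfolding ij(3)[symmetric] by (simp add: f_def)
        then show False using ns(3) ij by auto
      qed
      ultimately have "card {..<Suc k} \<le> card ?Q" using fq by (metis card_image card_mono)
      then show False by (simp add: k_def)
    qed
    then show False using nA by blast
  qed
  then obtain k where k: "emeasure M (Ak k) > 0" by blast
  show ?thesis
  proof (rule that[of "Ak k" k, OF Ak k])
    fix Z assume Z: "finite Z" "Z \<subseteq> Ak k" "Z \<times> Z \<subseteq> R" "card Z > k"
    obtain zs where zs: "distinct zs" "set zs \<subseteq> Z" "length zs = Suc k"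
    proof -
      obtain us where us: "set us = Z" "distinct us" using finite_distinct_list[OF Z(1)] by blast
      then have "length us \<ge> Suc k" using Z(4) distinct_card[of us] by simp
      then show ?thesis using us that[of "take (Suc k) us"] set_take_subset[of "Suc k" us] by auto
    qed
    \<comment> \<open>Any point of \<open>Z\<close> can serve as base point, because
      \<open>Z\<close> lies in one R-class and all its points satisfy the bound.\<close>
    obtain x where x: "x \<in> Z" using Z(4) by fastforce
    have zR: "(x, z) \<in> R" if "z \<in> set zs" for z using that zs Z(3) x by auto
    define ns where "ns = map (\<lambda>z. SOME n. z = g n x) zs"
    have gs: "g (SOME n. z = g n x) x = z" if "z \<in> set zs" for z
      using someI_ex[OF R_ex[OF zR[OF that]]] by simp
    have m: "map (\<lambda>n. g n x) ns = zs" unfolding ns_def by (simp add: map_idI gs)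
    have l: "length ns = Suc k" using zs by (simp add: ns_def)
    have gz: "g (ns ! i) x = zs ! i" if "i < Suc k" for i using that l m by (metis nth_map)
    have "g n x \<in> A" if "n \<in> set ns" for n
    proof -
      have "g n x \<in> set zs" using that unfolding m[symmetric] by simp
      then show ?thesis using zs(2) Z(2) by (auto simp: Ak_def)
    qed
    moreover have "x \<in> Ak k" using x Z by blast
    ultimately obtain i j where ij: "i < Suc k" "j < Suc k" "i \<noteq> j" "(g (ns ! i) x, g (ns ! j) x) \<in> S"
      using l unfolding Ak_def by blast
    have "zs ! i \<in> Z" "zs ! j \<in> Z" using ij zs nth_mem[of i zs] nth_mem[of j zs] by auto
    moreover have "zs ! i \<noteq> zs ! j" using ij zs nth_eq_iff_index_eq by metis
    moreover have "(zs ! i, zs ! j) \<in> S" using ij gz by simp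
    ultimately show "\<exists>y\<in>Z. \<exists>z\<in>Z. y \<noteq> z \<and> (y, z) \<in> S" by blast
  qed
qed

text \<open>On a translate of \<open>B\<close> every \<open>E\<close>-class has at most \<open>k\<close> points that are inequivalent under the
  translate of \<open>S\<close>, although by mass transport it meets this translate in more than \<open>2 * k\<close> points on
  average.\<close>

lemma infinite_index_if_Id_in_closure:
  assumes erg: "ergodic_rel M R" and infR: "AE x in M. infinite (R `` {x})"
    and m: "equivalent_finite_measure RM m" and S: "borel_equiv M S" "S \<subseteq> R"
    and cl: "\<And>e. e > 0 \<Longrightarrow> \<exists>T\<in>Aut_rel M R. measure m (sym_diff (Id_on (space M)) (map_prod T T ` S \<inter> R)) < e"
  shows "everywhere_infinite_index M R S"
proof (rule ccontr)
  assume ne: "\<not> everywhere_infinite_index M R S"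
  have Sm [measurable]: "S \<in> sets (M \<Otimes>\<^sub>M M)" and Seq: "equiv (space M) S" using S by (auto simp: borel_equiv_def)
  obtain B k where B [measurable]: "B \<in> sets M" and Bpos: "emeasure M B > 0"
    and Bk: "\<And>Z. finite Z \<Longrightarrow> Z \<subseteq> B \<Longrightarrow> Z \<times> Z \<subseteq> R \<Longrightarrow> card Z > k \<Longrightarrow> \<exists>y\<in>Z. \<exists>z\<in>Z. y \<noteq> z \<and> (y, z) \<in> S"
    by (rule finite_index_witness[OF Sm Seq ne]) (assumption | rule that)+
  define b where "b = prob B"
  have b: "b > 0" using Bpos by (simp add: b_def emeasure_eq_measure)
  \<comment> \<open>The factor 2 pays for the measure, less than \<open>b / 2\<close>, that is lost
    when \<open>Domain W\<close> is discarded.\<close>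
  obtain N0 :: nat where N0: "2 * real k / b < real N0" using reals_Archimedean2 by blast
  define N where "N = max 2 N0"
  have "2 * real k < real N0 * b" using N0 b by (simp add: divide_less_eq)
  also have "\<dots> \<le> real N * b" using b by (intro mult_right_mono) (auto simp: N_def)
  finally have N: "N \<ge> 2" "2 * real k < real N * b" by (auto simp: N_def)
  obtain E where Em [measurable]: "E \<in> sets (M \<Otimes>\<^sub>M M)" and ER: "E \<subseteq> R" and Eeq: "equiv (space M) E"
    and Efin: "\<And>x. x \<in> space M \<Longrightarrow> finite (E `` {x})" and Ecard: "AE x in M. card (E `` {x}) = N"
    by (rule block_relation[OF erg infR N(1)]) (assumption | rule that)+
  have Est: "sym E" "trans E" using Eeq by (auto simp: equiv_def)
  have Ecount: "AE x in M. emeasure (count_space UNIV) (E `` {x}) = of_nat N"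
    using Ecard AE_space by eventually_elim (simp add: Efin emeasure_count_space)
  have "emeasure RM E = (\<integral>\<^sup>+x. of_nat N \<partial>M)"
    unfolding emeasure_RM[OF Em ER] by (rule nn_integral_cong_AE[OF Ecount])
  then have "emeasure RM E < \<infinity>" by (simp add: emeasure_space_1 of_nat_less_top)
  then obtain d where d: "d > 0" "\<And>A. A \<in> sets RM \<Longrightarrow> measure m A < d \<Longrightarrow> emeasure RM (A \<inter> E) < ennreal (b / 2)"
    using block_continuity[OF m Em ER, of "b / 2"] b by auto
  obtain T where T: "T \<in> Aut_rel M R" and Td: "measure m (sym_diff (Id_on (space M)) (map_prod T T ` S \<inter> R)) < d"
    using cl[OF d(1)] by blast
  have Ta: "mp_automorphism M T" and TR: "AE x in M. (map_prod T T ` R) `` {x} = R `` {x}"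
    using T by (auto simp: Aut_rel_def rel_eq_ae_def)
  define T' where "T' = the_inv_into (space M) T"
  note inj = inv_inj[OF Ta, folded T'_def]
  define S' where "S' = map_prod T T ` S \<inter> R"
  have S'm [measurable]: "S' \<in> sets (M \<Otimes>\<^sub>M M)" and S'R: "S' \<subseteq> R"
    using borel_equiv_image[OF Ta S] by (auto simp: S'_def borel_equiv_def)
  have S'eq: "S' = {(x, y). (x, y) \<in> R \<and> (T' x, T' y) \<in> S}"
    unfolding S'_def T'_def by (rule automorphism_image[OF Ta S(2)])
  \<comment> \<open>These pairs lie in \<open>E\<close> and in the symmetric difference of the
    diagonal and \<open>S'\<close>, so the choice of \<open>d\<close> bounds their measure by
    \<open>b / 2\<close>.\<close>
  define W where "W = E \<inter> S' - Id_on (space M)"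
  have Wm: "W \<in> sets (M \<Otimes>\<^sub>M M)" "W \<subseteq> R" using ER by (auto simp: W_def)
  have IdR: "Id_on (space M) \<subseteq> R" using R_refl by auto
  have "emeasure M (Domain W) \<le> emeasure RM W" by (rule Domain_le_RM[OF Wm])
  also have "\<dots> \<le> emeasure RM (sym_diff (Id_on (space M)) S' \<inter> E)"
    using ER IdR S'R by (intro emeasure_mono) (auto simp: W_def sets_RM)
  also have "\<dots> < ennreal (b / 2)"
    using Td IdR S'R by (intro d(2)) (auto simp: sets_RM S'_def[symmetric])
  finally have Z': "prob (Domain W) < b / 2" using b by (simp add: emeasure_eq_measure ennreal_less_iff)
  define TB where "TB = {x \<in> space M. T' x \<in> B}"
  have TB [measurable]: "TB \<in> sets M" and TBm: "prob TB = b"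
    using measure_preserving_preimage[OF Ta B] by (auto simp: TB_def T'_def b_def measure_def)
  have Dm [measurable]: "Domain W \<in> sets M" by (rule Domain_meas[OF Wm])
  define C where "C = TB - Domain W"
  have Cm [measurable]: "C \<in> sets M" by (simp add: C_def)
  have "prob TB \<le> prob (C \<union> Domain W)" by (intro finite_measure_mono) (auto simp: C_def)
  also have "\<dots> \<le> prob C + prob (Domain W)" by (intro measure_Un_le) auto
  finally have Cb: "prob C > b / 2" using Z' TBm by simp
  define A where "A = {(x, y). (x, y) \<in> R \<and> (x, y) \<in> E \<and> y \<in> C}"
  have Am: "A \<in> sets (M \<Otimes>\<^sub>M M)" unfolding A_def by (intro rel_setI') measurable
  have AR: "A \<subseteq> R" by (auto simp: A_def)
  have Ak: "AE x in M. emeasure (count_space UNIV) (A `` {x}) \<le> of_nat k"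
    using TR AE_space
  proof eventually_elim
    case (elim x)
    have AE: "A `` {x} \<subseteq> E `` {x}" by (auto simp: A_def)
    then have fin: "finite (A `` {x})" using Efin[OF elim(2)] finite_subset by blast
    have As: "A `` {x} \<subseteq> space M" using AR R_space by auto
    \<comment> \<open>Here \<open>T\<close> has to preserve R and not just the measure; otherwise
      the preimages of related points need not be related.\<close>
    have xT: "(T' x, T' y) \<in> R" if "y \<in> A `` {x}" for y
    proof -
      have "y \<in> (map_prod T T ` R) `` {x}" using that AR elim by auto
      then have "(x, y) \<in> map_prod T T ` R \<inter> R" using that AR by auto
      then show ?thesis unfolding automorphism_image[OF Ta subset_refl] by (simp add: T'_def)
    qed
    \<comment> \<open>More than \<open>k\<close> points of a block, pulled back into
      \<open>B\<close>, would include two S-equivalent ones; the corresponding points of the block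
      form a pair in \<open>W\<close>, although \<open>C\<close> avoids
      \<open>Domain W\<close>.\<close>
    have "card (A `` {x}) \<le> k"
    proof (rule ccontr)
      assume "\<not> card (A `` {x}) \<le> k"
      then have "card (T' ` (A `` {x})) > k"
        using card_image[OF inj_on_subset[OF inj(1) As]] by simp
      moreover have "T' ` (A `` {x}) \<subseteq> B" by (auto simp: A_def C_def TB_def)
      moreover have "T' ` (A `` {x}) \<times> T' ` (A `` {x}) \<subseteq> R"
        using xT R_sym R_trans by blast
      ultimately obtain y z where yz: "y \<in> A `` {x}" "z \<in> A `` {x}" "T' y \<noteq> T' z" "(T' y, T' z) \<in> S"
        using Bk[of "T' ` (A `` {x})"] fin by blast
      have "(y, z) \<in> E" using yz(1,2) Est by (auto simp: A_def dest: symD transD)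
      then have "(y, z) \<in> W" using yz ER by (auto simp: W_def S'eq)
      then show False using yz(1) by (auto simp: A_def C_def)
    qed
    then show ?case using fin by (simp add: emeasure_count_space)
  qed
  \<comment> \<open>Counting \<open>A\<close> by second coordinates gives \<open>N\<close> pairs for
    almost every point of \<open>C\<close>, by first coordinates at most \<open>k\<close> pairs for
    almost every point.\<close>
  have "ennreal (real N * prob C) = (\<integral>\<^sup>+y. of_nat N * indicator C y \<partial>M)"
    by (subst nn_integral_cmult_indicator) (auto simp: emeasure_eq_measure ennreal_mult ennreal_of_nat_eq_real_of_nat)
  also have "\<dots> = (\<integral>\<^sup>+y. emeasure (count_space UNIV) (A\<inverse> `` {y}) \<partial>M)"
  proof (rule nn_integral_cong_AE)
    show "AE y in M. of_nat N * indicator C y = emeasure (count_space UNIV) (A\<inverse> `` {y})"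
      using Ecount
    proof eventually_elim
      case (elim y)
      have "A\<inverse> `` {y} = (if y \<in> C then E `` {y} else {})"
        using ER Est(1) by (auto simp: A_def dest: symD)
      then show ?case using elim by simp
    qed
  qed
  also have "\<dots> = emeasure RM A"
    using mass_transport[OF Am AR] emeasure_RM[OF converse_meas[OF Am] converse_R[OF AR]] by simp
  also have "\<dots> = (\<integral>\<^sup>+x. emeasure (count_space UNIV) (A `` {x}) \<partial>M)" by (rule emeasure_RM[OF Am AR])
  also have "\<dots> \<le> (\<integral>\<^sup>+x. of_nat k \<partial>M)" by (rule nn_integral_mono_AE[OF Ak])
  also have "\<dots> = ennreal (real k)" by (simp add: emeasure_space_1 ennreal_of_nat_eq_real_of_nat)
  finally have "real N * prob C \<le> real k" by simp
  moreover have "real N * (b / 2) \<le> real N * prob C" using Cb by (intro mult_left_mono) auto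
  ultimately show False using N(2) by simp
qed

text \<open>Blocks of more than \<open>K\<close> points cannot be approximated where classes have at
  most \<open>K\<close> points: each such point is unrelated to some point of its block. The set of
  these points has the same measure \<open>b\<close> for every image of S.\<close>

lemma aperiodic_if_hyperfinite_in_closure:
  assumes erg: "ergodic_rel M R" and infR: "AE x in M. infinite (R `` {x})"
    and m: "equivalent_finite_measure RM m" and S: "borel_equiv M S" "S \<subseteq> R"
    and cl: "\<And>H e. borel_equiv M H \<Longrightarrow> H \<subseteq> R \<Longrightarrow> hyperfinite_rel M H \<Longrightarrow> e > 0 \<Longrightarrow>
      \<exists>T\<in>Aut_rel M R. measure m (sym_diff H (map_prod T T ` S \<inter> R)) < e"
  shows "aperiodic_rel M S"
proof (rule ccontr)
  assume na: "\<not> aperiodic_rel M S"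
  have Sm [measurable]: "S \<in> sets (M \<Otimes>\<^sub>M M)" using S by (auto simp: borel_equiv_def)
  note [measurable] = fibre_meas[OF Sm S(2)]
  define P where "P K = {x \<in> space M. emeasure (count_space UNIV) (S `` {x}) \<le> of_nat K}" for K :: nat
  have Pm [measurable]: "P K \<in> sets M" for K unfolding P_def by measurable
  have P': "x \<in> P K \<longleftrightarrow> x \<in> space M \<and> finite (S `` {x}) \<and> card (S `` {x}) \<le> K" for x K
    by (auto simp: P_def emeasure_count_space top_unique)
  have "\<exists>K. emeasure M (P K) > 0"
  proof (rule ccontr)
    assume "\<not> ?thesis"
    then have "AE x in M. x \<notin> P K" for K by (intro AE_not_in) (auto simp: null_sets_def)
    then have "AE x in M. \<forall>K. x \<notin> P K" by (simp add: AE_all_countable)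
    with AE_space have "AE x in M. infinite (S `` {x})" by eventually_elim (auto simp: P')
    then show False using na by (simp add: aperiodic_rel_def)
  qed
  then obtain K where K: "emeasure M (P K) > 0" by blast
  define b where "b = prob (P K)"
  have b: "b > 0" using K by (simp add: b_def emeasure_eq_measure)
  \<comment> \<open>More than \<open>K\<close>, and at least 2 as \<open>block_relation\<close>
    requires.\<close>
  define N where "N = K + 2"
  obtain E where Em [measurable]: "E \<in> sets (M \<Otimes>\<^sub>M M)" and ER: "E \<subseteq> R" and Eeq: "equiv (space M) E"
    and Efin: "\<And>x. x \<in> space M \<Longrightarrow> finite (E `` {x})" and Ecard: "AE x in M. card (E `` {x}) = N"
    by (rule block_relation[OF erg infR, of N]) (simp add: N_def, (assumption | rule that)+)
  have Ecount: "AE x in M. emeasure (count_space UNIV) (E `` {x}) = of_nat N"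
    using Ecard AE_space by eventually_elim (simp add: Efin emeasure_count_space)
  have "emeasure RM E = (\<integral>\<^sup>+x. of_nat N \<partial>M)"
    unfolding emeasure_RM[OF Em ER] by (rule nn_integral_cong_AE[OF Ecount])
  then have "emeasure RM E < \<infinity>" by (simp add: emeasure_space_1 of_nat_less_top)
  then obtain d where d: "d > 0" "\<And>A. A \<in> sets RM \<Longrightarrow> measure m A < d \<Longrightarrow> emeasure RM (A \<inter> E) < ennreal b"
    using block_continuity[OF m Em ER _ b] by auto
  have "E \<subseteq> space M \<times> space M" using ER R_space by auto
  then have hyp: "hyperfinite_rel M E"
    unfolding hyperfinite_rel_def using Em Eeq Efin
    by (intro bexI[of _ "space M"] conjI exI[of _ "\<lambda>_. E"]) auto
  obtain T where T: "T \<in> Aut_rel M R" and Td: "measure m (sym_diff E (map_prod T T ` S \<inter> R)) < d"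
    using cl[OF _ ER hyp d(1)] Em Eeq by (auto simp: borel_equiv_def)
  have Ta: "mp_automorphism M T" using T by (auto simp: Aut_rel_def)
  define T' where "T' = the_inv_into (space M) T"
  note inj = inv_inj[OF Ta, folded T'_def]
  define S' where "S' = map_prod T T ` S \<inter> R"
  have S'm [measurable]: "S' \<in> sets (M \<Otimes>\<^sub>M M)" and S'R: "S' \<subseteq> R"
    using borel_equiv_image[OF Ta S] by (auto simp: S'_def borel_equiv_def)
  have S'eq: "S' = {(x, y). (x, y) \<in> R \<and> (T' x, T' y) \<in> S}"
    unfolding S'_def T'_def by (rule automorphism_image[OF Ta S(2)])
  define TP where "TP = {x \<in> space M. T' x \<in> P K}"
  have TP [measurable]: "TP \<in> sets M" and TPm: "emeasure M TP = ennreal b"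
    using measure_preserving_preimage[OF Ta Pm] by (auto simp: TP_def T'_def b_def emeasure_eq_measure)
  have ES: "E - S' \<in> sets (M \<Otimes>\<^sub>M M)" "E - S' \<subseteq> R" using ER by auto
  have "AE x in M. x \<in> TP \<longrightarrow> x \<in> Domain (E - S')"
    using Ecard AE_space
  proof (eventually_elim, intro impI)
    fix x assume x: "card (E `` {x}) = N" "x \<in> space M" "x \<in> TP"
    show "x \<in> Domain (E - S')"
    proof (rule ccontr)
      assume "x \<notin> Domain (E - S')"
      then have EX: "E `` {x} \<subseteq> S' `` {x}" by auto
      have fS: "finite (S `` {T' x})" "card (S `` {T' x}) \<le> K" using x(3) by (auto simp: TP_def P')
      have "T' ` (E `` {x}) \<subseteq> S `` {T' x}" using EX by (auto simp: S'eq)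
      then have "card (T' ` (E `` {x})) \<le> K" using fS by (meson card_mono le_trans)
      moreover have "E `` {x} \<subseteq> space M" using ER R_space by auto
      then have "card (T' ` (E `` {x})) = N" using x(1) card_image[OF inj_on_subset[OF inj(1)]] by metis
      ultimately show False by (simp add: N_def)
    qed
  qed
  then have "emeasure M TP \<le> emeasure M (Domain (E - S'))"
    using Domain_meas[OF ES] by (intro emeasure_mono_AE) auto
  also have "\<dots> \<le> emeasure RM (E - S')" by (rule Domain_le_RM[OF ES])
  also have "\<dots> \<le> emeasure RM (sym_diff E S' \<inter> E)"
    using ER S'R by (intro emeasure_mono) (auto simp: sets_RM)
  also have "\<dots> < ennreal b"
    using Td ER S'R by (intro d(2)) (auto simp: sets_RM S'_def[symmetric])
  finally show False using TPm by simp
qed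

end

section \<open>A Borel injection into the reals and an enumeration of generators\<close>

lemma ternary_less:
  fixes a b :: "nat \<Rightarrow> real"
  assumes a: "\<And>k. a k \<in> {0, 1}" and b: "\<And>k. b k \<in> {0, 1}"
    and eq: "\<And>k. k < n \<Longrightarrow> a k = b k" and n: "a n = 1" "b n = 0"
  shows "(\<Sum>k. b k * (1/3)^k) < (\<Sum>k. a k * (1/3)^k)"
proof -
  have s: "summable (\<lambda>k. (1/3::real)^k)" by (rule summable_geometric) simp
  have sm: "summable (\<lambda>k. f k * (1/3)^k)" if "\<And>k. f k \<in> {0, 1}" for f :: "nat \<Rightarrow> real"
  proof (rule summable_comparison_test'[OF s])
    fix k show "norm (f k * (1/3)^k) \<le> (1/3)^k" using that[of k] by auto
  qed
  have "(\<Sum>k. b k * (1/3)^k) = (\<Sum>k. b (k + Suc n) * (1/3)^(k + Suc n)) + (\<Sum>k<Suc n. b k * (1/3)^k)"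
    by (rule suminf_split_initial_segment[OF sm[OF b]])
  also have "(\<Sum>k. b (k + Suc n) * (1/3)^(k + Suc n)) \<le> (\<Sum>k. (1/3)^Suc n * (1/3)^k)"
  proof (rule suminf_le)
    fix k show "b (k + Suc n) * (1/3)^(k + Suc n) \<le> (1/3)^Suc n * (1/3)^k"
      using b[of "k + Suc n"] by (auto simp: power_add)
    show "summable (\<lambda>k. b (k + Suc n) * (1/3)^(k + Suc n))" using sm[OF b] by (subst summable_iff_shift)
    show "summable (\<lambda>k. (1/3)^Suc n * (1/3::real)^k)" by (rule summable_mult[OF s])
  qed
  \<comment> \<open>In base 3 the digits 0 and 1 leave a tail of at most half the term
    \<open>(1/3)^n\<close>; in base 2 the tail could equal the leading term, and distinct sequences
    could give the same number.\<close>
  also have "(\<Sum>k. (1/3)^Suc n * (1/3::real)^k) = (1/3)^Suc n * (3/2)"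
    by (subst suminf_mult[OF s]) (simp add: suminf_geometric)
  also have "(1/3)^Suc n * (3/2) + (\<Sum>k<Suc n. b k * (1/3)^k) < (\<Sum>k<Suc n. a k * (1/3)^k)"
    using n eq by simp
  also have "\<dots> \<le> (\<Sum>k. a k * (1/3)^k)"
  proof (rule sum_le_suminf[OF sm[OF a]])
    fix k show "0 \<le> a k * (1/3)^k" using a[of k] by auto
  qed auto
  finally show ?thesis by simp
qed

text \<open>A countable base separates points, so a point is determined by the sequence of its
  memberships in the base sets, and the ternary expansion turns this sequence into a real
  number.\<close>

lemma standard_borel_inj_real:
  assumes M: "standard_borel M"
  obtains c :: "'a \<Rightarrow> real" where "c \<in> borel_measurable M" "inj_on c (space M)"
proof -
  from M obtain T where T: "completely_metrizable_space T" "second_countable T"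
      "topspace T = space M" "sets M = sigma_sets (space M) {U. openin T U}"
    unfolding standard_borel_def by blast
  from T(2) obtain B where B0: "countable B" "\<forall>V\<in>B. openin T V"
      "\<forall>U x. openin T U \<and> x \<in> U \<longrightarrow> (\<exists>V\<in>B. x \<in> V \<and> V \<subseteq> U)"
    unfolding second_countable_def by (elim exE conjE)
  have H: "Hausdorff_space T"
    using T(1) completely_metrizable_imp_metrizable_space metrizable_imp_Hausdorff_space by blast
  have sep: "\<exists>V\<in>B. x \<in> V \<and> y \<notin> V" if xy: "x \<in> space M" "y \<in> space M" "x \<noteq> y" for x y
  proof -
    have "\<exists>U W. openin T U \<and> openin T W \<and> x \<in> U \<and> y \<in> W \<and> disjnt U W"
      using H xy T(3) unfolding Hausdorff_space_def by simp
    then obtain U W where U: "openin T U" "x \<in> U" "y \<in> W" "disjnt U W" by blast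
    then obtain V where "V \<in> B" "x \<in> V" "V \<subseteq> U" using B0(3) by blast
    then show ?thesis using U unfolding disjnt_def by blast
  qed
  \<comment> \<open>Inserting the empty set keeps the family nonempty, so that it has an enumeration
    by all naturals.\<close>
  define U where "U = from_nat_into (insert {} B)"
  have rU: "range U = insert {} B" unfolding U_def using B0(1) by (intro range_from_nat_into) auto
  have Bs: "V \<in> sets M" if "V \<in> B" for V
    unfolding T(4) using B0(2) that by (intro sigma_sets.Basic) simp
  have [measurable]: "U n \<in> sets M" for n
    using rangeI[of U n] Bs unfolding rU by auto
  define c where "c x = (\<Sum>n. indicat_real (U n) x * (1/3)^n)" for x
  have "inj_on c (space M)"
  proof (rule inj_onI, rule ccontr)
    fix x y assume xy: "x \<in> space M" "y \<in> space M" "c x = c y" "x \<noteq> y"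
    obtain V where "V \<in> B" "x \<in> V" "y \<notin> V" using sep xy by blast
    then have ex: "\<exists>n. indicat_real (U n) x \<noteq> indicat_real (U n) y"
      using rU by (metis imageE indicator_simps insertI2 zero_neq_one)
    define n where "n = (LEAST n. indicat_real (U n) x \<noteq> indicat_real (U n) y)"
    have n: "indicat_real (U n) x \<noteq> indicat_real (U n) y" unfolding n_def by (rule LeastI_ex[OF ex])
    have less: "indicat_real (U k) x = indicat_real (U k) y" if "k < n" for k
      using not_less_Least that unfolding n_def by blast
    have ind: "indicat_real (U k) z \<in> {0, 1}" for k z by (simp add: indicator_def)
    consider "indicat_real (U n) x = 1" "indicat_real (U n) y = 0" | "indicat_real (U n) y = 1" "indicat_real (U n) x = 0"
      using n ind[of n x] ind[of n y] by fastforce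
    then show False
    proof cases
      case 1
      have "c y < c x" unfolding c_def by (rule ternary_less[of "\<lambda>k. indicat_real (U k) x" "\<lambda>k. indicat_real (U k) y" n, OF ind ind less 1])
      then show False using xy by simp
    next
      case 2
      have "c x < c y" unfolding c_def by (rule ternary_less[of "\<lambda>k. indicat_real (U k) y" "\<lambda>k. indicat_real (U k) x" n, OF ind ind less[symmetric] 2])
      then show False using xy by simp
    qed
  qed
  moreover have "c \<in> borel_measurable M" unfolding c_def by measurable
  ultimately show ?thesis using that by blast
qed

lemma pmp_equiv_pmp_rel:
  assumes M: "standard_prob_space M" and R: "pmp_equiv M R"
  obtains g gi c where "pmp_rel M R g gi c"
proof -
  have p: "prob_space M" and sb: "standard_borel M" using M by (auto simp: standard_prob_space_def)
  obtain c :: "'a \<Rightarrow> real" where c: "c \<in> borel_measurable M" "inj_on c (space M)"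
    using standard_borel_inj_real[OF sb] by blast
  obtain G :: "nat monoid" and \<phi> where ga: "group_action G (space M) \<phi>"
    and mp: "\<forall>h\<in>carrier G. measure_pres M (\<phi> h)"
    and Req: "R = {(x, y). x \<in> space M \<and> y \<in> orbit G \<phi> x}"
    using R unfolding pmp_equiv_def by blast
  interpret ga: group_action G "space M" \<phi> by (rule ga)
  have grp: "group G" using ga.group_hom group_hom.axioms(1) by blast
  interpret group G by (rule grp)
  \<comment> \<open>The enumeration may repeat elements, so finite groups need no separate
    treatment.\<close>
  define e where "e = from_nat_into (carrier G)"
  have ne: "carrier G \<noteq> {}" using one_closed by blast
  have re: "range e = carrier G" unfolding e_def using ne by (intro range_from_nat_into) auto
  have ec: "e n \<in> carrier G" for n using re by blast
  define g where "g n = \<phi> (e n)" for n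
  define gi where "gi n = \<phi> (inv\<^bsub>G\<^esub> (e n))" for n
  have sp: "\<phi> h x \<in> space M" if "h \<in> carrier G" "x \<in> space M" for h x
    using ga.element_image[OF that refl] .
  have "pmp_rel M R g gi c"
  proof (intro pmp_rel.intro pmp_rel_axioms.intro p sb R c)
    show "R = {(x, y). x \<in> space M \<and> (\<exists>n. y = g n x)}"
    proof -
      have "y \<in> orbit G \<phi> x \<longleftrightarrow> (\<exists>n. y = g n x)" for x y
        unfolding orbit_def g_def re[symmetric] by auto
      then show ?thesis unfolding Req by auto
    qed
    show "equiv (space M) R"
    proof (rule equivI)
      show "R \<subseteq> space M \<times> space M" unfolding Req orbit_def using sp by auto
      show "refl_on (space M) R" unfolding Req refl_on_def using ga.orbit_refl by auto
      show "sym R"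
      proof (rule symI)
        fix x y assume "(x, y) \<in> R"
        then have h: "x \<in> space M" "y \<in> orbit G \<phi> x" by (auto simp: Req)
        then have "y \<in> space M" using sp by (auto simp: orbit_def)
        then show "(y, x) \<in> R" using ga.orbit_sym[OF h(1) _ h(2)] by (simp add: Req)
      qed
      show "trans R"
      proof (rule transI)
        fix x y z assume "(x, y) \<in> R" "(y, z) \<in> R"
        then have h: "x \<in> space M" "y \<in> space M" "y \<in> orbit G \<phi> x" "z \<in> orbit G \<phi> y" by (auto simp: Req)
        then have "z \<in> space M" using sp by (auto simp: orbit_def)
        then show "(x, z) \<in> R" using ga.orbit_trans[OF h(1,2) _ h(3,4)] h(1) by (simp add: Req)
      qed
    qed
  next
    fix n
    have ic: "inv\<^bsub>G\<^esub> (e n) \<in> carrier G" using ec by simp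
    show "g n \<in> measurable M M" "distr M M (g n) = M"
      using mp ec by (auto simp: g_def measure_pres_def)
    show "gi n \<in> measurable M M" "distr M M (gi n) = M"
      using mp ic by (auto simp: gi_def measure_pres_def)
    fix x assume x: "x \<in> space M"
    show "gi n (g n x) = x" unfolding g_def gi_def by (rule ga.orbit_sym_aux[OF ec x refl])
    show "g n (gi n x) = x" using ga.orbit_sym_aux[OF ic x refl] ec by (simp add: g_def gi_def)
  qed
  then show ?thesis by (rule that)
qed

theorem corollary4p12:
  fixes M :: "'a measure" and R S :: "('a \<times> 'a) set" and m :: "('a \<times> 'a) measure"
  assumes "standard_prob_space M"
    and "pmp_equiv M R" and "ergodic_rel M R"
    and "borel_equiv M S" and "S \<subseteq> R"
    and "equivalent_finite_measure (rel_measure M R) m"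
  shows
    "((aperiodic_rel M S \<and> everywhere_infinite_index M R S)
        \<longleftrightarrow> (aperiodic_rel M S \<and>
             mclass (rel_measure M R) (Id_on (space M))
               \<in> Sub_topology M R m closure_of sub_orbit M R (full_group M R) S)) \<and>
     ((aperiodic_rel M S \<and> everywhere_infinite_index M R S)
        \<longleftrightarrow> (aperiodic_rel M S \<and>
             mclass (rel_measure M R) (Id_on (space M))
               \<in> Sub_topology M R m closure_of sub_orbit M R (Aut_rel M R) S)) \<and>
     ((aperiodic_rel M S \<and> everywhere_infinite_index M R S)
        \<longleftrightarrow> Sub_hyp M R \<subseteq> Sub_topology M R m closure_of sub_orbit M R (full_group M R) S) \<and>
     ((aperiodic_rel M S \<and> everywhere_infinite_index M R S)
        \<longleftrightarrow> Sub_hyp M R \<subseteq> Sub_topology M R m closure_of sub_orbit M R (Aut_rel M R) S)"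
proof -
  obtain g gi c where "pmp_rel M R g gi c" using pmp_equiv_pmp_rel[OF assms(1,2)] .
  then interpret pmp_rel M R g gi c .
  let ?cl = "\<lambda>G. Sub_topology M R m closure_of sub_orbit M R G S"
  let ?I = "Id_on (space M)"
  have al: "atomless M" using assms(1) by (simp add: standard_prob_space_def)
  note infR = R_aperiodic[OF assms(3) al]
  have fA: "full_group M R \<subseteq> Aut_rel M R" by (auto simp: full_group_def)
  have mono: "?cl (full_group M R) \<subseteq> ?cl (Aut_rel M R)"
    using fA by (intro closure_of_mono) (auto simp: sub_orbit_def)
  note cl_iff = closure_orbit_iff[OF assms(6,4,5)]
  have I: "borel_equiv M ?I" "?I \<subseteq> R" "hyperfinite_rel M ?I"
  proof -
    show b: "borel_equiv M ?I"
      by (auto simp: borel_equiv_def equiv_def refl_on_def sym_def trans_def)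
    show "?I \<subseteq> R" using R_refl by auto
    have "?I `` {x} \<subseteq> {x}" for x by auto
    then have "finite (?I `` {x})" for x by (meson finite.intros finite_subset)
    then show "hyperfinite_rel M ?I"
      unfolding hyperfinite_rel_def using b
      by (intro bexI[of _ "space M"] conjI exI[of _ "\<lambda>_. ?I"]) (auto simp: borel_equiv_def)
  qed
  \<comment> \<open>The diagonal is hyperfinite, so the last two conditions put it into the
    closure.\<close>
  have I_hyp: "mclass RM ?I \<in> Sub_hyp M R" using I by (auto simp: Sub_hyp_def)
  have 1: "Sub_hyp M R \<subseteq> ?cl (full_group M R)" if "aperiodic_rel M S" "everywhere_infinite_index M R S"
    using hyperfinite_in_closure[OF assms(3,6,4,5) that] cl_iff[OF _ _ fA] by (auto simp: Sub_hyp_def)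
  have 2: "everywhere_infinite_index M R S" if "mclass RM ?I \<in> ?cl (Aut_rel M R)"
    using infinite_index_if_Id_in_closure[OF assms(3) infR assms(6,4,5)] that cl_iff[OF I(1,2) subset_refl] by blast
  have 3: "aperiodic_rel M S" if "Sub_hyp M R \<subseteq> ?cl (Aut_rel M R)"
  proof (rule aperiodic_if_hyperfinite_in_closure[OF assms(3) infR assms(6,4,5)])
    fix H and e :: real assume H: "borel_equiv M H" "H \<subseteq> R" "hyperfinite_rel M H" "e > 0"
    then have "mclass RM H \<in> ?cl (Aut_rel M R)" using that by (auto simp: Sub_hyp_def)
    then show "\<exists>T\<in>Aut_rel M R. measure m (sym_diff H (map_prod T T ` S \<inter> R)) < e"
      using cl_iff[OF H(1,2) subset_refl] H(4) by blast
  qed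
  \<comment> \<open>\<open>1\<close> leads from the first condition to the fourth,
    \<open>mono\<close> from the full group to all automorphisms, and \<open>2\<close> returns to
    infinite index. Aperiodicity is assumed in the second and third conditions and comes from
    \<open>3\<close> in the last two.\<close>
  show ?thesis using 1 2 3 mono I_hyp by blast
qed

end
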